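(* Let $\Omega$ be a bounded domain of $\mathbb{R}^N$, $N\ge3$, containing the origin, and let $1\le q<\frac{2N}{N-2}$. Then minimizers of $$\min_{u\in H,\ u\neq0}\ \frac{\|u\|^2_{H(\Omega)}}{\big(\int_\Omega|u|^q\,dx\big)^{2/q}}$$ cannot exist in $H_0^1(\Omega)$; that is, no minimizer of this problem belongs to $H_0^1(\Omega)$.
   Context: $H=H(\Omega)$ is the Hilbert space obtained as the completion of $C_0^\infty(\Omega)$ under the norm $\|\phi\|_H^2=\int_\Omega|\nabla\phi|^2dx-\big(\frac{N-2}{2}\big)^2\int_\Omega\frac{\phi^2}{|x|^2}dx$, $\phi\in C_0^\infty(\Omega)$, regarded as a space of functions on $\Omega$ (it embeds continuously in $L^p(\Omega)$ for $1\le p<\frac{2N}{N-2}$). $H_0^1(\Omega)$ is the usual Sobolev space, which is contained in $H$. *)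

theory Defs
  imports "HOL-Analysis.Analysis"
begin

primrec C_k :: "nat \<Rightarrow> ('a::euclidean_space \<Rightarrow> real) \<Rightarrow> bool" where
  "C_k 0 f \<longleftrightarrow> continuous_on UNIV f"
| "C_k (Suc k) f \<longleftrightarrow> (\<forall>x. f differentiable (at x)) \<and>
     (\<forall>i\<in>Basis. C_k k (\<lambda>x. frechet_derivative f (at x) i))"

text \<open>Test functions on \<open>\<Omega>\<close> are extended by zero to the whole space.\<close>

definition test_functions :: "'a::euclidean_space set \<Rightarrow> ('a \<Rightarrow> real) set" where
  "test_functions \<Omega> =
     {\<phi>. (\<forall>k. C_k k \<phi>) \<and> compact (closure {x. \<phi> x \<noteq> 0}) \<and> closure {x. \<phi> x \<noteq> 0} \<subseteq> \<Omega>}"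

definition grad :: "('a::euclidean_space \<Rightarrow> real) \<Rightarrow> 'a \<Rightarrow> 'a" where
  "grad f x = (\<Sum>i\<in>Basis. frechet_derivative f (at x) i *\<^sub>R i)"

definition tendsto_Lp ::
  "'a::euclidean_space set \<Rightarrow> real \<Rightarrow> (nat \<Rightarrow> 'a \<Rightarrow> 'b::euclidean_space) \<Rightarrow> ('a \<Rightarrow> 'b) \<Rightarrow> bool" where
  "tendsto_Lp \<Omega> p f u \<longleftrightarrow>
     (\<forall>n. f n \<in> borel_measurable (lebesgue_on \<Omega>)
        \<and> integrable (lebesgue_on \<Omega>) (\<lambda>x. norm (f n x) powr p)) \<and>
     u \<in> borel_measurable (lebesgue_on \<Omega>) \<and>
     integrable (lebesgue_on \<Omega>) (\<lambda>x. norm (u x) powr p) \<and>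
     (\<lambda>n. LINT x|lebesgue_on \<Omega>. norm (f n x - u x) powr p) \<longlonglongrightarrow> 0"

subsection \<open>The space \<open>H(\<Omega>)\<close>\<close>

text \<open>The norm on test functions. The radicand is nonnegative by Hardy's inequality;
  the value of \<open>(\<phi> x)\<^sup>2 / (norm x)\<^sup>2\<close> at \<open>x = 0\<close> is irrelevant, a point being a null set.\<close>

definition hardy_norm :: "'a::euclidean_space set \<Rightarrow> ('a \<Rightarrow> real) \<Rightarrow> real" where
  "hardy_norm \<Omega> \<phi> = sqrt (
     (LINT x|lebesgue_on \<Omega>. (norm (grad \<phi> x))\<^sup>2)
     - ((real DIM('a) - 2) / 2)\<^sup>2 * (LINT x|lebesgue_on \<Omega>. (\<phi> x)\<^sup>2 / (norm x)\<^sup>2))"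

text \<open>The completion is realised as a space of functions through its continuous (and injective)
  embedding into \<open>L\<^sup>p(\<Omega>)\<close>, \<open>1 \<le> p < 2N/(N-2)\<close>: the element of the completion
  given by a Cauchy sequence of test functions is identified with the limit of that sequence
  in these \<open>L\<^sup>p\<close> spaces, and its norm is the limit of the norms. As usual, functions are
  representatives of classes modulo equality almost everywhere in \<open>\<Omega>\<close>.\<close>

definition H_represents ::
  "'a::euclidean_space set \<Rightarrow> (nat \<Rightarrow> 'a \<Rightarrow> real) \<Rightarrow> ('a \<Rightarrow> real) \<Rightarrow> bool" where
  "H_represents \<Omega> \<phi> u \<longleftrightarrow>
     (\<forall>n. \<phi> n \<in> test_functions \<Omega>) \<and>
     (\<forall>e>0. \<exists>M. \<forall>m\<ge>M. \<forall>n\<ge>M. hardy_norm \<Omega> (\<lambda>x. \<phi> m x - \<phi> n x) < e) \<and>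
     (\<forall>p. 1 \<le> p \<and> p < 2 * real DIM('a) / (real DIM('a) - 2) \<longrightarrow> tendsto_Lp \<Omega> p \<phi> u)"

definition H_space :: "'a::euclidean_space set \<Rightarrow> ('a \<Rightarrow> real) set" where
  "H_space \<Omega> = {u. \<exists>\<phi>. H_represents \<Omega> \<phi> u}"

definition H_norm :: "'a::euclidean_space set \<Rightarrow> ('a \<Rightarrow> real) \<Rightarrow> real" where
  "H_norm \<Omega> u = (THE l. \<exists>\<phi>. H_represents \<Omega> \<phi> u \<and> (\<lambda>n. hardy_norm \<Omega> (\<phi> n)) \<longlonglongrightarrow> l)"

subsection \<open>The space \<open>H\<^sub>0\<^sup>1(\<Omega>)\<close>\<close>

definition weak_grad ::
  "'a::euclidean_space set \<Rightarrow> ('a \<Rightarrow> real) \<Rightarrow> ('a \<Rightarrow> 'a) \<Rightarrow> bool" where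
  "weak_grad \<Omega> u g \<longleftrightarrow>
     (\<forall>\<psi>\<in>test_functions \<Omega>. \<forall>i\<in>Basis.
        (LINT x|lebesgue_on \<Omega>. u x * (grad \<psi> x \<bullet> i)) = - (LINT x|lebesgue_on \<Omega>. (g x \<bullet> i) * \<psi> x))"

text \<open>The closure of the test functions in \<open>H\<^sup>1(\<Omega>)\<close>; \<open>tendsto_Lp\<close> includes that
  \<open>u\<close> and its weak gradient \<open>g\<close> are in \<open>L\<^sup>2(\<Omega>)\<close>.\<close>

definition H10_space :: "'a::euclidean_space set \<Rightarrow> ('a \<Rightarrow> real) set" where
  "H10_space \<Omega> = {u. \<exists>g \<phi>. weak_grad \<Omega> u g \<and> (\<forall>n. \<phi> n \<in> test_functions \<Omega>) \<and>
     tendsto_Lp \<Omega> 2 \<phi> u \<and> tendsto_Lp \<Omega> 2 (\<lambda>n. grad (\<phi> n)) g}"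

subsection \<open>The minimization problem\<close>

definition H_quotient :: "'a::euclidean_space set \<Rightarrow> real \<Rightarrow> ('a \<Rightarrow> real) \<Rightarrow> real" where
  "H_quotient \<Omega> q u =
     (H_norm \<Omega> u)\<^sup>2 / (LINT x|lebesgue_on \<Omega>. \<bar>u x\<bar> powr q) powr (2 / q)"

definition H_minimizer :: "'a::euclidean_space set \<Rightarrow> real \<Rightarrow> ('a \<Rightarrow> real) \<Rightarrow> bool" where
  "H_minimizer \<Omega> q =
     is_arg_min (H_quotient \<Omega> q)
       (\<lambda>u. u \<in> H_space \<Omega> \<and> \<not> (AE x in lebesgue_on \<Omega>. u x = 0))"

end

theory Submission
  imports Defs
begin

text \<open>
  Write \<open>N\<close> for the dimension, \<open>c = ((N - 2)/2)\<^sup>2\<close> and \<open>L \<psi> = - \<Delta>\<psi> - c \<psi>/|x|\<^sup>2\<close> (\<open>hardy_op\<close>),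
  and suppose that a minimizer \<open>u\<close> lies in \<open>H\<^sub>0\<^sup>1(\<Omega>)\<close>. Two properties of \<open>|u|\<close> exclude each other.

  First, \<open>|u|\<close> is a weak supersolution: \<open>\<integral> |u| L \<psi> \<ge> 0\<close> for all test functions \<open>\<psi> \<ge> 0\<close>
  (\<open>minimizer_abs_supersolution\<close>). Take test functions representing \<open>u\<close> in \<open>H(\<Omega>)\<close> and replace them
  by smooth approximations \<open>f\<^sub>n\<close> of their absolute values. This does not increase the Dirichlet integral
  and changes the Hardy term as little as desired, so \<open>f\<^sub>n\<close> is still a minimizing sequence, and it tends
  to \<open>|u|\<close> in every admissible \<open>L\<^sup>p\<close>. The competitor \<open>f\<^sub>n + t \<psi>\<close>, \<open>t > 0\<close>, has at least the \<open>L\<^sup>q\<close> norm of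
  \<open>f\<^sub>n\<close>, so its energy is at least the minimal one up to \<open>o(1)\<close>; letting \<open>n \<rightarrow> \<infinity>\<close> and then \<open>t \<rightarrow> 0\<close> gives
  the claim. The \<open>L\<^sup>q\<close> norm is never differentiated, so \<open>q = 1\<close> is no exception.

  Second, \<open>\<integral> u\<^sup>2/|x|\<^sup>2 < \<infinity>\<close> for \<open>u \<in> H\<^sub>0\<^sup>1(\<Omega>)\<close>, by Hardy's inequality and Fatou's lemma
  (\<open>H10_integrable_divide_norm2\<close>).

  The conflict is visible in the variable \<open>t = ln |x|\<close>: since
  \<open>L (|x|\<^bsup>-(N-2)/2\<^esup> \<eta>(t)) = - |x|\<^bsup>-(N-2)/2-2\<^esup> \<eta>''(t)\<close>, the spherical means of \<open>|x|\<^bsup>(N-2)/2\<^esup> |u|\<close> form a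
  concave function of \<open>t\<close> near \<open>-\<infinity>\<close>. A nonnegative concave function on a half-line to \<open>-\<infinity>\<close> is
  nonincreasing, so unless \<open>u\<close> vanishes near the origin, \<open>|u|\<close> is on average at least a multiple of
  \<open>|x|\<^bsup>-(N-2)/2\<^esup>\<close> there, and then \<open>\<integral> u\<^sup>2/|x|\<^sup>2 = \<infinity>\<close>. The proof of \<open>supersolution_vanishes_near_0\<close> expresses
  this by testing with one convex decreasing profile \<open>\<eta>\<close>, cut off ever closer to the origin. Finally
  \<open>- \<Delta>|u| \<ge> c |u|/|x|\<^sup>2 \<ge> 0\<close>, and the zero set of a nonnegative superharmonic function spreads over
  the connected set \<open>\<Omega>\<close> (\<open>supersolution_unique_continuation\<close>). So \<open>u = 0\<close> almost everywhere, and a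
  minimizer is not zero.

  Along the way the norm of \<open>H(\<Omega>)\<close> must be shown to be independent of the approximating sequence. For test
  functions, \<open>\<integral> \<nabla>\<chi> \<nabla>\<psi> - c \<chi> \<psi>/|x|\<^sup>2 = \<integral> \<chi> L \<psi>\<close>, and \<open>L \<psi>\<close> lies in the dual of an admissible \<open>L\<^sup>p\<close>
  because \<open>|x|\<^bsup>-2\<^esup>\<close> does so locally. Hence the form is continuous in its first argument for the
  convergence in \<open>L\<^sup>p\<close>, which makes it closable (\<open>hardy_norm_closable\<close>).
\<close>

section \<open>Smoothness on open sets\<close>

text \<open>The radial functions used below are compositions with \<open>ln\<close> and powers, which are smooth only away
  from the origin, so the global \<open>C_k\<close> is localised. Derivatives are still taken in the full
  neighbourhood of a point, hence the notion is meant for open sets.\<close>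

primrec C_on :: "nat \<Rightarrow> 'a::euclidean_space set \<Rightarrow> ('a \<Rightarrow> real) \<Rightarrow> bool" where
  "C_on 0 S f \<longleftrightarrow> continuous_on S f"
| "C_on (Suc k) S f \<longleftrightarrow> (\<forall>x\<in>S. f differentiable (at x)) \<and>
     (\<forall>i\<in>Basis. C_on k S (\<lambda>x. frechet_derivative f (at x) i))"

lemma C_k_iff_C_on: "C_k k f \<longleftrightarrow> C_on k UNIV f"
  by (induction k arbitrary: f) auto

lemma C_on_cong:
  assumes "open S" "\<And>x. x \<in> S \<Longrightarrow> f x = g x" "C_on k S f"
  shows "C_on k S g"
  using assms(2,3)
proof (induction k arbitrary: f g)
  case 0
  then show ?case by (auto cong: continuous_on_cong)
next
  case (Suc k)
  have dg: "(g has_derivative frechet_derivative f (at x)) (at x)" if "x \<in> S" for x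
    using that Suc.prems assms(1)
    by (auto intro!: has_derivative_transform_within_open[of f _ x UNIV S g]
        simp: frechet_derivative_works[symmetric])
  have "frechet_derivative f (at x) = frechet_derivative g (at x)" if "x \<in> S" for x
    using dg[OF that] by (rule frechet_derivative_at)
  then have "C_on k S (\<lambda>x. frechet_derivative g (at x) i)" if "i \<in> Basis" for i
    using Suc.IH[of "\<lambda>x. frechet_derivative f (at x) i" "\<lambda>x. frechet_derivative g (at x) i"] Suc.prems that by auto
  then show ?case using dg by (auto simp: differentiable_def)
qed

lemma C_on_SucI:
  assumes "open S" "\<And>x. x \<in> S \<Longrightarrow> (f has_derivative f' x) (at x)"
    and "\<And>i. i \<in> Basis \<Longrightarrow> C_on k S (\<lambda>x. f' x i)"
  shows "C_on (Suc k) S f"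
proof -
  have "f' x = frechet_derivative f (at x)" if "x \<in> S" for x
    using assms(2)[OF that] by (rule frechet_derivative_at)
  then have "C_on k S (\<lambda>x. frechet_derivative f (at x) i)" if "i \<in> Basis" for i
    using C_on_cong[OF assms(1) _ assms(3)[OF that]] by auto
  then show ?thesis using assms(2) by (auto simp: differentiable_def)
qed

lemma C_on_Suc_has_derivative:
  "C_on (Suc k) S f \<Longrightarrow> x \<in> S \<Longrightarrow> (f has_derivative frechet_derivative f (at x)) (at x)"
  by (simp add: frechet_derivative_works[symmetric])

lemma C_on_SucD: "C_on (Suc k) S f \<Longrightarrow> C_on k S f"
proof (induction k arbitrary: f)
  case 0
  then show ?case
    by (auto intro!: continuous_at_imp_continuous_on differentiable_imp_continuous_within)
next
  case (Suc k)
  show ?case unfolding C_on.simps(2)[of k]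
    using Suc.prems Suc.IH by (subst (asm) C_on.simps(2)) blast
qed

lemma C_on_subset: "C_on k S f \<Longrightarrow> T \<subseteq> S \<Longrightarrow> C_on k T f"
  by (induction k arbitrary: f) (auto intro: continuous_on_subset)

lemma C_on_Un:
  "open S \<Longrightarrow> open T \<Longrightarrow> C_on k S f \<Longrightarrow> C_on k T f \<Longrightarrow> C_on k (S \<union> T) f"
  by (induction k arbitrary: f) (auto intro: continuous_on_open_Un)

lemma C_on_const: "C_on k S (\<lambda>x. c)"
proof (induction k arbitrary: c)
  case (Suc k)
  show ?case
    using Suc by simp
qed simp

lemma C_on_add:
  "open S \<Longrightarrow> C_on k S f \<Longrightarrow> C_on k S g \<Longrightarrow> C_on k S (\<lambda>x. f x + g x)"
proof (induction k arbitrary: f g)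
  case (Suc k)
  show ?case
  proof (rule C_on_SucI)
    fix x assume "x \<in> S"
    then show "((\<lambda>x. f x + g x) has_derivative
      (\<lambda>h. frechet_derivative f (at x) h + frechet_derivative g (at x) h)) (at x)"
      using Suc.prems(2,3) by (intro has_derivative_add C_on_Suc_has_derivative)
  qed (use Suc in auto)
qed (auto intro: continuous_intros)

lemma C_on_mult:
  "open S \<Longrightarrow> C_on k S f \<Longrightarrow> C_on k S g \<Longrightarrow> C_on k S (\<lambda>x. f x * g x)"
proof (induction k arbitrary: f g)
  case (Suc k)
  show ?case
  proof (rule C_on_SucI)
    fix x assume "x \<in> S"
    then show "((\<lambda>x. f x * g x) has_derivative
      (\<lambda>h. f x * frechet_derivative g (at x) h + frechet_derivative f (at x) h * g x)) (at x)"
      using Suc.prems(2,3) by (intro has_derivative_mult C_on_Suc_has_derivative)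
  next
    fix i :: 'a assume "i \<in> Basis"
    then show "C_on k S (\<lambda>x. f x * frechet_derivative g (at x) i + frechet_derivative f (at x) i * g x)"
      using Suc.prems C_on_SucD[OF Suc.prems(2)] C_on_SucD[OF Suc.prems(3)]
      by (intro C_on_add Suc.IH) auto
  qed (use Suc in auto)
qed (auto intro: continuous_intros)

lemma C_on_cmult: "open S \<Longrightarrow> C_on k S f \<Longrightarrow> C_on k S (\<lambda>x. c * f x)"
  by (intro C_on_mult C_on_const)

lemma C_on_minus: "open S \<Longrightarrow> C_on k S f \<Longrightarrow> C_on k S (\<lambda>x. - f x)"
  using C_on_cmult[of S k f "-1"] by simp

lemma C_on_diff:
  "open S \<Longrightarrow> C_on k S f \<Longrightarrow> C_on k S g \<Longrightarrow> C_on k S (\<lambda>x. f x - g x)"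
  using C_on_add[of S k f "\<lambda>x. - g x"] C_on_minus[of S k g] by simp

lemma C_on_inner: "C_on k UNIV (\<lambda>x. (x - z) \<bullet> i)"
proof (cases k)
  case (Suc j)
  show ?thesis unfolding Suc
  proof (rule C_on_SucI)
    show "((\<lambda>x. (x - z) \<bullet> i) has_derivative (\<lambda>h. h \<bullet> i)) (at x)" for x
      by (auto intro!: derivative_eq_intros)
  qed (auto intro: C_on_const)
qed (auto intro!: continuous_intros)

lemma C_on_sum:
  "open S \<Longrightarrow> (\<And>i. i \<in> I \<Longrightarrow> C_on k S (f i)) \<Longrightarrow> C_on k S (\<lambda>x. \<Sum>i\<in>I. f i x)"
  by (induction I rule: infinite_finite_induct) (auto intro: C_on_const C_on_add)

lemma C_on_norm2: "C_on k S (\<lambda>x::'a::euclidean_space. (norm (x - z))\<^sup>2)"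
proof -
  have *: "(\<lambda>x. (norm (x - z))\<^sup>2) = (\<lambda>x. \<Sum>i\<in>Basis. ((x - z) \<bullet> i) * ((x - z) \<bullet> i))"
    by (simp only: power2_norm_eq_inner euclidean_inner[of "x - z" "x - z" for x])
  have "C_on k UNIV (\<lambda>x. (norm (x - z))\<^sup>2)"
    unfolding * by (intro C_on_sum C_on_mult C_on_inner) auto
  then show ?thesis by (rule C_on_subset) auto
qed

lemma C_on_compose:
  fixes h :: "real \<Rightarrow> real"
  assumes "open S" "open T"
  shows "C_on k T h \<Longrightarrow> C_on k S f \<Longrightarrow> f ` S \<subseteq> T \<Longrightarrow> C_on k S (\<lambda>x. h (f x))"
proof (induction k arbitrary: h)
  case 0
  then show ?case by (auto intro: continuous_on_compose2)
next
  case (Suc k)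
  show ?case
  proof (rule C_on_SucI)
    fix x assume x: "x \<in> S"
    then have "f x \<in> T" using Suc.prems by auto
    then have "(h has_derivative frechet_derivative h (at (f x))) (at (f x))"
      using Suc.prems by (intro C_on_Suc_has_derivative)
    moreover have "linear (frechet_derivative h (at (f x)))"
      using calculation by (rule has_derivative_linear)
    then have "frechet_derivative h (at (f x)) t = t * frechet_derivative h (at (f x)) 1" for t
      using linear_scale[of "frechet_derivative h (at (f x))" t 1] by simp
    then have "frechet_derivative h (at (f x)) = (\<lambda>t. t * frechet_derivative h (at (f x)) 1)"
      by (rule ext)
    ultimately have "(h has_derivative (\<lambda>t. t * frechet_derivative h (at (f x)) 1)) (at (f x))"
      by simp
    from has_derivative_compose[OF C_on_Suc_has_derivative[OF Suc.prems(2) x] this]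
    show "((\<lambda>x. h (f x)) has_derivative
       (\<lambda>i. frechet_derivative f (at x) i * frechet_derivative h (at (f x)) 1)) (at x)" .
  next
    fix i :: 'a assume "i \<in> Basis"
    then show "C_on k S (\<lambda>x. frechet_derivative f (at x) i * frechet_derivative h (at (f x)) 1)"
      using Suc.prems assms C_on_SucD[OF Suc.prems(2)]
      by (intro C_on_mult Suc.IH[of "\<lambda>t. frechet_derivative h (at t) 1"]) auto
  qed fact
qed

text \<open>Together with induction on \<open>k\<close> this proves smoothness of any family of real functions that is closed
  under differentiation.\<close>

lemma C_on_realI:
  fixes h :: "real \<Rightarrow> real"
  assumes "open S" "\<And>x. x \<in> S \<Longrightarrow> (h has_real_derivative h' x) (at x)" "C_on k S h'"
  shows "C_on (Suc k) S h"
  using assms(2,3) by (intro C_on_SucI[OF assms(1), where f'="\<lambda>x t. h' x * t"])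
    (auto simp: has_field_derivative_def)

lemma C_on_ident: "C_on k UNIV (\<lambda>x::real. x)"
  using C_on_inner[of k 0 "1::real"] by (simp add: inner_real_def)

lemma C_on_powr: "C_on k {0<..} (\<lambda>x::real. x powr a)"
proof (induction k arbitrary: a)
  case (Suc k)
  show ?case
    by (rule C_on_realI[where h'="\<lambda>x. a * x powr (a - 1)"])
      (auto intro!: derivative_eq_intros C_on_cmult Suc)
qed (auto intro!: continuous_intros)

lemma C_on_ln: "C_on k {0<..} (ln :: real \<Rightarrow> real)"
proof (cases k)
  case (Suc j)
  have "C_on j {0<..} (inverse::real\<Rightarrow>real)"
    by (rule C_on_cong[OF _ _ C_on_powr[of j "-1"]]) (auto simp: powr_minus)
  then show ?thesis unfolding Suc
    by (intro C_on_realI) (auto intro!: derivative_eq_intros simp: field_simps)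
qed (auto intro!: continuous_intros)

section \<open>A smooth function that is flat at the origin\<close>

text \<open>The standard function \<open>exp (-1/s)\<close> times integer powers of \<open>s\<close>, negative ones included. The whole
  family is considered because it is closed under differentiation up to linear combinations, which gives
  the smoothness of all members at once.\<close>

definition flat :: "int \<Rightarrow> real \<Rightarrow> real" where
  "flat j s = (if s \<le> 0 then 0 else s powi j * exp (- 1 / s))"

text \<open>Substituting \<open>1/s\<close>, this is the fact that \<open>exp\<close> grows faster than every power.\<close>

lemma flat_tendsto_0: "((\<lambda>s. flat j s) \<longlongrightarrow> 0) (at_right 0)"
proof -
  have "((\<lambda>y::real. y ^ nat \<bar>j\<bar> / exp y) \<longlongrightarrow> 0) at_top" by (rule tendsto_power_div_exp_0)
  then have "((\<lambda>s::real. inverse s ^ nat \<bar>j\<bar> / exp (inverse s)) \<longlongrightarrow> 0) (at_right 0)"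
    by (rule filterlim_compose[OF _ filterlim_inverse_at_top_right])
  then show ?thesis
  proof (rule Lim_null_comparison[rotated])
    show "\<forall>\<^sub>F s in at_right 0. norm (flat j s) \<le> inverse s ^ nat \<bar>j\<bar> / exp (inverse s)"
      unfolding eventually_at_right_field
    proof (intro exI[of _ 1] conjI allI impI)
      fix s :: real assume s: "0 < s" "s < 1"
      have "s powi j \<le> s powi (- \<bar>j\<bar>)" using s by (intro power_int_decreasing) auto
      also have "\<dots> = inverse s ^ nat \<bar>j\<bar>"
        using s by (auto simp: power_int_def power_inverse)
      finally show "norm (flat j s) \<le> inverse s ^ nat \<bar>j\<bar> / exp (inverse s)"
        using s by (simp add: flat_def exp_minus field_simps)
    qed simp
  qed
qed

lemma flat_has_derivative:
  "(flat j has_real_derivative (of_int j * flat (j - 1) s + flat (j - 2) s)) (at s)"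
proof -
  consider "s < 0" | "s > 0" | "s = 0" by linarith
  then show ?thesis
  proof cases
    case 1
    have "(flat j has_real_derivative 0) (at s)"
      by (rule has_field_derivative_transform_within_open[of "\<lambda>_. 0" _ _ "{..<0}"])
        (use 1 in \<open>auto simp: flat_def\<close>)
    then show ?thesis using 1 by (simp add: flat_def)
  next
    case 2
    have "((\<lambda>s. s powi j * exp (- 1 / s)) has_real_derivative
       (of_int j * flat (j - 1) s + flat (j - 2) s)) (at s)"
      using 2 by (auto intro!: derivative_eq_intros simp: flat_def power_int_diff power2_eq_square field_simps)
    then show ?thesis
      by (rule has_field_derivative_transform_within_open[of _ _ _ "{0<..}"])
        (use 2 in \<open>auto simp: flat_def\<close>)
  next
    case 3
    have "((\<lambda>h. (flat j (0 + h) - flat j 0) / h) \<longlongrightarrow> 0) (at 0)"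
    proof (subst filterlim_at_split, intro conjI)
      have "\<forall>\<^sub>F h in at_left 0. 0 = (flat j (0 + h) - flat j 0) / h"
        unfolding eventually_at_left_field by (rule exI[of _ "-1"]) (auto simp: flat_def)
      then show "((\<lambda>h. (flat j (0 + h) - flat j 0) / h) \<longlongrightarrow> 0) (at_left 0)"
        by (rule tendsto_eventually[OF eventually_mono]) auto
      show "((\<lambda>h. (flat j (0 + h) - flat j 0) / h) \<longlongrightarrow> 0) (at_right 0)"
      proof (rule Lim_transform_eventually[OF flat_tendsto_0[of "j - 1"]])
        show "\<forall>\<^sub>F h in at_right 0. flat (j - 1) h = (flat j (0 + h) - flat j 0) / h"
          unfolding eventually_at_right_field
          by (rule exI[of _ 1]) (auto simp: flat_def power_int_diff)
      qed
    qed
    then show ?thesis using 3 by (simp add: DERIV_def flat_def)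
  qed
qed

lemma C_on_flat: "C_on k UNIV (flat j)"
proof (induction k arbitrary: j)
  case 0
  then show ?case
    by (simp add: continuous_at_imp_continuous_on DERIV_isCont[OF flat_has_derivative])
next
  case (Suc k)
  show ?case
    by (rule C_on_realI[OF _ flat_has_derivative]) (auto intro!: C_on_add C_on_cmult Suc)
qed

section \<open>Test functions and integration by parts\<close>

abbreviation pd :: "'a::euclidean_space \<Rightarrow> ('a \<Rightarrow> real) \<Rightarrow> 'a \<Rightarrow> real" where
  "pd i f x \<equiv> frechet_derivative f (at x) i"

lemma test_functionsI:
  assumes "\<And>k. C_on k UNIV f" "compact K" "K \<subseteq> \<Omega>" "\<And>x. x \<notin> K \<Longrightarrow> f x = 0"
  shows "f \<in> test_functions \<Omega>"
proof -
  have "closure {x. f x \<noteq> 0} \<subseteq> K"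
    using assms(2,4) by (intro closure_minimal) (auto intro: compact_imp_closed)
  moreover have "compact (closure {x. f x \<noteq> 0})"
    unfolding compact_closure using assms(4)
    by (intro bounded_subset[OF compact_imp_bounded[OF assms(2)]]) auto
  ultimately show ?thesis
    using assms(1,3) by (auto simp: test_functions_def C_k_iff_C_on)
qed

lemma test_C_on: "f \<in> test_functions \<Omega> \<Longrightarrow> C_on k UNIV f"
  by (auto simp: test_functions_def C_k_iff_C_on)

lemma test_support:
  assumes "f \<in> test_functions \<Omega>"
  obtains K where "compact K" "K \<subseteq> \<Omega>" "\<And>x. x \<notin> K \<Longrightarrow> f x = 0"
proof (rule that)
  show "compact (closure {x. f x \<noteq> 0})" "closure {x. f x \<noteq> 0} \<subseteq> \<Omega>"
    using assms by (auto simp: test_functions_def)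
  show "f x = 0" if "x \<notin> closure {x. f x \<noteq> 0}" for x
    using that closure_subset[of "{x. f x \<noteq> 0}"] by auto
qed

lemma test_outside: "f \<in> test_functions \<Omega> \<Longrightarrow> x \<notin> \<Omega> \<Longrightarrow> f x = 0"
  by (metis test_support subsetD)

lemma test_has_derivative:
  "f \<in> test_functions \<Omega> \<Longrightarrow> (f has_derivative frechet_derivative f (at x)) (at x)"
  by (rule C_on_Suc_has_derivative[OF test_C_on]) auto

lemma test_continuous: "f \<in> test_functions \<Omega> \<Longrightarrow> continuous_on S f"
  using test_C_on[of f \<Omega> 0] by (auto intro: continuous_on_subset)

lemma test_zero: "(\<lambda>x. 0) \<in> test_functions \<Omega>"
  by (rule test_functionsI[of _ "{}"]) (auto intro: C_on_const)

lemma test_mult_smooth: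
  assumes "f \<in> test_functions \<Omega>" "\<And>k. C_on k UNIV g"
  shows "(\<lambda>x. f x * g x) \<in> test_functions \<Omega>"
proof -
  obtain K where "compact K" "K \<subseteq> \<Omega>" "\<And>x. x \<notin> K \<Longrightarrow> f x = 0"
    using test_support[OF assms(1)] by blast
  then show ?thesis
    by (intro test_functionsI[of _ K] C_on_mult test_C_on[OF assms(1)] assms(2)) auto
qed

lemma test_mult:
  "f \<in> test_functions \<Omega> \<Longrightarrow> g \<in> test_functions \<Omega> \<Longrightarrow> (\<lambda>x. f x * g x) \<in> test_functions \<Omega>"
  by (rule test_mult_smooth) (auto intro: test_C_on)

lemma test_cmult: "f \<in> test_functions \<Omega> \<Longrightarrow> (\<lambda>x. c * f x) \<in> test_functions \<Omega>"
  using test_mult_smooth[of f \<Omega> "\<lambda>_. c"] by (simp add: C_on_const mult.commute)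

lemma test_add:
  assumes "f \<in> test_functions \<Omega>" "g \<in> test_functions \<Omega>"
  shows "(\<lambda>x. f x + g x) \<in> test_functions \<Omega>"
proof -
  obtain K where K: "compact K" "K \<subseteq> \<Omega>" "\<And>x. x \<notin> K \<Longrightarrow> f x = 0"
    using test_support[OF assms(1)] by blast
  obtain L where "compact L" "L \<subseteq> \<Omega>" "\<And>x. x \<notin> L \<Longrightarrow> g x = 0"
    using test_support[OF assms(2)] by blast
  with K show ?thesis
    by (intro test_functionsI[of _ "K \<union> L"] C_on_add test_C_on[OF assms(1)] test_C_on[OF assms(2)]) auto
qed

lemma test_diff:
  "f \<in> test_functions \<Omega> \<Longrightarrow> g \<in> test_functions \<Omega> \<Longrightarrow> (\<lambda>x. f x - g x) \<in> test_functions \<Omega>"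
  using test_add[of f \<Omega> "\<lambda>x. (-1) * g x"] test_cmult[of g \<Omega> "-1"] by simp

lemma pd_eq_0_open:
  assumes "open U" "\<And>y. y \<in> U \<Longrightarrow> f y = 0" "x \<in> U"
  shows "pd i f x = 0"
proof -
  have "(f has_derivative (\<lambda>_. 0)) (at x)"
    by (rule has_derivative_transform_within_open[of "\<lambda>_. 0" _ _ _ U]) (use assms in auto)
  then show ?thesis by (metis frechet_derivative_at)
qed

lemma test_pd:
  assumes "f \<in> test_functions \<Omega>" "i \<in> Basis"
  shows "pd i f \<in> test_functions \<Omega>"
proof -
  obtain K where K: "compact K" "K \<subseteq> \<Omega>" "\<And>x. x \<notin> K \<Longrightarrow> f x = 0"
    using test_support[OF assms(1)] by blast
  show ?thesis
  proof (rule test_functionsI[OF _ K(1,2)])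
    show "C_on k UNIV (pd i f)" for k
      using test_C_on[OF assms(1), of "Suc k"] assms(2) by auto
    show "pd i f x = 0" if "x \<notin> K" for x
      using pd_eq_0_open[of "- K" f x i] K that by (auto intro: compact_imp_closed)
  qed
qed

lemma test_sum:
  "(\<And>i. i \<in> I \<Longrightarrow> f i \<in> test_functions \<Omega>) \<Longrightarrow> (\<lambda>x. \<Sum>i\<in>I. f i x) \<in> test_functions \<Omega>"
  by (induction I rule: infinite_finite_induct) (auto intro: test_zero test_add)

definition laplacian :: "('a::euclidean_space \<Rightarrow> real) \<Rightarrow> 'a \<Rightarrow> real" where
  "laplacian f x = (\<Sum>i\<in>Basis. pd i (pd i f) x)"

lemma test_laplacian: "f \<in> test_functions \<Omega> \<Longrightarrow> laplacian f \<in> test_functions \<Omega>"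
  unfolding laplacian_def[abs_def] by (intro test_sum test_pd)

lemma pd_add:
  "f \<in> test_functions \<Omega> \<Longrightarrow> g \<in> test_functions \<Omega> \<Longrightarrow> pd i (\<lambda>x. f x + g x) x = pd i f x + pd i g x"
  by (subst frechet_derivative_at[symmetric, OF has_derivative_add[OF test_has_derivative test_has_derivative]]) auto

lemma pd_cmult: "f \<in> test_functions \<Omega> \<Longrightarrow> pd i (\<lambda>x. c * f x) x = c * pd i f x"
  by (subst frechet_derivative_at[symmetric, OF has_derivative_mult_right[OF test_has_derivative]]) auto

lemma pd_mult:
  assumes "(f has_derivative f') (at x)" "(g has_derivative g') (at x)"
  shows "pd i (\<lambda>x. f x * g x) x = f x * g' i + f' i * g x"
  by (subst frechet_derivative_at[symmetric, OF has_derivative_mult[OF assms]]) auto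

lemma grad_inner: "grad f x \<bullet> grad g x = (\<Sum>i\<in>Basis. pd i f x * pd i g x)"
  unfolding grad_def by (simp add: inner_sum_left inner_sum_right inner_Basis if_distrib mult.commute cong: if_cong)

lemma test_bounded:
  assumes "f \<in> test_functions \<Omega>"
  obtains M where "M > 0" "\<And>x. \<bar>f x\<bar> \<le> M"
proof -
  obtain K where K: "compact K" "K \<subseteq> \<Omega>" "\<And>x. x \<notin> K \<Longrightarrow> f x = 0"
    using test_support[OF assms(1)] by blast
  have "bounded (f ` K)"
    by (intro compact_imp_bounded compact_continuous_image K test_continuous[OF assms])
  then obtain M where M: "M > 0" "\<And>x. x \<in> K \<Longrightarrow> \<bar>f x\<bar> \<le> M"
    unfolding bounded_pos by auto
  show ?thesis
    by (rule that[OF M(1)]) (metis M K(3) abs_zero less_imp_le)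
qed

lemma test_borel: "f \<in> test_functions \<Omega> \<Longrightarrow> f \<in> borel_measurable borel"
  by (intro borel_measurable_continuous_onI test_continuous)

lemma test_integrable:
  assumes "f \<in> test_functions \<Omega>"
  shows "integrable lborel f"
proof -
  obtain K where K: "compact K" "K \<subseteq> \<Omega>" "\<And>x. x \<notin> K \<Longrightarrow> f x = 0"
    using test_support[OF assms(1)] by blast
  have "integrable lborel (\<lambda>x. indicator K x *\<^sub>R f x)"
    by (intro borel_integrable_compact K test_continuous[OF assms])
  moreover have "(\<lambda>x. indicator K x *\<^sub>R f x) = f"
    using K(3) by (auto simp: indicator_def fun_eq_iff)
  ultimately show ?thesis by simp
qed

lemma integral_lebesgue_on_eq_lborel:
  fixes f :: "'a::euclidean_space \<Rightarrow> real"
  assumes "\<Omega> \<in> sets lebesgue" "f \<in> borel_measurable borel" "\<And>x. x \<notin> \<Omega> \<Longrightarrow> f x = 0"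
  shows "integral\<^sup>L (lebesgue_on \<Omega>) f = integral\<^sup>L lborel f"
    and "integrable (lebesgue_on \<Omega>) f \<longleftrightarrow> integrable lborel f"
proof -
  have *: "(\<lambda>x. indicator \<Omega> x *\<^sub>R f x) = f"
    using assms(3) by (auto simp: indicator_def fun_eq_iff)
  show "integral\<^sup>L (lebesgue_on \<Omega>) f = integral\<^sup>L lborel f"
    using assms by (simp add: integral_restrict_space * integral_completion del: real_scaleR_def)
  show "integrable (lebesgue_on \<Omega>) f \<longleftrightarrow> integrable lborel f"
    using assms by (simp add: integrable_restrict_space * integrable_completion del: real_scaleR_def)
qed

text \<open>All difference quotients integrate to \<open>0\<close>, as Lebesgue measure is invariant under translations.
  By the mean value theorem they are bounded by the supremum of the derivative, so dominated convergence
  passes this on to the derivative.\<close>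

lemma integral_pd_eq_0:
  fixes f :: "'a::euclidean_space \<Rightarrow> real"
  assumes f: "f \<in> test_functions \<Omega>" and i: "i \<in> Basis"
  shows "(LINT x|lborel. pd i f x) = 0"
proof -
  define t where "t n = inverse (real (Suc n))" for n
  have t: "0 < t n" "t n \<le> 1" for n by (auto simp: t_def inverse_le_1_iff)
  define g where "g n x = (f (x + t n *\<^sub>R i) - f x) / t n" for n x
  obtain M where M: "M > 0" "\<And>x. \<bar>pd i f x\<bar> \<le> M" using test_bounded[OF test_pd[OF f i]] by blast
  obtain K where K: "compact K" "K \<subseteq> \<Omega>" "\<And>x. x \<notin> K \<Longrightarrow> f x = 0"
    using test_support[OF f] by blast
  obtain R where R: "\<And>x. x \<in> K \<Longrightarrow> norm x \<le> R"
    using compact_imp_bounded[OF K(1)] unfolding bounded_iff by blast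
  have line: "((\<lambda>s. f (x + s *\<^sub>R i)) has_real_derivative pd i f (x + s *\<^sub>R i)) (at s)" for x s
  proof -
    have "((\<lambda>s. x + s *\<^sub>R i) has_derivative (\<lambda>h. h *\<^sub>R i)) (at s)"
      by (auto intro!: derivative_eq_intros)
    from has_derivative_compose[OF this test_has_derivative[OF f]]
    have "((\<lambda>s. f (x + s *\<^sub>R i)) has_derivative (\<lambda>h. frechet_derivative f (at (x + s *\<^sub>R i)) (h *\<^sub>R i))) (at s)" .
    moreover have "frechet_derivative f (at (x + s *\<^sub>R i)) (h *\<^sub>R i) = pd i f (x + s *\<^sub>R i) * h" for h
      using linear_scale[OF has_derivative_linear[OF test_has_derivative[OF f]], of "x + s *\<^sub>R i" h i]
      by (simp add: mult.commute)
    ultimately show ?thesis by (simp add: has_field_derivative_def)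
  qed
  have shift: "integrable lborel (\<lambda>x. f (x + v))" "(LINT x|lborel. f (x + v)) = (LINT x|lborel. f x)" for v
  proof -
    have "integrable (distr lborel borel ((+) v)) f"
      using test_integrable[OF f] by (simp add: lborel_distr_plus)
    then show "integrable lborel (\<lambda>x. f (x + v))"
      using test_borel[OF f] by (subst (asm) integrable_distr_eq) (auto simp: add.commute)
    have "(LINT x|lborel. f x) = (LINT x|distr lborel borel ((+) v). f x)"
      by (simp add: lborel_distr_plus)
    also have "\<dots> = (LINT x|lborel. f (x + v))"
      using test_borel[OF f] by (subst integral_distr) (auto simp: add.commute)
    finally show "(LINT x|lborel. f (x + v)) = (LINT x|lborel. f x)" ..
  qed
  have g_int: "integrable lborel (g n)" "(LINT x|lborel. g n x) = 0" for n
    unfolding g_def using shift test_integrable[OF f] by auto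
  have "(\<lambda>n. LINT x|lborel. g n x) \<longlonglongrightarrow> (LINT x|lborel. pd i f x)"
  proof (rule integral_dominated_convergence[where w="\<lambda>x. indicator (cball 0 (R + 1)) x *\<^sub>R M"])
    show "integrable lborel (\<lambda>x. indicator (cball 0 (R + 1)) x *\<^sub>R M)"
      by (intro borel_integrable_compact) auto
    show "AE x in lborel. (\<lambda>n. g n x) \<longlonglongrightarrow> pd i f x"
    proof (rule AE_I2)
      fix x :: 'a
      have "((\<lambda>h. (f (x + h *\<^sub>R i) - f x) / h) \<longlongrightarrow> pd i f x) (at 0)"
        using line[of x 0] by (simp add: DERIV_def)
      moreover have "filterlim t (at 0) sequentially"
        unfolding filterlim_at using t(1) LIMSEQ_inverse_real_of_nat
        by (auto simp: t_def[abs_def] less_imp_neq[symmetric])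
      ultimately show "(\<lambda>n. g n x) \<longlonglongrightarrow> pd i f x"
        unfolding g_def by (rule filterlim_compose)
    qed
    show "AE x in lborel. norm (g n x) \<le> indicator (cball 0 (R + 1)) x *\<^sub>R M" for n
    proof (rule AE_I2)
      fix x :: 'a
      show "norm (g n x) \<le> indicator (cball 0 (R + 1)) x *\<^sub>R M"
      proof (cases "x \<in> cball 0 (R + 1)")
        case True
        obtain z where "f (x + t n *\<^sub>R i) - f (x + 0 *\<^sub>R i) = (t n - 0) * pd i f (x + z *\<^sub>R i)"
          using MVT2[OF t(1)[of n], of "\<lambda>s. f (x + s *\<^sub>R i)" "\<lambda>s. pd i f (x + s *\<^sub>R i)"] line by blast
        then have "g n x = pd i f (x + z *\<^sub>R i)" using t(1)[of n] by (simp add: g_def)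
        then show ?thesis using M(2) True by simp
      next
        case False
        have "norm x \<le> norm (x + t n *\<^sub>R i) + norm (t n *\<^sub>R i)"
          by (metis add_diff_cancel norm_triangle_ineq4)
        then have "x \<notin> K" "x + t n *\<^sub>R i \<notin> K"
          using R[of x] R[of "x + t n *\<^sub>R i"] False t[of n] i by auto
        then show ?thesis using K(3) M by (simp add: g_def)
      qed
    qed
  qed (use test_borel[OF test_pd[OF f i]] borel_measurable_integrable[OF g_int(1)] in auto)
  then show ?thesis by (simp add: g_int LIMSEQ_const_iff)
qed

lemma integration_by_parts:
  assumes f: "f \<in> test_functions \<Omega>" and g: "g \<in> test_functions \<Omega>" and i: "i \<in> Basis"
  shows "(LINT x|lborel. pd i f x * g x) = - (LINT x|lborel. f x * pd i g x)"
proof -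
  have "0 = (LINT x|lborel. pd i (\<lambda>x. f x * g x) x)"
    by (simp add: integral_pd_eq_0[OF test_mult[OF f g] i])
  also have "\<dots> = (LINT x|lborel. f x * pd i g x + pd i f x * g x)"
    by (simp add: pd_mult[OF test_has_derivative[OF f] test_has_derivative[OF g]])
  also have "\<dots> = (LINT x|lborel. f x * pd i g x) + (LINT x|lborel. pd i f x * g x)"
    by (intro Bochner_Integration.integral_add test_integrable[of _ \<Omega>] test_mult test_pd f g i)
  finally show ?thesis by simp
qed

lemma green_identity:
  assumes f: "f \<in> test_functions \<Omega>" and g: "g \<in> test_functions \<Omega>"
  shows "(LINT x|lborel. grad f x \<bullet> grad g x) = - (LINT x|lborel. f x * laplacian g x)"
proof -
  have "(LINT x|lborel. grad f x \<bullet> grad g x) = (\<Sum>i\<in>Basis. LINT x|lborel. pd i f x * pd i g x)"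
    unfolding grad_inner
    by (intro Bochner_Integration.integral_sum test_integrable[of _ \<Omega>] test_mult test_pd f g)
  also have "\<dots> = (\<Sum>i\<in>Basis. - (LINT x|lborel. f x * pd i (pd i g) x))"
    by (intro sum.cong refl integration_by_parts[OF f test_pd[OF g]])
  also have "\<dots> = - (LINT x|lborel. f x * laplacian g x)"
    unfolding laplacian_def sum_negf sum_distrib_left
    by (subst Bochner_Integration.integral_sum) (auto intro!: test_integrable[of _ \<Omega>] test_mult test_pd f g)
  finally show ?thesis .
qed

section \<open>Local integrability of powers of the norm\<close>

text \<open>On a shell whose radii have the ratio \<open>e\<close> the weight varies only by the factor \<open>exp a\<close>, so that the
  volume of the outer ball is a sufficient bound. The bounds decay geometrically in \<open>k\<close> if \<open>a\<close> is less
  than the dimension and are constant if \<open>a\<close> equals it.\<close>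

lemma nn_integral_powr_shell:
  fixes a R :: real and k :: nat
  assumes a: "0 \<le> a" and R: "0 < R"
  defines "S \<equiv> {x::'a::euclidean_space. R * exp (- (real k + 1)) \<le> norm x \<and> norm x < R * exp (- real k)}"
  shows "(\<integral>\<^sup>+(x::'a). ennreal (indicator S x * norm x powr (- a)) \<partial>lborel)
    \<le> ennreal (unit_ball_vol DIM('a) * exp a * R powr (DIM('a) - a) * exp (- (DIM('a) - a)) ^ k)"
proof -
  let ?r = "R * exp (- (real k + 1))" and ?s = "R * exp (- real k)"
  have "(\<integral>\<^sup>+x. ennreal (indicator S x * norm x powr (- a)) \<partial>lborel)
    \<le> (\<integral>\<^sup>+x. ennreal (?r powr (- a)) * indicator (ball (0::'a) ?s) x \<partial>lborel)"
  proof (rule nn_integral_mono)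
    fix x :: 'a
    show "ennreal (indicator S x * norm x powr (- a)) \<le> ennreal (?r powr (- a)) * indicator (ball 0 ?s) x"
    proof (cases "x \<in> S")
      case True
      then have "norm x powr (- a) \<le> ?r powr (- a)"
        using a R by (intro powr_mono2') (auto simp: S_def)
      moreover have "x \<in> ball 0 ?s" using True by (auto simp: S_def)
      ultimately show ?thesis using True by (simp add: ennreal_leI)
    qed auto
  qed
  also have "\<dots> = ennreal (?r powr (- a)) * ennreal (unit_ball_vol DIM('a) * ?s ^ DIM('a))"
    using R by (subst nn_integral_cmult_indicator) (auto simp: emeasure_ball)
  also have "\<dots> = ennreal (?r powr (- a) * (unit_ball_vol DIM('a) * ?s ^ DIM('a)))"
    using R by (subst ennreal_mult) auto
  also have "?r powr (- a) * (unit_ball_vol DIM('a) * ?s ^ DIM('a))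
      = unit_ball_vol DIM('a) * exp a * R powr (DIM('a) - a) * exp (- (DIM('a) - a)) ^ k"
  proof -
    have s: "?s ^ DIM('a) = exp (DIM('a) * (ln R - real k))"
      using R by (simp add: exp_of_nat_mult exp_diff exp_minus divide_inverse)
    have r: "?r powr (- a) = exp (- a * (ln R - (real k + 1)))"
      using R by (simp add: powr_def ln_mult)
    have e: "exp (- (DIM('a) - a)) ^ k = exp (real k * (- (DIM('a) - a)))"
      by (simp only: exp_of_nat_mult)
    have p: "R powr (DIM('a) - a) = exp ((DIM('a) - a) * ln R)"
      using R by (simp add: powr_def)
    show ?thesis unfolding s r e p
      by (simp add: exp_add[symmetric] mult.assoc mult.left_commute[of _ "unit_ball_vol _"]) (simp add: algebra_simps)
  qed
  finally show ?thesis .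
qed

definition annulus :: "real \<Rightarrow> nat \<Rightarrow> 'a::euclidean_space set" where
  "annulus R n = {x. R * exp (- real n) \<le> norm x \<and> norm x < R}"

lemma annulus_measurable [measurable]: "annulus R n \<in> sets borel"
proof -
  have "annulus R n = (\<lambda>x. norm x) -` {R * exp (- real n)..<R} \<inter> space borel"
    by (auto simp: annulus_def)
  also have "\<dots> \<in> sets borel" by (rule measurable_sets[of _ _ borel]) auto
  finally show ?thesis .
qed

text \<open>The case \<open>a < N\<close> gives local integrability. For \<open>a = N\<close> the bound grows linearly in \<open>n\<close>, that is
  logarithmically in the ratio of the radii; this slow growth is what the cutoff near the origin
  relies on.\<close>

lemma nn_integral_powr_annulus:
  fixes a R :: real
  assumes a: "0 \<le> a" and R: "0 < R"
  shows "(\<integral>\<^sup>+(x::'a::euclidean_space). ennreal (indicator (annulus R n) x * norm x powr (- a)) \<partial>lborel)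
    \<le> ennreal (unit_ball_vol DIM('a) * exp a * R powr (DIM('a) - a) * (\<Sum>k<n. exp (- (DIM('a) - a)) ^ k))"
proof (induction n)
  case 0
  have "annulus R 0 = ({} :: 'a set)" by (auto simp: annulus_def)
  then show ?case by simp
next
  case (Suc n)
  let ?S = "{x::'a. R * exp (- (real n + 1)) \<le> norm x \<and> norm x < R * exp (- real n)}"
  have S: "?S \<in> sets borel"
  proof -
    have "?S = (\<lambda>x. norm x) -` {R * exp (- (real n + 1))..<R * exp (- real n)} \<inter> space borel" by auto
    also have "\<dots> \<in> sets borel" by (rule measurable_sets[of _ _ borel]) auto
    finally show ?thesis .
  qed
  have "exp (- (real n + 1)) \<le> exp (- real n)" "exp (- real n) \<le> 1" by auto
  then have ord: "R * exp (- (real n + 1)) \<le> R * exp (- real n)" "R * exp (- real n) \<le> R"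
    using R by auto
  have eq: "indicator (annulus R (Suc n)) x = indicator (annulus R n) x + (indicator ?S x :: real)" for x :: 'a
    using ord unfolding annulus_def by (auto simp: indicator_def add.commute)
  have "(\<integral>\<^sup>+(x::'a). ennreal (indicator (annulus R (Suc n)) x * norm x powr (- a)) \<partial>lborel)
    = (\<integral>\<^sup>+(x::'a). ennreal (indicator (annulus R n) x * norm x powr (- a)) + ennreal (indicator ?S x * norm x powr (- a)) \<partial>lborel)"
    by (intro nn_integral_cong) (simp only: eq distrib_right ennreal_plus[symmetric] mult_nonneg_nonneg indicator_pos_le powr_ge_zero)
  also have "\<dots> = (\<integral>\<^sup>+(x::'a). ennreal (indicator (annulus R n) x * norm x powr (- a)) \<partial>lborel)
     + (\<integral>\<^sup>+(x::'a). ennreal (indicator ?S x * norm x powr (- a)) \<partial>lborel)"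
    using S by (intro nn_integral_add) (auto intro!: measurable_compose[OF _ measurable_ennreal] borel_measurable_times borel_measurable_indicator)
  also have "\<dots> \<le> ennreal (unit_ball_vol DIM('a) * exp a * R powr (DIM('a) - a) * (\<Sum>k<n. exp (- (DIM('a) - a)) ^ k))
     + ennreal (unit_ball_vol DIM('a) * exp a * R powr (DIM('a) - a) * exp (- (DIM('a) - a)) ^ n)"
    by (intro add_mono Suc nn_integral_powr_shell a R)
  also have "\<dots> = ennreal (unit_ball_vol DIM('a) * exp a * R powr (DIM('a) - a) * (\<Sum>k<Suc n. exp (- (DIM('a) - a)) ^ k))"
    by (subst ennreal_plus[symmetric]) (auto simp: distrib_left intro!: mult_nonneg_nonneg sum_nonneg)
  finally show ?case .
qed

lemma integrable_norm_powr_ball: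
  fixes a R :: real
  assumes a: "0 \<le> a" "a < DIM('a::euclidean_space)" and R: "0 < R"
  shows "integrable lborel (\<lambda>x::'a. indicator (ball 0 R) x * norm x powr (- a))"
proof (rule integrableI_nonneg)
  let ?q = "exp (- (DIM('a) - a))"
  let ?C = "unit_ball_vol DIM('a) * exp a * R powr (DIM('a) - a)"
  have q: "0 < ?q" "?q < 1" using a by auto
  have "(\<integral>\<^sup>+(x::'a). ennreal (indicator (ball 0 R) x * norm x powr (- a)) \<partial>lborel) \<le> ennreal (?C * (1 / (1 - ?q)))"
  proof (rule LIMSEQ_le_const2)
    show "(\<lambda>n. \<integral>\<^sup>+(x::'a). ennreal (indicator (annulus R n) x * norm x powr (- a)) \<partial>lborel)
       \<longlonglongrightarrow> (\<integral>\<^sup>+(x::'a). ennreal (indicator (ball 0 R) x * norm x powr (- a)) \<partial>lborel)"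
    proof (rule nn_integral_LIMSEQ)
      show "mono (\<lambda>n (x::'a). ennreal (indicator (annulus R n) x * norm x powr (- a)))"
      proof (intro monoI le_funI ennreal_leI mult_right_mono)
        fix m n :: nat and x :: 'a assume "m \<le> n"
        then have "exp (- real n) \<le> exp (- real m)" by simp
        then have "R * exp (- real n) \<le> R * exp (- real m)" using R by simp
        then show "indicator (annulus R m) x \<le> (indicator (annulus R n) x :: real)"
          by (auto simp: annulus_def indicator_def)
      qed auto
      fix x :: 'a
      show "(\<lambda>n. ennreal (indicator (annulus R n) x * norm x powr (- a))) \<longlonglongrightarrow> ennreal (indicator (ball 0 R) x * norm x powr (- a))"
      proof (cases "x = 0")
        case False
        have "\<forall>\<^sub>F n in sequentially. R * exp (- real n) \<le> norm x"
          unfolding eventually_sequentially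
        proof (intro exI[of _ "nat \<lceil>ln (R / norm x)\<rceil>"] allI impI)
          fix n assume "nat \<lceil>ln (R / norm x)\<rceil> \<le> n"
          then have "ln (R / norm x) \<le> real n" by linarith
          then have "R / norm x \<le> exp (real n)" using False R by (metis exp_ln exp_le_cancel_iff divide_pos_pos zero_less_norm_iff)
          then show "R * exp (- real n) \<le> norm x" using False by (simp add: exp_minus field_simps)
        qed
        then have "\<forall>\<^sub>F n in sequentially. ennreal (indicator (annulus R n) x * norm x powr (- a))
             = ennreal (indicator (ball 0 R) x * norm x powr (- a))"
          by eventually_elim (auto simp: annulus_def indicator_def)
        then show ?thesis by (rule tendsto_eventually)
      qed simp
    qed measurable
    have "(\<integral>\<^sup>+(x::'a). ennreal (indicator (annulus R n) x * norm x powr (- a)) \<partial>lborel) \<le> ennreal (?C * (1 / (1 - ?q)))" for n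
    proof (rule order_trans[OF nn_integral_powr_annulus[OF a(1) R]])
      have "(\<Sum>k<n. ?q ^ k) \<le> (\<Sum>k. ?q ^ k)" using q by (intro sum_le_suminf summable_geometric) auto
      also have "\<dots> = 1 / (1 - ?q)" using q by (intro suminf_geometric) auto
      finally show "ennreal (?C * (\<Sum>k<n. ?q ^ k)) \<le> ennreal (?C * (1 / (1 - ?q)))"
        by (intro ennreal_leI mult_left_mono) auto
    qed
    then show "\<exists>N. \<forall>n\<ge>N. (\<integral>\<^sup>+(x::'a). ennreal (indicator (annulus R n) x * norm x powr (- a)) \<partial>lborel) \<le> ennreal (?C * (1 / (1 - ?q)))"
      by blast
  qed
  also have "\<dots> < \<infinity>" by simp
  finally show "(\<integral>\<^sup>+(x::'a). ennreal (indicator (ball 0 R) x * norm x powr (- a)) \<partial>lborel) < \<infinity>" .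
  have [measurable]: "ball (0::'a) R \<in> sets borel" by auto
  show "(\<lambda>x::'a. indicator (ball 0 R) x * norm x powr (- a)) \<in> borel_measurable lborel"
    unfolding measurable_lborel1 by measurable
qed auto

lemma inverse_norm2_eq_powr: "inverse ((norm x)\<^sup>2) = norm x powr (- 2)"
  by (cases "x = 0") (auto simp: powr_minus)

lemma integrable_divide_norm2:
  fixes h :: "'a::euclidean_space \<Rightarrow> real"
  assumes dim: "DIM('a) \<ge> 3" and h: "h \<in> test_functions \<Omega>"
  shows "integrable lborel (\<lambda>x. h x / (norm x)\<^sup>2)"
proof -
  obtain M where M: "M > 0" "\<And>x. \<bar>h x\<bar> \<le> M" using test_bounded[OF h] by blast
  obtain K where K: "compact K" "K \<subseteq> \<Omega>" "\<And>x. x \<notin> K \<Longrightarrow> h x = 0"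
    using test_support[OF h] by blast
  obtain R where R: "R > 0" "\<And>x. x \<in> K \<Longrightarrow> norm x < R"
    using compact_imp_bounded[OF K(1)] unfolding bounded_pos_less by blast
  have "integrable lborel (\<lambda>x::'a. M * (indicator (ball 0 R) x * norm x powr (- 2)))"
    using dim R by (intro integrable_mult_right integrable_norm_powr_ball) auto
  then show ?thesis
  proof (rule Bochner_Integration.integrable_bound)
    show "(\<lambda>x. h x / (norm x)\<^sup>2) \<in> borel_measurable lborel"
      using test_borel[OF h] by measurable
    show "AE x in lborel. norm (h x / (norm x)\<^sup>2) \<le> norm (M * (indicator (ball 0 R) x * norm x powr (- 2)))"
    proof (rule AE_I2)
      fix x
      show "norm (h x / (norm x)\<^sup>2) \<le> norm (M * (indicator (ball 0 R) x * norm x powr (- 2)))"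
      proof (cases "x \<in> K")
        case True
        then show ?thesis using R(2)[OF True] M(1) M(2)[of x]
          by (simp add: divide_inverse inverse_norm2_eq_powr abs_mult mult_right_mono)
      qed (simp add: K(3))
    qed
  qed
qed

section \<open>Hardy's inequality and the Hardy form\<close>

text \<open>With \<open>a = (N - 2)/2\<close> and \<open>r = 1/(|x|\<^sup>2 + e)\<close>, expand \<open>0 \<le> |\<nabla>f + a f r x|\<^sup>2\<close>; the mixed term is
  recovered from the divergence of \<open>f\<^sup>2 r x\<close>, whose integral vanishes. The regularisation keeps
  this vector field smooth, at the price of the inequality \<open>|x|\<^sup>2 r \<le> 1\<close>, which has the right direction.\<close>

lemma hardy_inequality_regularized:
  fixes f :: "'a::euclidean_space \<Rightarrow> real" and e :: real
  assumes dim: "DIM('a) \<ge> 3" and f: "f \<in> test_functions \<Omega>" and e: "e > 0"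
  shows "((real DIM('a) - 2) / 2)\<^sup>2 * (LINT x|lborel. (f x)\<^sup>2 * inverse ((norm x)\<^sup>2 + e))
    \<le> (LINT x|lborel. (norm (grad f x))\<^sup>2)"
proof -
  define a where "a = (real DIM('a) - 2) / 2"
  have N: "real DIM('a) = 2 * a + 2" by (simp add: a_def field_simps)
  have a0: "a \<ge> 0" using dim by (simp add: a_def)
  define r where "r = (\<lambda>x::'a. inverse ((norm x)\<^sup>2 + e))"
  have rho: "(norm x)\<^sup>2 + e > 0" for x :: 'a using e by (simp add: add_nonneg_pos)
  have C_r: "C_on k UNIV r" for k
  proof -
    have "C_on k UNIV (\<lambda>x::'a. (\<lambda>t. t powr (-1)) ((norm (x - 0))\<^sup>2 + e))"
      using rho by (intro C_on_compose[OF _ _ C_on_powr] C_on_add C_on_norm2 C_on_const) auto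
    moreover have "(\<lambda>t. t powr (-1)) ((norm (x - 0))\<^sup>2 + e) = r x" for x
      using rho[of x] by (simp add: r_def powr_minus)
    ultimately show ?thesis by simp
  qed
  have r_der: "(r has_derivative (\<lambda>h. - 2 * (x \<bullet> h) * (r x)\<^sup>2)) (at x)" for x
  proof -
    have "((\<lambda>x. inverse (x \<bullet> x + e)) has_derivative (\<lambda>h. - 2 * (x \<bullet> h) * (r x)\<^sup>2)) (at x)"
      using rho[of x] unfolding r_def power2_norm_eq_inner
      by (auto intro!: derivative_eq_intros simp: power2_eq_square[of "inverse _"] inner_commute)
    then show ?thesis unfolding r_def[abs_def] power2_norm_eq_inner .
  qed
  define F where "F i = (\<lambda>x. (f x * f x) * (((x - 0) \<bullet> i) * r x))" for i
  have F: "F i \<in> test_functions \<Omega>" for i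
    unfolding F_def by (intro test_mult_smooth test_mult f C_on_mult C_on_inner C_r) auto
  have pdF: "pd i (F i) x = 2 * f x * pd i f x * (x \<bullet> i) * r x
      + (f x)\<^sup>2 * (r x - 2 * (x \<bullet> i)\<^sup>2 * (r x)\<^sup>2)" if "i \<in> Basis" for i x
  proof -
    have "((\<lambda>x. f x * f x) has_derivative (\<lambda>h. f x * frechet_derivative f (at x) h + frechet_derivative f (at x) h * f x)) (at x)"
      by (intro has_derivative_mult test_has_derivative[OF f])
    moreover have "((\<lambda>x. ((x - 0) \<bullet> i) * r x) has_derivative (\<lambda>h. ((x - 0) \<bullet> i) * (- 2 * (x \<bullet> h) * (r x)\<^sup>2) + (h \<bullet> i) * r x)) (at x)"
      by (intro has_derivative_mult r_der) (auto intro!: derivative_eq_intros)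
    ultimately show ?thesis unfolding F_def
      using that by (subst pd_mult) (auto simp: power2_eq_square algebra_simps)
  qed
  \<comment> \<open>the divergence of \<open>f\<^sup>2 r x\<close>\<close>
  define G where "G x = (\<Sum>i\<in>Basis. pd i (F i) x)" for x
  have G: "G \<in> test_functions \<Omega>"
    unfolding G_def[abs_def] by (intro test_sum test_pd F)
  have G_int: "(LINT x|lborel. G x) = 0"
    unfolding G_def
    by (subst Bochner_Integration.integral_sum) (auto intro!: test_integrable[of _ \<Omega>] test_pd F sum.neutral integral_pd_eq_0[OF F])
  have G_eq: "G x = 2 * f x * r x * (grad f x \<bullet> x) + (f x)\<^sup>2 * (DIM('a) * r x - 2 * (norm x)\<^sup>2 * (r x)\<^sup>2)" for x
  proof -
    have "grad f x \<bullet> x = (\<Sum>i\<in>Basis. pd i f x * (x \<bullet> i))"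
      unfolding grad_def by (simp add: inner_sum_left inner_commute[of x])
    moreover have "(norm x)\<^sup>2 = (\<Sum>i\<in>Basis. (x \<bullet> i)\<^sup>2)"
      by (subst power2_norm_eq_inner, subst euclidean_inner) (simp add: power2_eq_square)
    ultimately show ?thesis unfolding G_def
      by (simp add: pdF sum.distrib sum_subtractf sum_distrib_left sum_distrib_right algebra_simps)
  qed
  have pw: "- a * G x \<le> (norm (grad f x))\<^sup>2 - a\<^sup>2 * ((f x)\<^sup>2 * r x)" for x
  proof -
    define y where "y = (norm x)\<^sup>2 * (r x)\<^sup>2"
    have "y \<le> r x"
    proof -
      have "(norm x)\<^sup>2 * r x \<le> 1" using rho[of x] e by (simp add: r_def field_simps)
      then have "((norm x)\<^sup>2 * r x) * r x \<le> 1 * r x"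
        using rho[of x] by (intro mult_right_mono) (auto simp: r_def less_imp_le)
      then show ?thesis by (simp add: y_def power2_eq_square mult.assoc)
    qed
    have "0 \<le> (norm (grad f x + (a * f x * r x) *\<^sub>R x))\<^sup>2" by simp
    also have "\<dots> = (norm (grad f x))\<^sup>2 + 2 * a * f x * r x * (grad f x \<bullet> x) + a\<^sup>2 * (f x)\<^sup>2 * y"
      unfolding y_def power2_norm_eq_inner
      by (simp add: inner_add_left inner_add_right inner_commute power2_eq_square algebra_simps)
    finally have 1: "0 \<le> (norm (grad f x))\<^sup>2 + 2 * a * f x * r x * (grad f x \<bullet> x) + a\<^sup>2 * (f x)\<^sup>2 * y" .
    have 2: "a * G x = 2 * a * f x * r x * (grad f x \<bullet> x) + a * (f x)\<^sup>2 * ((2 * a + 2) * r x - 2 * y)"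
      unfolding G_eq N y_def by (simp add: algebra_simps)
    have "0 \<le> (a\<^sup>2 + 2 * a) * (f x)\<^sup>2 * (r x - y)"
      using \<open>y \<le> r x\<close> a0 by simp
    also have "\<dots> = a * (f x)\<^sup>2 * ((2 * a + 2) * r x - 2 * y) - a\<^sup>2 * (f x)\<^sup>2 * y - a\<^sup>2 * ((f x)\<^sup>2 * r x)"
      by (simp add: algebra_simps power2_eq_square)
    finally show ?thesis using 1 2 by linarith
  qed
  have I1: "integrable lborel (\<lambda>x. (norm (grad f x))\<^sup>2)"
    unfolding power2_norm_eq_inner grad_inner
    by (intro Bochner_Integration.integrable_sum test_integrable[of _ \<Omega>] test_mult test_pd f)
  have I2: "integrable lborel (\<lambda>x. (f x)\<^sup>2 * r x)"
    unfolding power2_eq_square by (intro test_integrable[of _ \<Omega>] test_mult_smooth test_mult f C_r)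
  have "(LINT x|lborel. - a * G x) \<le> (LINT x|lborel. (norm (grad f x))\<^sup>2 - a\<^sup>2 * ((f x)\<^sup>2 * r x))"
    using pw I1 I2 test_integrable[OF G] by (intro integral_mono) auto
  then show ?thesis using I1 I2 G_int by (simp add: a_def r_def)
qed

lemma hardy_inequality:
  fixes f :: "'a::euclidean_space \<Rightarrow> real"
  assumes dim: "DIM('a) \<ge> 3" and f: "f \<in> test_functions \<Omega>"
  shows "((real DIM('a) - 2) / 2)\<^sup>2 * (LINT x|lborel. (f x)\<^sup>2 / (norm x)\<^sup>2)
    \<le> (LINT x|lborel. (norm (grad f x))\<^sup>2)"
proof -
  define t where "t n = inverse (real (Suc n))" for n
  have "(\<lambda>n. LINT x|lborel. (f x)\<^sup>2 * inverse ((norm x)\<^sup>2 + t n)) \<longlonglongrightarrow> (LINT x|lborel. (f x)\<^sup>2 / (norm x)\<^sup>2)"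
  proof (rule integral_dominated_convergence[where w="\<lambda>x. (f x)\<^sup>2 / (norm x)\<^sup>2"])
    show "integrable lborel (\<lambda>x. (f x)\<^sup>2 / (norm x)\<^sup>2)"
      using integrable_divide_norm2[OF dim test_mult[OF f f]] by (simp add: power2_eq_square)
    have nz: "AE x in lborel. x \<noteq> (0::'a)" by (rule AE_lborel_singleton)
    show "AE x in lborel. (\<lambda>n. (f x)\<^sup>2 * inverse ((norm x)\<^sup>2 + t n)) \<longlonglongrightarrow> (f x)\<^sup>2 / (norm x)\<^sup>2"
      using nz
    proof eventually_elim
      case (elim x)
      have "t \<longlonglongrightarrow> 0" unfolding t_def[abs_def] by (rule LIMSEQ_inverse_real_of_nat)
      then have "(\<lambda>n. (f x)\<^sup>2 * inverse ((norm x)\<^sup>2 + t n)) \<longlonglongrightarrow> (f x)\<^sup>2 * inverse ((norm x)\<^sup>2 + 0)"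
        using elim by (intro tendsto_intros) auto
      then show ?case by (simp add: divide_inverse)
    qed
    show "AE x in lborel. norm ((f x)\<^sup>2 * inverse ((norm x)\<^sup>2 + t n)) \<le> (f x)\<^sup>2 / (norm x)\<^sup>2" for n
      using nz
    proof eventually_elim
      case (elim x)
      have "0 < t n" by (simp add: t_def)
      then have "inverse ((norm x)\<^sup>2 + t n) \<le> inverse ((norm x)\<^sup>2)" "0 \<le> inverse ((norm x)\<^sup>2 + t n)"
        using elim by (auto intro!: le_imp_inverse_le)
      then show ?case by (simp add: divide_inverse mult_left_mono abs_mult)
    qed
  qed (use test_borel[OF f] in measurable)
  then have "(\<lambda>n. ((real DIM('a) - 2) / 2)\<^sup>2 * (LINT x|lborel. (f x)\<^sup>2 * inverse ((norm x)\<^sup>2 + t n)))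
     \<longlonglongrightarrow> ((real DIM('a) - 2) / 2)\<^sup>2 * (LINT x|lborel. (f x)\<^sup>2 / (norm x)\<^sup>2)"
    by (rule tendsto_mult_left)
  then show ?thesis
    by (rule LIMSEQ_le_const2) (auto intro!: exI[of _ 0] hardy_inequality_regularized[OF dim f] simp: t_def simp del: of_nat_Suc)
qed

definition hardy_form :: "('a::euclidean_space \<Rightarrow> real) \<Rightarrow> ('a \<Rightarrow> real) \<Rightarrow> real" where
  "hardy_form f g = (LINT x|lborel. grad f x \<bullet> grad g x)
     - ((real DIM('a) - 2) / 2)\<^sup>2 * (LINT x|lborel. f x * g x / (norm x)\<^sup>2)"

text \<open>The Schroedinger operator \<open>- \<Delta> - c/|x|\<^sup>2\<close> of the form \<open>hardy_form\<close>.\<close>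

definition hardy_op :: "('a::euclidean_space \<Rightarrow> real) \<Rightarrow> 'a \<Rightarrow> real" where
  "hardy_op g x = - laplacian g x - ((real DIM('a) - 2) / 2)\<^sup>2 * (g x / (norm x)\<^sup>2)"

lemma hardy_form_nonneg:
  fixes f :: "'a::euclidean_space \<Rightarrow> real"
  assumes "DIM('a) \<ge> 3" "f \<in> test_functions \<Omega>"
  shows "0 \<le> hardy_form f f"
  using hardy_inequality[OF assms]
  by (simp add: hardy_form_def dot_square_norm power2_eq_square[of "f x" for x, symmetric])

lemma hardy_form_commute: "hardy_form f g = hardy_form g f"
  by (simp add: hardy_form_def inner_commute mult.commute)

lemma integrable_grad_inner:
  "f \<in> test_functions \<Omega> \<Longrightarrow> g \<in> test_functions \<Omega> \<Longrightarrow> integrable lborel (\<lambda>x. grad f x \<bullet> grad g x)"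
  unfolding grad_inner
  by (intro Bochner_Integration.integrable_sum test_integrable[of _ \<Omega>] test_mult test_pd)

lemma grad_add:
  "f \<in> test_functions \<Omega> \<Longrightarrow> g \<in> test_functions \<Omega> \<Longrightarrow> grad (\<lambda>x. f x + g x) x = grad f x + grad g x"
  unfolding grad_def by (simp add: pd_add scaleR_add_left sum.distrib)

lemma grad_cmult: "f \<in> test_functions \<Omega> \<Longrightarrow> grad (\<lambda>x. c * f x) x = c *\<^sub>R grad f x"
  unfolding grad_def by (simp add: pd_cmult scaleR_sum_right)

lemma hardy_form_add_left:
  fixes f :: "'a::euclidean_space \<Rightarrow> real"
  assumes "DIM('a) \<ge> 3" and f: "f \<in> test_functions \<Omega>" and g: "g \<in> test_functions \<Omega>" and h: "h \<in> test_functions \<Omega>"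
  shows "hardy_form (\<lambda>x. f x + g x) h = hardy_form f h + hardy_form g h"
  unfolding hardy_form_def
  by (simp add: grad_add[OF f g] inner_add_left distrib_right add_divide_distrib
     integrable_grad_inner[OF f h] integrable_grad_inner[OF g h]
     integrable_divide_norm2[OF assms(1) test_mult[OF f h]] integrable_divide_norm2[OF assms(1) test_mult[OF g h]])
   (simp add: algebra_simps)

lemma hardy_form_cmult_left:
  fixes f :: "'a::euclidean_space \<Rightarrow> real"
  assumes f: "f \<in> test_functions \<Omega>"
  shows "hardy_form (\<lambda>x. c * f x) h = c * hardy_form f h"
proof -
  have "(\<lambda>x. c * f x * h x / (norm x)\<^sup>2) = (\<lambda>x. c * (f x * h x / (norm x)\<^sup>2))" by (simp add: mult.assoc)
  then show ?thesis
    unfolding hardy_form_def grad_cmult[OF f] inner_scaleR_left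
    by (simp only: integral_mult_right_zero right_diff_distrib mult.left_commute[of _ c])
qed

lemma hardy_form_add_cmult:
  fixes f :: "'a::euclidean_space \<Rightarrow> real"
  assumes dim: "DIM('a) \<ge> 3" and f: "f \<in> test_functions \<Omega>" and g: "g \<in> test_functions \<Omega>"
  shows "hardy_form (\<lambda>x. f x + t * g x) (\<lambda>x. f x + t * g x)
    = hardy_form f f + 2 * t * hardy_form f g + t\<^sup>2 * hardy_form g g"
proof -
  have tg: "(\<lambda>x. t * g x) \<in> test_functions \<Omega>" by (rule test_cmult[OF g])
  have s: "(\<lambda>x. f x + t * g x) \<in> test_functions \<Omega>" by (rule test_add[OF f tg])
  have *: "hardy_form k (\<lambda>x. f x + t * g x) = hardy_form k f + t * hardy_form k g"
    if "k \<in> test_functions \<Omega>" for k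
    using hardy_form_add_left[OF dim f tg that] hardy_form_cmult_left[OF g, of t k]
    by (simp add: hardy_form_commute[of k])
  show ?thesis
    using hardy_form_add_left[OF dim f tg s] hardy_form_cmult_left[OF g, of t "\<lambda>x. f x + t * g x"] *[OF f] *[OF g]
    by (simp add: hardy_form_commute[of g f] algebra_simps power2_eq_square)
qed

lemma quadratic_nonneg_discriminant:
  fixes a b c :: real
  assumes "\<And>t. 0 \<le> a + 2 * t * b + t\<^sup>2 * c" and "0 \<le> c"
  shows "b\<^sup>2 \<le> a * c"
proof (cases "c = 0")
  case True
  have "b = 0"
  proof (rule ccontr)
    assume "b \<noteq> 0"
    then show False using assms(1)[of "- (a + 1) / (2 * b)"] True by (simp add: field_simps)
  qed
  then show ?thesis using True by simp
next
  case False
  have "0 \<le> c * (a + 2 * (- b / c) * b + (- b / c)\<^sup>2 * c)" by (intro mult_nonneg_nonneg assms)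
  also have "\<dots> = a * c - b\<^sup>2" using False by (simp add: field_simps power2_eq_square)
  finally show ?thesis by simp
qed

lemma hardy_form_Cauchy_Schwarz:
  fixes f :: "'a::euclidean_space \<Rightarrow> real"
  assumes dim: "DIM('a) \<ge> 3" and f: "f \<in> test_functions \<Omega>" and g: "g \<in> test_functions \<Omega>"
  shows "\<bar>hardy_form f g\<bar> \<le> sqrt (hardy_form f f) * sqrt (hardy_form g g)"
proof -
  have "(hardy_form f g)\<^sup>2 \<le> hardy_form f f * hardy_form g g"
  proof (rule quadratic_nonneg_discriminant)
    fix t
    show "0 \<le> hardy_form f f + 2 * t * hardy_form f g + t\<^sup>2 * hardy_form g g"
      unfolding hardy_form_add_cmult[OF dim f g, symmetric]
      by (rule hardy_form_nonneg[OF dim test_add[OF f test_cmult[OF g]]])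
  qed (rule hardy_form_nonneg[OF dim g])
  then have "sqrt ((hardy_form f g)\<^sup>2) \<le> sqrt (hardy_form f f * hardy_form g g)"
    by (rule real_sqrt_le_mono)
  then show ?thesis by (simp add: real_sqrt_mult)
qed

lemma hardy_norm_eq:
  fixes f :: "'a::euclidean_space \<Rightarrow> real"
  assumes "open \<Omega>" and f: "f \<in> test_functions \<Omega>"
  shows "hardy_norm \<Omega> f = sqrt (hardy_form f f)"
proof -
  have m: "\<Omega> \<in> sets lebesgue" using assms(1) by (intro sets_completionI_sets) auto
  have "pd i f x = 0" if "x \<notin> \<Omega>" "i \<in> Basis" for x i
    using test_outside[OF test_pd[OF f that(2)] that(1)] .
  then have g: "grad f x = 0" if "x \<notin> \<Omega>" for x
    using that by (simp add: grad_def)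
  have "(LINT x|lebesgue_on \<Omega>. (norm (grad f x))\<^sup>2) = (LINT x|lborel. (norm (grad f x))\<^sup>2)"
    using borel_measurable_integrable[OF integrable_grad_inner[OF f f]]
    by (intro integral_lebesgue_on_eq_lborel[OF m]) (simp_all add: g power2_norm_eq_inner)
  moreover have "(LINT x|lebesgue_on \<Omega>. (f x)\<^sup>2 / (norm x)\<^sup>2) = (LINT x|lborel. (f x)\<^sup>2 / (norm x)\<^sup>2)"
    using test_borel[OF f] test_outside[OF f] by (intro integral_lebesgue_on_eq_lborel[OF m]) auto
  ultimately show ?thesis
    by (simp add: hardy_norm_def hardy_form_def dot_square_norm power2_eq_square[of "f x" for x, symmetric])
qed

lemma hardy_norm_diff_triangle:
  fixes f :: "'a::euclidean_space \<Rightarrow> real"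
  assumes dim: "DIM('a) \<ge> 3" and "open \<Omega>" and f: "f \<in> test_functions \<Omega>" and g: "g \<in> test_functions \<Omega>"
  shows "hardy_norm \<Omega> f \<le> hardy_norm \<Omega> g + hardy_norm \<Omega> (\<lambda>x. f x - g x)"
proof -
  let ?d = "\<lambda>x. f x - g x"
  have d: "?d \<in> test_functions \<Omega>" by (rule test_diff[OF f g])
  note nn = hardy_form_nonneg[OF dim f] hardy_form_nonneg[OF dim g] hardy_form_nonneg[OF dim d]
  have "hardy_form f f = hardy_form g g + 2 * hardy_form g ?d + hardy_form ?d ?d"
    using hardy_form_add_cmult[OF dim g d, of 1] by simp
  also have "\<dots> \<le> hardy_form g g + 2 * (sqrt (hardy_form g g) * sqrt (hardy_form ?d ?d)) + hardy_form ?d ?d"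
    using hardy_form_Cauchy_Schwarz[OF dim g d] by simp
  also have "\<dots> = (sqrt (hardy_form g g) + sqrt (hardy_form ?d ?d))\<^sup>2"
    using nn by (simp add: power2_sum)
  finally have "sqrt (hardy_form f f) \<le> sqrt ((sqrt (hardy_form g g) + sqrt (hardy_form ?d ?d))\<^sup>2)"
    by (rule real_sqrt_le_mono)
  then show ?thesis using nn f g d assms(2) by (simp add: hardy_norm_eq)
qed

text \<open>Moving both derivatives to \<open>g\<close> leaves an expression that makes sense for every \<open>f\<close> in a suitable
  \<open>L\<^sup>p\<close>. All passages to the limit in the form go through this identity.\<close>

lemma hardy_form_eq_integral:
  fixes f :: "'a::euclidean_space \<Rightarrow> real"
  assumes dim: "DIM('a) \<ge> 3" and f: "f \<in> test_functions \<Omega>" and g: "g \<in> test_functions \<Omega>"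
  shows "integrable lborel (\<lambda>x. f x * hardy_op g x)"
    and "hardy_form f g = (LINT x|lborel. f x * hardy_op g x)"
proof -
  let ?c = "((real DIM('a) - 2) / 2)\<^sup>2"
  have eq: "(\<lambda>x. f x * hardy_op g x) = (\<lambda>x. - (f x * laplacian g x) - ?c * (f x * g x / (norm x)\<^sup>2))"
  proof
    have "u * (- l - c * (v / m)) = - (u * l) - c * (u * v / m)" for u l c v m :: real
      by (simp add: algebra_simps)
    then show "f x * hardy_op g x = - (f x * laplacian g x) - ?c * (f x * g x / (norm x)\<^sup>2)" for x
      by (simp only: hardy_op_def)
  qed
  have i1: "integrable lborel (\<lambda>x. f x * laplacian g x)"
    by (intro test_integrable[of _ \<Omega>] test_mult test_laplacian f g)
  have i2: "integrable lborel (\<lambda>x. f x * g x / (norm x)\<^sup>2)"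
    by (rule integrable_divide_norm2[OF dim test_mult[OF f g]])
  show "integrable lborel (\<lambda>x. f x * hardy_op g x)" unfolding eq
    by (intro Bochner_Integration.integrable_diff integrable_minus integrable_mult_right i1 i2)
  show "hardy_form f g = (LINT x|lborel. f x * hardy_op g x)"
    unfolding eq hardy_form_def green_identity[OF f g]
    by (subst Bochner_Integration.integral_diff) (auto intro!: integrable_mult_right i1 i2 simp del: times_divide_eq_right)
qed

section \<open>Convergence in \<open>L\<^sup>p\<close>\<close>

lemma borel_measurable_lebesgue_onI:
  fixes g :: "'a::euclidean_space \<Rightarrow> real"
  shows "g \<in> borel_measurable borel \<Longrightarrow> g \<in> borel_measurable (lebesgue_on \<Omega>)"
  by (intro measurable_restrict_space1 measurable_completion) simp

lemma powr_add_le: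
  fixes a b p :: real
  assumes "0 \<le> a" "0 \<le> b" "0 \<le> p"
  shows "(a + b) powr p \<le> 2 powr p * (a powr p + b powr p)"
proof -
  have "(a + b) powr p \<le> (2 * max a b) powr p" using assms by (intro powr_mono2) auto
  also have "\<dots> = 2 powr p * max a b powr p" using assms by (simp add: powr_mult)
  also have "\<dots> \<le> 2 powr p * (a powr p + b powr p)"
    by (intro mult_left_mono) (auto simp: max_def)
  finally show ?thesis .
qed

lemma integrable_powr_add:
  fixes f g :: "'a \<Rightarrow> real"
  assumes "0 \<le> p" "f \<in> borel_measurable M" "g \<in> borel_measurable M" "h \<in> borel_measurable M"
    and "integrable M (\<lambda>x. \<bar>f x\<bar> powr p)" "integrable M (\<lambda>x. \<bar>g x\<bar> powr p)"
    and le: "\<And>x. x \<in> space M \<Longrightarrow> \<bar>h x\<bar> \<le> \<bar>f x\<bar> + \<bar>g x\<bar>"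
  shows "integrable M (\<lambda>x. \<bar>h x\<bar> powr p)"
    and "(LINT x|M. \<bar>h x\<bar> powr p) \<le> 2 powr p * ((LINT x|M. \<bar>f x\<bar> powr p) + (LINT x|M. \<bar>g x\<bar> powr p))"
proof -
  have i: "integrable M (\<lambda>x. 2 powr p * (\<bar>f x\<bar> powr p + \<bar>g x\<bar> powr p))"
    using assms by (intro integrable_mult_right Bochner_Integration.integrable_add)
  have b: "\<bar>h x\<bar> powr p \<le> 2 powr p * (\<bar>f x\<bar> powr p + \<bar>g x\<bar> powr p)" if "x \<in> space M" for x
    using powr_mono2[OF assms(1) _ le[OF that]] powr_add_le[of "\<bar>f x\<bar>" "\<bar>g x\<bar>" p] assms(1) by simp
  show int: "integrable M (\<lambda>x. \<bar>h x\<bar> powr p)"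
  proof (rule Bochner_Integration.integrable_bound[OF i])
    show "(\<lambda>x. \<bar>h x\<bar> powr p) \<in> borel_measurable M" using assms(4) by measurable
    show "AE x in M. norm (\<bar>h x\<bar> powr p) \<le> norm (2 powr p * (\<bar>f x\<bar> powr p + \<bar>g x\<bar> powr p))"
      using b by (intro AE_I2) auto
  qed
  have "(LINT x|M. \<bar>h x\<bar> powr p) \<le> (LINT x|M. 2 powr p * (\<bar>f x\<bar> powr p + \<bar>g x\<bar> powr p))"
    using b by (intro integral_mono int i)
  then show "(LINT x|M. \<bar>h x\<bar> powr p) \<le> 2 powr p * ((LINT x|M. \<bar>f x\<bar> powr p) + (LINT x|M. \<bar>g x\<bar> powr p))"
    using assms(5,6) by simp
qed

lemma tendsto_LpD:
  fixes f :: "nat \<Rightarrow> 'a::euclidean_space \<Rightarrow> real"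
  assumes "tendsto_Lp \<Omega> p f u" "0 \<le> p"
  shows "f n \<in> borel_measurable (lebesgue_on \<Omega>)" "u \<in> borel_measurable (lebesgue_on \<Omega>)"
    and "integrable (lebesgue_on \<Omega>) (\<lambda>x. \<bar>f n x\<bar> powr p)" "integrable (lebesgue_on \<Omega>) (\<lambda>x. \<bar>u x\<bar> powr p)"
    and "integrable (lebesgue_on \<Omega>) (\<lambda>x. \<bar>f n x - u x\<bar> powr p)"
    and "(\<lambda>n. LINT x|lebesgue_on \<Omega>. \<bar>f n x - u x\<bar> powr p) \<longlonglongrightarrow> 0"
proof -
  show a: "f n \<in> borel_measurable (lebesgue_on \<Omega>)" "u \<in> borel_measurable (lebesgue_on \<Omega>)"
    "integrable (lebesgue_on \<Omega>) (\<lambda>x. \<bar>f n x\<bar> powr p)" "integrable (lebesgue_on \<Omega>) (\<lambda>x. \<bar>u x\<bar> powr p)"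
    "(\<lambda>n. LINT x|lebesgue_on \<Omega>. \<bar>f n x - u x\<bar> powr p) \<longlonglongrightarrow> 0"
    using assms(1) by (auto simp: tendsto_Lp_def)
  show "integrable (lebesgue_on \<Omega>) (\<lambda>x. \<bar>f n x - u x\<bar> powr p)"
    using a by (intro integrable_powr_add(1)[OF assms(2) a(1) a(2) _ a(3,4)]) auto
qed

lemma Young_scaled:
  fixes a b K p q :: real
  assumes "1 < p" "1 < q" "1 / p + 1 / q = 1" "0 < K"
  shows "\<bar>a * b\<bar> \<le> K powr p * \<bar>a\<bar> powr p + K powr (- q) * \<bar>b\<bar> powr q"
proof -
  have "(K * \<bar>a\<bar>) * (\<bar>b\<bar> / K) \<le> (K * \<bar>a\<bar>) powr p / p + (\<bar>b\<bar> / K) powr q / q"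
    using assms by (intro Youngs_inequality) auto
  also have "\<dots> \<le> (K * \<bar>a\<bar>) powr p / 1 + (\<bar>b\<bar> / K) powr q / 1"
    using assms by (intro add_mono divide_left_mono) auto
  also have "\<dots> = K powr p * \<bar>a\<bar> powr p + K powr (- q) * \<bar>b\<bar> powr q"
    using assms by (simp add: powr_mult powr_divide powr_minus_divide)
  finally show ?thesis using assms by (simp add: abs_mult)
qed

text \<open>Young's inequality with a weight \<open>K\<close>: a large \<open>K\<close> makes the contribution of \<open>h\<close> small, and then a
  large \<open>n\<close> the remaining one.\<close>

lemma tendsto_Lp_pairing:
  fixes f :: "nat \<Rightarrow> 'a::euclidean_space \<Rightarrow> real"
  assumes p: "1 < p" "1 < q" "1 / p + 1 / q = 1"
    and f: "tendsto_Lp \<Omega> p f u"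
    and h: "h \<in> borel_measurable (lebesgue_on \<Omega>)" "integrable (lebesgue_on \<Omega>) (\<lambda>x. \<bar>h x\<bar> powr q)"
  shows "integrable (lebesgue_on \<Omega>) (\<lambda>x. u x * h x)"
    and "(\<lambda>n. LINT x|lebesgue_on \<Omega>. f n x * h x) \<longlonglongrightarrow> (LINT x|lebesgue_on \<Omega>. u x * h x)"
proof -
  have p0: "0 \<le> p" using p by simp
  note fD = tendsto_LpD[OF f p0]
  have prod: "integrable (lebesgue_on \<Omega>) (\<lambda>x. g x * h x)"
    and prod_le: "\<And>K. 0 < K \<Longrightarrow> (LINT x|lebesgue_on \<Omega>. \<bar>g x * h x\<bar>)
      \<le> K powr p * (LINT x|lebesgue_on \<Omega>. \<bar>g x\<bar> powr p) + K powr (- q) * (LINT x|lebesgue_on \<Omega>. \<bar>h x\<bar> powr q)"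
    if g: "g \<in> borel_measurable (lebesgue_on \<Omega>)" "integrable (lebesgue_on \<Omega>) (\<lambda>x. \<bar>g x\<bar> powr p)" for g
  proof -
    have i: "integrable (lebesgue_on \<Omega>) (\<lambda>x. K powr p * \<bar>g x\<bar> powr p + K powr (- q) * \<bar>h x\<bar> powr q)" for K
      using g(2) h(2) by simp
    have b: "norm (g x * h x) \<le> norm (K powr p * \<bar>g x\<bar> powr p + K powr (- q) * \<bar>h x\<bar> powr q)" if "0 < K" for x K
      using Young_scaled[OF p that, of "g x" "h x"] by simp
    show int: "integrable (lebesgue_on \<Omega>) (\<lambda>x. g x * h x)"
    proof (rule Bochner_Integration.integrable_bound[OF i[of 1]])
      show "AE x in lebesgue_on \<Omega>. norm (g x * h x) \<le> norm (1 powr p * \<bar>g x\<bar> powr p + 1 powr (- q) * \<bar>h x\<bar> powr q)"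
        using b[of 1] by (intro AE_I2) auto
    qed (use g(1) h(1) in measurable)
    show "(LINT x|lebesgue_on \<Omega>. \<bar>g x * h x\<bar>)
      \<le> K powr p * (LINT x|lebesgue_on \<Omega>. \<bar>g x\<bar> powr p) + K powr (- q) * (LINT x|lebesgue_on \<Omega>. \<bar>h x\<bar> powr q)"
      if "0 < K" for K
    proof -
      have "(LINT x|lebesgue_on \<Omega>. \<bar>g x * h x\<bar>)
        \<le> (LINT x|lebesgue_on \<Omega>. K powr p * \<bar>g x\<bar> powr p + K powr (- q) * \<bar>h x\<bar> powr q)"
        using Young_scaled[OF p that] by (intro integral_mono i integrable_abs int) auto
      then show ?thesis using g(2) h(2) by simp
    qed
  qed
  show iu: "integrable (lebesgue_on \<Omega>) (\<lambda>x. u x * h x)" by (rule prod) (rule fD)+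
  have ifn: "integrable (lebesgue_on \<Omega>) (\<lambda>x. f n x * h x)" for n by (rule prod) (rule fD)+
  define J where "J = (LINT x|lebesgue_on \<Omega>. \<bar>h x\<bar> powr q)"
  have J: "0 \<le> J" by (auto simp: J_def)
  define I where "I n = (LINT x|lebesgue_on \<Omega>. \<bar>f n x - u x\<bar> powr p)" for n
  have I: "I \<longlonglongrightarrow> 0" using fD(6) by (simp add: I_def[abs_def])
  show "(\<lambda>n. LINT x|lebesgue_on \<Omega>. f n x * h x) \<longlonglongrightarrow> (LINT x|lebesgue_on \<Omega>. u x * h x)"
  proof (rule LIMSEQ_I)
    fix e :: real assume e: "0 < e"
    \<comment> \<open>chosen such that \<open>K powr (- q) * J < e / 2\<close>\<close>
    define K where "K = (2 * (J + 1) / e) powr (1 / q)"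
    have K: "0 < K" using e J by (simp add: K_def)
    have "K powr (- q) = inverse (2 * (J + 1) / e)"
      using p e J by (simp add: K_def powr_powr powr_minus)
    then have "K powr (- q) * (J + 1) = e / 2" using e J by (simp add: field_simps)
    moreover have "K powr (- q) * J < K powr (- q) * (J + 1)" using K by simp
    ultimately have "K powr (- q) * J < e / 2" by simp
    moreover have "\<forall>\<^sub>F n in sequentially. I n < e / 2 / K powr p"
      using I e K by (intro order_tendstoD(2)[OF I]) auto
    then obtain n0 where n0: "\<And>n. n \<ge> n0 \<Longrightarrow> I n < e / 2 / K powr p"
      by (auto simp: eventually_sequentially)
    ultimately show "\<exists>no. \<forall>n\<ge>no. norm ((LINT x|lebesgue_on \<Omega>. f n x * h x) - (LINT x|lebesgue_on \<Omega>. u x * h x)) < e"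
    proof (intro exI[of _ n0] allI impI)
      fix n assume n: "n \<ge> n0"
      have "norm ((LINT x|lebesgue_on \<Omega>. f n x * h x) - (LINT x|lebesgue_on \<Omega>. u x * h x))
        = norm (LINT x|lebesgue_on \<Omega>. (f n x - u x) * h x)"
        using iu ifn[of n] by (simp add: left_diff_distrib)
      also have "\<dots> \<le> (LINT x|lebesgue_on \<Omega>. \<bar>(f n x - u x) * h x\<bar>)"
        using integral_norm_bound[of "lebesgue_on \<Omega>" "\<lambda>x. (f n x - u x) * h x"] by simp
      also have "\<dots> \<le> K powr p * I n + K powr (- q) * J"
        unfolding I_def J_def using fD(1)[of n] fD(2,5) by (intro prod_le K) auto
      also have "K powr p * I n < e / 2"
        using n0[OF n] K by (simp add: field_simps)
      finally show "norm ((LINT x|lebesgue_on \<Omega>. f n x * h x) - (LINT x|lebesgue_on \<Omega>. u x * h x)) < e"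
        using \<open>K powr (- q) * J < e / 2\<close> by linarith
    qed
  qed
qed

lemma hardy_op_outside: "g \<in> test_functions \<Omega> \<Longrightarrow> x \<notin> \<Omega> \<Longrightarrow> hardy_op g x = 0"
  using test_outside[of g \<Omega> x] test_outside[OF test_laplacian, of g \<Omega> x] by (simp add: hardy_op_def)

lemma hardy_op_borel: "g \<in> test_functions \<Omega> \<Longrightarrow> hardy_op g \<in> borel_measurable borel"
  using test_borel[of g \<Omega>] test_borel[OF test_laplacian, of g \<Omega>] unfolding hardy_op_def[abs_def] by measurable

lemma open_sets_lebesgue: "open S \<Longrightarrow> S \<in> sets lebesgue"
  by (intro sets_completionI_sets) auto

text \<open>The bound \<open>2 q < N\<close> is what local integrability of \<open>(1/|x|\<^sup>2)\<^sup>q\<close> requires.\<close>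

lemma hardy_op_powr_integrable:
  fixes g :: "'a::euclidean_space \<Rightarrow> real" and q :: real
  assumes g: "g \<in> test_functions \<Omega>" and q: "0 < q" "2 * q < DIM('a)" and "open \<Omega>"
  shows "integrable (lebesgue_on \<Omega>) (\<lambda>x. \<bar>hardy_op g x\<bar> powr q)"
proof -
  let ?c = "((real DIM('a) - 2) / 2)\<^sup>2"
  obtain L where L: "L > 0" "\<And>x. \<bar>laplacian g x\<bar> \<le> L" using test_bounded[OF test_laplacian[OF g]] by blast
  obtain M where M: "M > 0" "\<And>x. \<bar>g x\<bar> \<le> M" using test_bounded[OF g] by blast
  obtain K where K: "compact K" "K \<subseteq> \<Omega>" "\<And>x. x \<notin> K \<Longrightarrow> g x = 0"
    using test_support[OF g] by blast
  obtain K' where K': "compact K'" "K' \<subseteq> \<Omega>" "\<And>x. x \<notin> K' \<Longrightarrow> laplacian g x = 0"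
    using test_support[OF test_laplacian[OF g]] by blast
  obtain R where R: "R > 0" "\<And>x. x \<in> K \<union> K' \<Longrightarrow> norm x < R"
    using compact_imp_bounded[OF compact_Un[OF K(1) K'(1)]] unfolding bounded_pos_less by blast
  have [measurable]: "ball (0::'a) R \<in> sets borel" by auto
  have i1: "integrable lborel (\<lambda>x::'a. \<bar>indicator (ball 0 R) x * L\<bar> powr q)"
  proof -
    have "integrable lborel (\<lambda>x::'a. indicator (ball 0 R) x *\<^sub>R (L powr q))"
      using emeasure_bounded_finite[of "ball (0::'a) R"] by (intro integrable_indicator) auto
    then show ?thesis
      by (rule Bochner_Integration.integrable_cong[THEN iffD1, rotated -1]) (use L in \<open>auto simp: indicator_def\<close>)
  qed
  have i2: "integrable lborel (\<lambda>x::'a. \<bar>indicator (ball 0 R) x * (?c * M * inverse ((norm x)\<^sup>2))\<bar> powr q)"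
  proof -
    have "integrable lborel (\<lambda>x::'a. (?c * M) powr q * (indicator (ball 0 R) x * norm x powr (- (2 * q))))"
      using q R by (intro integrable_mult_right integrable_norm_powr_ball) auto
    then show ?thesis
    proof (rule Bochner_Integration.integrable_cong[THEN iffD1, rotated -1])
      fix x :: 'a
      have "\<bar>?c * M * inverse ((norm x)\<^sup>2)\<bar> powr q = (?c * M * norm x powr (- 2)) powr q"
        using M(1) by (simp add: inverse_norm2_eq_powr)
      also have "\<dots> = (?c * M) powr q * norm x powr (- (2 * q))"
        using M(1) by (simp only: powr_mult[of "?c * M"] powr_powr) simp
      finally show "(?c * M) powr q * (indicator (ball 0 R) x * norm x powr (- (2 * q)))
          = \<bar>indicator (ball 0 R) x * (?c * M * inverse ((norm x)\<^sup>2))\<bar> powr q"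
        by (cases "x \<in> ball 0 R") auto
    qed simp
  qed
  have "integrable lborel (\<lambda>x. \<bar>hardy_op g x\<bar> powr q)"
  proof (rule integrable_powr_add(1)[OF _ _ _ _ i1 i2])
    fix x
    show "\<bar>hardy_op g x\<bar> \<le> \<bar>indicator (ball 0 R) x * L\<bar> + \<bar>indicator (ball 0 R) x * (?c * M * inverse ((norm x)\<^sup>2))\<bar>"
    proof (cases "x \<in> K \<union> K'")
      case True
      have "\<bar>hardy_op g x\<bar> \<le> \<bar>laplacian g x\<bar> + \<bar>?c * (g x / (norm x)\<^sup>2)\<bar>"
        unfolding hardy_op_def by linarith
      also have "\<bar>?c * (g x / (norm x)\<^sup>2)\<bar> = ?c * \<bar>g x\<bar> * inverse ((norm x)\<^sup>2)"
        by (simp only: abs_mult divide_inverse abs_inverse abs_power2 mult.assoc)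
      also have "\<dots> \<le> ?c * M * inverse ((norm x)\<^sup>2)"
        by (intro mult_right_mono mult_left_mono M) auto
      finally show ?thesis using L(1) L(2)[of x] M R(2)[OF True] by simp
    next
      case False
      then show ?thesis using K(3) K'(3) by (simp add: hardy_op_def)
    qed
  qed (use hardy_op_borel[OF g] q in auto)
  then show ?thesis
    using hardy_op_borel[OF g] hardy_op_outside[OF g] q
    by (subst integral_lebesgue_on_eq_lborel(2)[OF open_sets_lebesgue[OF \<open>open \<Omega>\<close>]]) auto
qed

text \<open>An admissible exponent \<open>p\<close> whose conjugate \<open>q = 3N/(N + 4)\<close> satisfies \<open>2 q < N\<close>. Any \<open>p\<close> strictly
  between \<open>N/(N - 2)\<close> and \<open>2N/(N - 2)\<close> would serve.\<close>

definition hardy_exponent :: "'a::euclidean_space itself \<Rightarrow> real" where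
  "hardy_exponent _ = 3 * real DIM('a) / (2 * real DIM('a) - 4)"

lemma hardy_exponent_range:
  assumes "DIM('a::euclidean_space) \<ge> 3"
  shows "1 \<le> hardy_exponent TYPE('a)" "hardy_exponent TYPE('a) < 2 * real DIM('a) / (real DIM('a) - 2)"
proof -
  have "0 < real DIM('a) - 2" using assms by simp
  then show "1 \<le> hardy_exponent TYPE('a)" "hardy_exponent TYPE('a) < 2 * real DIM('a) / (real DIM('a) - 2)"
    unfolding hardy_exponent_def by (simp_all add: divide_simps)
qed

lemma hardy_op_pairing:
  fixes f :: "nat \<Rightarrow> 'a::euclidean_space \<Rightarrow> real"
  assumes dim: "DIM('a) \<ge> 3" and "open \<Omega>" and f: "tendsto_Lp \<Omega> (hardy_exponent TYPE('a)) f u"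
    and g: "g \<in> test_functions \<Omega>"
  shows "integrable (lebesgue_on \<Omega>) (\<lambda>x. u x * hardy_op g x)"
    and "(\<lambda>n. LINT x|lebesgue_on \<Omega>. f n x * hardy_op g x) \<longlonglongrightarrow> (LINT x|lebesgue_on \<Omega>. u x * hardy_op g x)"
proof -
  define q where "q = 3 * real DIM('a) / (real DIM('a) + 4)"
  have N: "real DIM('a) \<ge> 3" using dim by simp
  have p: "1 < hardy_exponent TYPE('a)" "1 < q" "1 / hardy_exponent TYPE('a) + 1 / q = 1"
    using N by (auto simp: hardy_exponent_def q_def divide_simps)
  have q: "0 < q" "2 * q < real DIM('a)" using N by (auto simp: q_def field_simps)
  note * = tendsto_Lp_pairing[OF p f borel_measurable_lebesgue_onI[OF hardy_op_borel[OF g]]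
      hardy_op_powr_integrable[OF g q \<open>open \<Omega>\<close>]]
  show "integrable (lebesgue_on \<Omega>) (\<lambda>x. u x * hardy_op g x)"
    and "(\<lambda>n. LINT x|lebesgue_on \<Omega>. f n x * hardy_op g x) \<longlonglongrightarrow> (LINT x|lebesgue_on \<Omega>. u x * hardy_op g x)"
    by (rule *)+
qed

lemma hardy_form_eq_integral_on:
  fixes f :: "'a::euclidean_space \<Rightarrow> real"
  assumes dim: "DIM('a) \<ge> 3" and "open \<Omega>" and f: "f \<in> test_functions \<Omega>" and g: "g \<in> test_functions \<Omega>"
  shows "hardy_form f g = (LINT x|lebesgue_on \<Omega>. f x * hardy_op g x)"
  unfolding hardy_form_eq_integral(2)[OF dim f g]
  using hardy_op_borel[OF g] test_borel[OF f] test_outside[OF f]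
  by (intro integral_lebesgue_on_eq_lborel(1)[symmetric] open_sets_lebesgue assms) auto

section \<open>The norm of \<open>H(\<Omega>)\<close>\<close>

lemma hardy_norm_minus:
  fixes f :: "'a::euclidean_space \<Rightarrow> real"
  assumes "open \<Omega>" "f \<in> test_functions \<Omega>"
  shows "hardy_norm \<Omega> (\<lambda>x. - f x) = hardy_norm \<Omega> f"
proof -
  have m: "(\<lambda>x. (-1) * f x) \<in> test_functions \<Omega>" by (rule test_cmult[OF assms(2)])
  have "hardy_form (\<lambda>x. (-1) * f x) (\<lambda>x. (-1) * f x) = (-1) * ((-1) * hardy_form f f)"
    unfolding hardy_form_cmult_left[OF assms(2)] hardy_form_commute[of f "\<lambda>x. (-1) * f x"] by (rule refl)
  then show ?thesis using hardy_norm_eq[OF assms(1) m] hardy_norm_eq[OF assms] by simp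
qed

lemma hardy_norm_0: "open \<Omega> \<Longrightarrow> hardy_norm \<Omega> (\<lambda>x. 0) = 0"
  using hardy_norm_eq[OF _ test_zero, of \<Omega>] hardy_form_cmult_left[OF test_zero, of 0 "\<lambda>x. 0"] by simp

text \<open>Split \<open>hardy_form f\<^sub>n f\<^sub>n\<close> into \<open>hardy_form (f\<^sub>n - f\<^sub>M) f\<^sub>n\<close>, which is small for large \<open>M\<close> uniformly in
  \<open>n \<ge> M\<close> by the Cauchy property, and \<open>hardy_form f\<^sub>M f\<^sub>n\<close>, which tends to \<open>0\<close> for fixed \<open>M\<close> because
  the form is continuous in \<open>f\<^sub>n\<close> with respect to \<open>L\<^sup>p\<close>.\<close>

lemma hardy_norm_closable:
  fixes f :: "nat \<Rightarrow> 'a::euclidean_space \<Rightarrow> real"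
  assumes dim: "DIM('a) \<ge> 3" and op: "open \<Omega>"
    and f: "\<And>n. f n \<in> test_functions \<Omega>"
    and Cauchy: "\<And>e. 0 < e \<Longrightarrow> \<exists>M. \<forall>m\<ge>M. \<forall>n\<ge>M. hardy_norm \<Omega> (\<lambda>x. f m x - f n x) < e"
    and Lp: "tendsto_Lp \<Omega> (hardy_exponent TYPE('a)) f (\<lambda>x. 0)"
  shows "(\<lambda>n. hardy_norm \<Omega> (f n)) \<longlonglongrightarrow> 0"
proof -
  have nn: "0 \<le> hardy_form (f n) (f n)" for n by (rule hardy_form_nonneg[OF dim f])
  obtain M1 where M1: "\<And>m n. m \<ge> M1 \<Longrightarrow> n \<ge> M1 \<Longrightarrow> hardy_norm \<Omega> (\<lambda>x. f m x - f n x) < 1"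
    using Cauchy[of 1] by auto
  define C where "C = hardy_norm \<Omega> (f M1) + 1"
  have C: "hardy_norm \<Omega> (f n) \<le> C" if "n \<ge> M1" for n
    using hardy_norm_diff_triangle[OF dim op f f, of n M1] M1[OF that, of M1] by (simp add: C_def)
  have "0 \<le> hardy_norm \<Omega> (f M1)" using nn hardy_norm_eq[OF op f] by simp
  then have C0: "0 < C" by (simp add: C_def)
  have "(\<lambda>n. hardy_form (f n) (f n)) \<longlonglongrightarrow> 0"
  proof (rule LIMSEQ_I)
    fix e :: real assume e: "0 < e"
    obtain M2 where M2: "\<And>m n. m \<ge> M2 \<Longrightarrow> n \<ge> M2 \<Longrightarrow> hardy_norm \<Omega> (\<lambda>x. f m x - f n x) < e / (2 * C)"
      using Cauchy[of "e / (2 * C)"] e C0 by auto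
    define M where "M = max M1 M2"
    have "(\<lambda>n. LINT x|lebesgue_on \<Omega>. f n x * hardy_op (f M) x) \<longlonglongrightarrow> (LINT x|lebesgue_on \<Omega>. 0 * hardy_op (f M) x)"
      by (rule hardy_op_pairing[OF dim op Lp f])
    then have "(\<lambda>n. hardy_form (f n) (f M)) \<longlonglongrightarrow> 0"
      by (simp add: hardy_form_eq_integral_on[OF dim op f f])
    then have "\<exists>n0. \<forall>n\<ge>n0. norm (hardy_form (f n) (f M) - 0) < e / 2"
      by (rule LIMSEQ_D) (use e in simp)
    then obtain n0 where n0: "\<And>n. n \<ge> n0 \<Longrightarrow> norm (hardy_form (f n) (f M) - 0) < e / 2" by blast
    show "\<exists>no. \<forall>n\<ge>no. norm (hardy_form (f n) (f n) - 0) < e"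
    proof (intro exI[of _ "max n0 M"] allI impI)
      fix n assume "max n0 M \<le> n"
      then have n: "n \<ge> n0" "n \<ge> M" by auto
      have d: "(\<lambda>x. f n x - f M x) \<in> test_functions \<Omega>" by (rule test_diff[OF f f])
      have "hardy_form (f n) (f n) = hardy_form (\<lambda>x. (f n x - f M x) + f M x) (f n)" by simp
      also have "\<dots> = hardy_form (\<lambda>x. f n x - f M x) (f n) + hardy_form (f M) (f n)"
        by (rule hardy_form_add_left[OF dim d f f])
      also have "hardy_form (\<lambda>x. f n x - f M x) (f n)
          \<le> hardy_norm \<Omega> (\<lambda>x. f n x - f M x) * hardy_norm \<Omega> (f n)"
        using hardy_form_Cauchy_Schwarz[OF dim d f, of n] hardy_norm_eq[OF op f] hardy_norm_eq[OF op d] by simp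
      also have "\<dots> \<le> e / (2 * C) * C"
        using n M2[of n M] C[of n] nn[of n] C0 e hardy_norm_eq[OF op f, of n]
        by (intro mult_mono) (auto simp: M_def)
      also have "\<dots> = e / 2" using C0 by simp
      finally show "norm (hardy_form (f n) (f n) - 0) < e"
        using n0[OF n(1)] nn[of n] hardy_form_commute[of "f M" "f n"] by auto
    qed
  qed
  then have "(\<lambda>n. sqrt (hardy_form (f n) (f n))) \<longlonglongrightarrow> sqrt 0" by (rule tendsto_real_sqrt)
  then show ?thesis by (simp add: hardy_norm_eq[OF op f])
qed

lemma tendsto_Lp_diff:
  fixes f g :: "nat \<Rightarrow> 'a::euclidean_space \<Rightarrow> real"
  assumes f: "tendsto_Lp \<Omega> p f u" and g: "tendsto_Lp \<Omega> p g u" and p: "1 \<le> p"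
  shows "tendsto_Lp \<Omega> p (\<lambda>n x. f n x - g n x) (\<lambda>x. 0)"
proof -
  have p0: "0 \<le> p" using p by simp
  note fD = tendsto_LpD[OF f p0] and gD = tendsto_LpD[OF g p0]
  have i: "integrable (lebesgue_on \<Omega>) (\<lambda>x. \<bar>f n x - g n x\<bar> powr p)"
    "(LINT x|lebesgue_on \<Omega>. \<bar>f n x - g n x\<bar> powr p)
      \<le> 2 powr p * ((LINT x|lebesgue_on \<Omega>. \<bar>f n x - u x\<bar> powr p) + (LINT x|lebesgue_on \<Omega>. \<bar>g n x - u x\<bar> powr p))" for n
  proof -
    have m: "(\<lambda>x. f n x - u x) \<in> borel_measurable (lebesgue_on \<Omega>)" "(\<lambda>x. g n x - u x) \<in> borel_measurable (lebesgue_on \<Omega>)"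
      "(\<lambda>x. f n x - g n x) \<in> borel_measurable (lebesgue_on \<Omega>)"
      using fD(1)[of n] fD(2) gD(1)[of n] by auto
    have le: "\<bar>f n x - g n x\<bar> \<le> \<bar>f n x - u x\<bar> + \<bar>g n x - u x\<bar>" for x by linarith
    show "integrable (lebesgue_on \<Omega>) (\<lambda>x. \<bar>f n x - g n x\<bar> powr p)"
      "(LINT x|lebesgue_on \<Omega>. \<bar>f n x - g n x\<bar> powr p)
        \<le> 2 powr p * ((LINT x|lebesgue_on \<Omega>. \<bar>f n x - u x\<bar> powr p) + (LINT x|lebesgue_on \<Omega>. \<bar>g n x - u x\<bar> powr p))"
      using integrable_powr_add[OF p0 m fD(5) gD(5) le] by auto
  qed
  have "(\<lambda>n. LINT x|lebesgue_on \<Omega>. \<bar>f n x - g n x\<bar> powr p) \<longlonglongrightarrow> 0"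
  proof (rule tendsto_sandwich[OF _ _ tendsto_const])
    show "(\<lambda>n. 2 powr p * ((LINT x|lebesgue_on \<Omega>. \<bar>f n x - u x\<bar> powr p) + (LINT x|lebesgue_on \<Omega>. \<bar>g n x - u x\<bar> powr p))) \<longlonglongrightarrow> 0"
      using tendsto_mult_left[OF tendsto_add[OF fD(6) gD(6)], of "2 powr p"] by simp
  qed (use i(2) in auto)
  then show ?thesis using i fD(1) gD(1) p by (simp add: tendsto_Lp_def)
qed

text \<open>The definite description in \<open>H_norm\<close> denotes something only because two sequences representing the same
  \<open>u\<close> differ by a sequence to which \<open>hardy_norm_closable\<close> applies.\<close>

lemma H_norm_LIMSEQ:
  fixes u :: "'a::euclidean_space \<Rightarrow> real"
  assumes dim: "DIM('a) \<ge> 3" and op: "open \<Omega>" and rep: "H_represents \<Omega> \<phi> u"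
  shows "(\<lambda>n. hardy_norm \<Omega> (\<phi> n)) \<longlonglongrightarrow> H_norm \<Omega> u"
proof -
  have abs_le: "\<bar>hardy_norm \<Omega> f - hardy_norm \<Omega> g\<bar> \<le> hardy_norm \<Omega> (\<lambda>x. f x - g x)"
    if "f \<in> test_functions \<Omega>" "g \<in> test_functions \<Omega>" for f g :: "'a \<Rightarrow> real"
    using hardy_norm_diff_triangle[OF dim op that] hardy_norm_diff_triangle[OF dim op that(2,1)]
      hardy_norm_minus[OF op test_diff[OF that]] by simp
  have lim: "\<exists>l. (\<lambda>n. hardy_norm \<Omega> (\<phi> n)) \<longlonglongrightarrow> l" if "H_represents \<Omega> \<phi> u" for \<phi>
  proof -
    have "Cauchy (\<lambda>n. hardy_norm \<Omega> (\<phi> n))"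
    proof (rule CauchyI)
      fix e :: real assume "0 < e"
      then have "\<exists>M. \<forall>m\<ge>M. \<forall>n\<ge>M. hardy_norm \<Omega> (\<lambda>x. \<phi> m x - \<phi> n x) < e"
        using that unfolding H_represents_def by blast
      then obtain M where M: "\<forall>m\<ge>M. \<forall>n\<ge>M. hardy_norm \<Omega> (\<lambda>x. \<phi> m x - \<phi> n x) < e" ..
      show "\<exists>M. \<forall>m\<ge>M. \<forall>n\<ge>M. norm (hardy_norm \<Omega> (\<phi> m) - hardy_norm \<Omega> (\<phi> n)) < e"
      proof (intro exI[of _ M] allI impI)
        fix m n assume "M \<le> m" "M \<le> n"
        then have "hardy_norm \<Omega> (\<lambda>x. \<phi> m x - \<phi> n x) < e" using M by blast
        moreover have "\<phi> m \<in> test_functions \<Omega>" "\<phi> n \<in> test_functions \<Omega>"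
          using that by (auto simp: H_represents_def)
        ultimately show "norm (hardy_norm \<Omega> (\<phi> m) - hardy_norm \<Omega> (\<phi> n)) < e"
          using abs_le[of "\<phi> m" "\<phi> n"] by simp
      qed
    qed
    then show ?thesis by (simp add: Cauchy_convergent_iff convergent_def)
  qed
  have unique: "l = l'" if r: "H_represents \<Omega> \<phi> u" "(\<lambda>n. hardy_norm \<Omega> (\<phi> n)) \<longlonglongrightarrow> l"
      and r': "H_represents \<Omega> \<phi>' u" "(\<lambda>n. hardy_norm \<Omega> (\<phi>' n)) \<longlonglongrightarrow> l'" for \<phi> \<phi>' l l'
  proof -
    have t: "\<phi> n \<in> test_functions \<Omega>" "\<phi>' n \<in> test_functions \<Omega>" for n
      using r r' by (auto simp: H_represents_def)
    let ?d = "\<lambda>n x. \<phi> n x - \<phi>' n x"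
    have dt: "?d n \<in> test_functions \<Omega>" for n by (rule test_diff[OF t])
    have "(\<lambda>n. hardy_norm \<Omega> (?d n)) \<longlonglongrightarrow> 0"
    proof (rule hardy_norm_closable[OF dim op dt])
      show "tendsto_Lp \<Omega> (hardy_exponent TYPE('a)) ?d (\<lambda>x. 0)"
        using r(1) r'(1) hardy_exponent_range[OF dim]
        by (intro tendsto_Lp_diff[where u=u]) (auto simp: H_represents_def)
      fix e :: real assume "0 < e"
      then have "0 < e / 2" by simp
      then obtain M M' where M: "\<And>m n. m \<ge> M \<Longrightarrow> n \<ge> M \<Longrightarrow> hardy_norm \<Omega> (\<lambda>x. \<phi> m x - \<phi> n x) < e / 2"
        "\<And>m n. m \<ge> M' \<Longrightarrow> n \<ge> M' \<Longrightarrow> hardy_norm \<Omega> (\<lambda>x. \<phi>' m x - \<phi>' n x) < e / 2"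
        using r(1) r'(1) unfolding H_represents_def by meson
      show "\<exists>M. \<forall>m\<ge>M. \<forall>n\<ge>M. hardy_norm \<Omega> (\<lambda>x. ?d m x - ?d n x) < e"
      proof (intro exI[of _ "max M M'"] allI impI)
        fix m n assume mn: "max M M' \<le> m" "max M M' \<le> n"
        have "hardy_norm \<Omega> (\<lambda>x. ?d m x - ?d n x)
          \<le> hardy_norm \<Omega> (\<lambda>x. \<phi> m x - \<phi> n x) + hardy_norm \<Omega> (\<lambda>x. (?d m x - ?d n x) - (\<phi> m x - \<phi> n x))"
          by (rule hardy_norm_diff_triangle[OF dim op]) (intro test_diff t)+
        also have "(\<lambda>x. (?d m x - ?d n x) - (\<phi> m x - \<phi> n x)) = (\<lambda>x. - (\<phi>' m x - \<phi>' n x))" by auto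
        also have "hardy_norm \<Omega> \<dots> = hardy_norm \<Omega> (\<lambda>x. \<phi>' m x - \<phi>' n x)"
          by (rule hardy_norm_minus[OF op]) (intro test_diff t)
        finally show "hardy_norm \<Omega> (\<lambda>x. ?d m x - ?d n x) < e"
          using M(1)[of m n] M(2)[of m n] mn by auto
      qed
    qed
    then have "(\<lambda>n. hardy_norm \<Omega> (\<phi> n) - hardy_norm \<Omega> (\<phi>' n)) \<longlonglongrightarrow> 0"
      by (rule Lim_null_comparison[rotated]) (use abs_le[OF t] in auto)
    moreover have "(\<lambda>n. hardy_norm \<Omega> (\<phi> n) - hardy_norm \<Omega> (\<phi>' n)) \<longlonglongrightarrow> l - l'"
      by (intro tendsto_diff r r')
    ultimately show "l = l'" using LIMSEQ_unique by fastforce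
  qed
  obtain l where l: "(\<lambda>n. hardy_norm \<Omega> (\<phi> n)) \<longlonglongrightarrow> l" using lim[OF rep] by blast
  have "H_norm \<Omega> u = l"
    unfolding H_norm_def using l rep unique by (intro the_equality) blast+
  then show ?thesis using l by simp
qed

lemma test_powr_integrable:
  assumes f: "f \<in> test_functions \<Omega>" and "0 < p" "open \<Omega>"
  shows "integrable (lebesgue_on \<Omega>) (\<lambda>x. \<bar>f x\<bar> powr p)"
proof -
  obtain K where K: "compact K" "K \<subseteq> \<Omega>" "\<And>x. x \<notin> K \<Longrightarrow> f x = 0"
    using test_support[OF f] by blast
  have "integrable lborel (\<lambda>x. indicator K x *\<^sub>R (\<bar>f x\<bar> powr p))"
    using assms(2) by (intro borel_integrable_compact K continuous_on_powr' continuous_intros test_continuous[OF f]) auto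
  moreover have "(\<lambda>x. indicator K x *\<^sub>R (\<bar>f x\<bar> powr p)) = (\<lambda>x. \<bar>f x\<bar> powr p)"
    using K(3) by (auto simp: indicator_def fun_eq_iff)
  ultimately have "integrable lborel (\<lambda>x. \<bar>f x\<bar> powr p)" by simp
  then show ?thesis
    using test_borel[OF f] test_outside[OF f]
    by (subst integral_lebesgue_on_eq_lborel(2)[OF open_sets_lebesgue[OF \<open>open \<Omega>\<close>]]) auto
qed

lemma H_represents_test:
  fixes f :: "'a::euclidean_space \<Rightarrow> real"
  assumes "open \<Omega>" and f: "f \<in> test_functions \<Omega>"
  shows "H_represents \<Omega> (\<lambda>_. f) f"
  unfolding H_represents_def tendsto_Lp_def
  using f hardy_norm_0[OF assms(1)] borel_measurable_lebesgue_onI[OF test_borel[OF f]] test_powr_integrable[OF f _ assms(1)]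
  by auto

lemma H_norm_test:
  fixes f :: "'a::euclidean_space \<Rightarrow> real"
  assumes "DIM('a) \<ge> 3" "open \<Omega>" "f \<in> test_functions \<Omega>"
  shows "H_norm \<Omega> f = hardy_norm \<Omega> f"
  using H_norm_LIMSEQ[OF assms(1,2) H_represents_test[OF assms(2,3)]] by (simp add: LIMSEQ_const_iff)

section \<open>Minimizers are supersolutions in absolute value\<close>

text \<open>Being smooth with value \<open>0\<close> at \<open>0\<close>, it maps test functions to test functions; being \<open>1\<close>-Lipschitz, it
  does not increase gradients.\<close>

definition smooth_abs :: "real \<Rightarrow> real \<Rightarrow> real" where
  "smooth_abs e s = sqrt (s\<^sup>2 + e\<^sup>2) - e"

lemma smooth_abs_bounds:
  assumes "0 < e"
  shows "0 \<le> smooth_abs e s" "smooth_abs e s \<le> \<bar>s\<bar>" "\<bar>s\<bar> - smooth_abs e s \<le> e"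
proof -
  have "e \<le> sqrt (s\<^sup>2 + e\<^sup>2)" by (rule real_le_rsqrt) simp
  then show "0 \<le> smooth_abs e s" by (simp add: smooth_abs_def)
  have "s\<^sup>2 + e\<^sup>2 \<le> (\<bar>s\<bar> + e)\<^sup>2" using assms by (simp add: power2_sum)
  then have "sqrt (s\<^sup>2 + e\<^sup>2) \<le> \<bar>s\<bar> + e" using assms by (intro real_le_lsqrt) auto
  then show "smooth_abs e s \<le> \<bar>s\<bar>" by (simp add: smooth_abs_def)
  have "\<bar>s\<bar> \<le> sqrt (s\<^sup>2 + e\<^sup>2)" by (rule real_le_rsqrt) simp
  then show "\<bar>s\<bar> - smooth_abs e s \<le> e" by (simp add: smooth_abs_def)
qed

lemma test_smooth_abs:
  assumes f: "f \<in> test_functions \<Omega>" and e: "0 < e"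
  shows "(\<lambda>x. smooth_abs e (f x)) \<in> test_functions \<Omega>"
proof -
  obtain K where K: "compact K" "K \<subseteq> \<Omega>" "\<And>x. x \<notin> K \<Longrightarrow> f x = 0"
    using test_support[OF f] by blast
  have pos: "0 < f x * f x + e\<^sup>2" for x using e by (simp add: add_nonneg_pos)
  have "C_on k UNIV (\<lambda>x. (\<lambda>t. t powr (1/2)) (f x * f x + e\<^sup>2) - e)" for k
    using pos by (intro C_on_diff C_on_const C_on_compose[OF _ _ C_on_powr] C_on_add C_on_mult test_C_on[OF f]) auto
  moreover have "(\<lambda>x. (\<lambda>t. t powr (1/2)) (f x * f x + e\<^sup>2) - e) = (\<lambda>x. smooth_abs e (f x))"
    using pos by (auto simp: fun_eq_iff smooth_abs_def powr_half_sqrt less_imp_le power2_eq_square)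
  ultimately have "C_on k UNIV (\<lambda>x. smooth_abs e (f x))" for k by simp
  then show ?thesis
    using K e by (intro test_functionsI[of _ K]) (auto simp: smooth_abs_def)
qed

lemma grad_smooth_abs_le:
  assumes f: "f \<in> test_functions \<Omega>" and e: "0 < e"
  shows "grad (\<lambda>x. smooth_abs e (f x)) x \<bullet> grad (\<lambda>x. smooth_abs e (f x)) x \<le> grad f x \<bullet> grad f x"
proof -
  have pos: "0 < (f x)\<^sup>2 + e\<^sup>2" using e by (simp add: add_nonneg_pos)
  have "(smooth_abs e has_real_derivative f x / sqrt ((f x)\<^sup>2 + e\<^sup>2)) (at (f x))"
    unfolding smooth_abs_def[abs_def] using pos
    by (auto intro!: derivative_eq_intros simp: divide_simps)
  then have "((\<lambda>x. smooth_abs e (f x)) has_derivative (\<lambda>h. f x / sqrt ((f x)\<^sup>2 + e\<^sup>2) * frechet_derivative f (at x) h)) (at x)"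
    unfolding has_field_derivative_def by (rule has_derivative_compose[OF test_has_derivative[OF f]])
  from frechet_derivative_at[OF this]
  have pd: "pd i (\<lambda>x. smooth_abs e (f x)) x = f x / sqrt ((f x)\<^sup>2 + e\<^sup>2) * pd i f x" for i
    by (simp add: fun_eq_iff)
  have "\<bar>f x\<bar> \<le> sqrt ((f x)\<^sup>2 + e\<^sup>2)" by (rule real_le_rsqrt) simp
  then have "\<bar>f x / sqrt ((f x)\<^sup>2 + e\<^sup>2)\<bar> \<le> 1" using pos by (simp add: abs_divide)
  then have "\<bar>pd i (\<lambda>x. smooth_abs e (f x)) x\<bar> \<le> 1 * \<bar>pd i f x\<bar>" for i
    unfolding pd abs_mult by (intro mult_right_mono) auto
  then show ?thesis unfolding grad_inner
    by (intro sum_mono) (simp add: power2_eq_square[symmetric] abs_le_square_iff[symmetric])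
qed

text \<open>Only the Hardy term can make the form larger, and it loses at most \<open>f\<^sup>2 - g\<^sup>2 \<le> 2 e |f|\<close> in the
  numerator. For a fixed \<open>f\<close> the excess is therefore of order \<open>e\<close>.\<close>

lemma hardy_form_smooth_abs_le:
  fixes f :: "'a::euclidean_space \<Rightarrow> real"
  assumes dim: "DIM('a) \<ge> 3" and f: "f \<in> test_functions \<Omega>" and e: "0 < e"
  defines "g \<equiv> \<lambda>x. smooth_abs e (f x)"
  shows "hardy_form g g \<le> hardy_form f f
     + e * (2 * ((real DIM('a) - 2) / 2)\<^sup>2 * (LINT x|lborel. \<bar>f x / (norm x)\<^sup>2\<bar>))"
proof -
  let ?c = "((real DIM('a) - 2) / 2)\<^sup>2"
  have g: "g \<in> test_functions \<Omega>" unfolding g_def by (rule test_smooth_abs[OF f e])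
  have 1: "(LINT x|lborel. grad g x \<bullet> grad g x) \<le> (LINT x|lborel. grad f x \<bullet> grad f x)"
    using grad_smooth_abs_le[OF f e] by (intro integral_mono integrable_grad_inner[of _ \<Omega>] f g) (auto simp: g_def)
  have i: "integrable lborel (\<lambda>x. f x * f x / (norm x)\<^sup>2)" "integrable lborel (\<lambda>x. g x * g x / (norm x)\<^sup>2)"
    "integrable lborel (\<lambda>x. f x / (norm x)\<^sup>2)"
    using integrable_divide_norm2[OF dim test_mult[OF f f]] integrable_divide_norm2[OF dim test_mult[OF g g]]
      integrable_divide_norm2[OF dim f] by auto
  have "(LINT x|lborel. f x * f x / (norm x)\<^sup>2) \<le> (LINT x|lborel. g x * g x / (norm x)\<^sup>2 + 2 * e * \<bar>f x / (norm x)\<^sup>2\<bar>)"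
  proof (intro integral_mono Bochner_Integration.integrable_add integrable_mult_right integrable_abs i)
    fix x
    note b = smooth_abs_bounds[OF e, of "f x"]
    have "(\<bar>f x\<bar> - g x) * (\<bar>f x\<bar> + g x) \<le> e * (2 * \<bar>f x\<bar>)"
      using b e by (intro mult_mono) (auto simp: g_def)
    then have "f x * f x \<le> g x * g x + 2 * e * \<bar>f x\<bar>"
      by (simp add: algebra_simps)
    then have "f x * f x / (norm x)\<^sup>2 \<le> (g x * g x + 2 * e * \<bar>f x\<bar>) / (norm x)\<^sup>2"
      by (rule divide_right_mono) simp
    then show "f x * f x / (norm x)\<^sup>2 \<le> g x * g x / (norm x)\<^sup>2 + 2 * e * \<bar>f x / (norm x)\<^sup>2\<bar>"
      by (simp add: add_divide_distrib)
  qed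
  also have "\<dots> = (LINT x|lborel. g x * g x / (norm x)\<^sup>2) + 2 * e * (LINT x|lborel. \<bar>f x / (norm x)\<^sup>2\<bar>)"
    by (subst Bochner_Integration.integral_add)
       (intro integrable_mult_right integrable_abs i arg_cong2[where f="(+)"] refl integral_mult_right_zero)+
  finally have 2: "?c * (LINT x|lborel. f x * f x / (norm x)\<^sup>2)
     \<le> ?c * ((LINT x|lborel. g x * g x / (norm x)\<^sup>2) + 2 * e * (LINT x|lborel. \<bar>f x / (norm x)\<^sup>2\<bar>))"
    by (intro mult_left_mono) auto
  have "hardy_form g g \<le> hardy_form f f + ?c * (2 * e * (LINT x|lborel. \<bar>f x / (norm x)\<^sup>2\<bar>))"
    unfolding hardy_form_def using 1 2[unfolded distrib_left] by linarith
  also have "?c * (2 * e * (LINT x|lborel. \<bar>f x / (norm x)\<^sup>2\<bar>)) = e * (2 * ?c * (LINT x|lborel. \<bar>f x / (norm x)\<^sup>2\<bar>))"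
    by (simp only: mult.assoc mult.left_commute)
  finally show ?thesis .
qed

text \<open>Convexity of the power, applied to \<open>a + b = (1 - t) (a/(1 - t)) + t (b/t)\<close>. The factor of \<open>a powr q\<close>
  tends to \<open>1\<close> as \<open>t \<rightarrow> 0\<close>, which replaces Minkowski's inequality in the next lemma.\<close>

lemma powr_add_convex:
  fixes a b q t :: real
  assumes "0 \<le> a" "0 \<le> b" "1 \<le> q" "0 < t" "t < 1"
  shows "(a + b) powr q \<le> (1 - t) powr (1 - q) * a powr q + t powr (1 - q) * b powr q"
proof -
  have le1: "1 \<le> s powr (1 - q)" if "0 < s" "s < 1" for s :: real
    using that assms(3) powr_mono_both'[of "1 - q" 0 s 1] powr_mono2'[of "1 - q" s 1] by simp
  consider "a = 0" | "b = 0" | "0 < a" "0 < b" using assms by linarith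
  then show ?thesis
  proof cases
    case 1
    then show ?thesis using le1[of t] assms mult_right_mono[of 1 "t powr (1 - q)" "b powr q"] by simp
  next
    case 2
    then show ?thesis using le1[of "1 - t"] assms mult_right_mono[of 1 "(1 - t) powr (1 - q)" "a powr q"] by simp
  next
    case 3
    have *: "s * (c / s) powr q = s powr (1 - q) * c powr q" if "0 < s" "0 < c" for s c :: real
      using that by (simp add: powr_divide powr_diff)
    have "((1 - t) *\<^sub>R (a / (1 - t)) + t *\<^sub>R (b / t)) powr q \<le> (1 - t) * (a / (1 - t)) powr q + t * (b / t) powr q"
      using assms 3 by (intro convex_onD[OF powr_convex[OF assms(3)]]) auto
    then show ?thesis using assms 3 by (simp add: *)
  qed
qed

lemma tendsto_Lp_integral_lower:
  fixes f :: "nat \<Rightarrow> 'a::euclidean_space \<Rightarrow> real"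
  assumes f: "tendsto_Lp \<Omega> q f u" and q: "1 \<le> q"
    and c: "c < (LINT x|lebesgue_on \<Omega>. \<bar>u x\<bar> powr q)"
  shows "\<forall>\<^sub>F n in sequentially. c < (LINT x|lebesgue_on \<Omega>. \<bar>f n x\<bar> powr q)"
proof -
  have q0: "0 \<le> q" using q by simp
  note fD = tendsto_LpD[OF f q0]
  define J where "J = (LINT x|lebesgue_on \<Omega>. \<bar>u x\<bar> powr q)"
  define D where "D n = (LINT x|lebesgue_on \<Omega>. \<bar>f n x - u x\<bar> powr q)" for n
  have "((\<lambda>t::real. (1 - t) powr (q - 1) * J) \<longlongrightarrow> (1 - 0) powr (q - 1) * J) (at_right 0)"
    by (intro tendsto_intros) auto
  then have "\<forall>\<^sub>F t::real in at_right 0. c < (1 - t) powr (q - 1) * J"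
    using c by (intro order_tendstoD(1)) (auto simp: J_def)
  moreover have "\<forall>\<^sub>F t::real in at_right 0. 0 < t \<and> t < 1"
    unfolding eventually_at_right_field by (rule exI[of _ 1]) auto
  ultimately have "\<forall>\<^sub>F t::real in at_right 0. c < (1 - t) powr (q - 1) * J \<and> 0 < t \<and> t < 1"
    by (rule eventually_conj)
  then obtain t where t: "c < (1 - t) powr (q - 1) * J" "0 < t" "t < 1"
    using eventually_happens'[OF trivial_limit_at_right_real] by blast
  have "(\<lambda>n. (1 - t) powr (q - 1) * (J - t powr (1 - q) * D n)) \<longlonglongrightarrow> (1 - t) powr (q - 1) * (J - t powr (1 - q) * 0)"
    using fD(6) by (intro tendsto_intros) (simp add: D_def[abs_def])
  then have "\<forall>\<^sub>F n in sequentially. c < (1 - t) powr (q - 1) * (J - t powr (1 - q) * D n)"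
    using t(1) by (intro order_tendstoD(1)) auto
  then show ?thesis
  proof eventually_elim
    case (elim n)
    have "J \<le> (LINT x|lebesgue_on \<Omega>. (1 - t) powr (1 - q) * \<bar>f n x\<bar> powr q + t powr (1 - q) * \<bar>f n x - u x\<bar> powr q)"
      unfolding J_def
    proof (intro integral_mono Bochner_Integration.integrable_add integrable_mult_right fD(3,4,5))
      fix x
      have "\<bar>u x\<bar> powr q \<le> (\<bar>f n x\<bar> + \<bar>f n x - u x\<bar>) powr q"
        using q by (intro powr_mono2) auto
      also have "\<dots> \<le> (1 - t) powr (1 - q) * \<bar>f n x\<bar> powr q + t powr (1 - q) * \<bar>f n x - u x\<bar> powr q"
        using q t by (intro powr_add_convex) auto
      finally show "\<bar>u x\<bar> powr q \<le> (1 - t) powr (1 - q) * \<bar>f n x\<bar> powr q + t powr (1 - q) * \<bar>f n x - u x\<bar> powr q" .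
    qed
    also have "\<dots> = (1 - t) powr (1 - q) * (LINT x|lebesgue_on \<Omega>. \<bar>f n x\<bar> powr q) + t powr (1 - q) * D n"
      unfolding D_def using fD(3,5)[of n] by simp
    finally have "(1 - t) powr (q - 1) * (J - t powr (1 - q) * D n)
       \<le> (1 - t) powr (q - 1) * ((1 - t) powr (1 - q) * (LINT x|lebesgue_on \<Omega>. \<bar>f n x\<bar> powr q))"
      by (intro mult_left_mono) auto
    also have "\<dots> = (LINT x|lebesgue_on \<Omega>. \<bar>f n x\<bar> powr q)"
      using t by (simp add: mult.assoc[symmetric] powr_add[symmetric])
    finally show ?case using elim by simp
  qed
qed

text \<open>Boundedness of \<open>\<Omega>\<close> enters because the error \<open>e n\<close> of the approximation is uniform in \<open>x\<close> and has to be
  small in \<open>L\<^sup>p\<close>.\<close>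

lemma tendsto_Lp_smooth_abs:
  fixes f :: "nat \<Rightarrow> 'a::euclidean_space \<Rightarrow> real"
  assumes f: "tendsto_Lp \<Omega> p f u" and p: "1 \<le> p" and e: "\<And>n. 0 < e n" "e \<longlonglongrightarrow> 0"
    and \<Omega>: "open \<Omega>" "bounded \<Omega>"
    and t: "\<And>n. f n \<in> test_functions \<Omega>"
  shows "tendsto_Lp \<Omega> p (\<lambda>n x. smooth_abs (e n) (f n x)) (\<lambda>x. \<bar>u x\<bar>)"
proof -
  have p0: "0 \<le> p" using p by simp
  note fD = tendsto_LpD[OF f p0]
  let ?g = "\<lambda>n x. smooth_abs (e n) (f n x)"
  have gt: "?g n \<in> test_functions \<Omega>" for n by (rule test_smooth_abs[OF t e(1)])
  have gm: "?g n \<in> borel_measurable (lebesgue_on \<Omega>)" for n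
    by (rule borel_measurable_lebesgue_onI[OF test_borel[OF gt]])
  have gi: "integrable (lebesgue_on \<Omega>) (\<lambda>x. \<bar>?g n x\<bar> powr p)" for n
    using p by (intro test_powr_integrable[OF gt] \<Omega>) auto
  have fin: "emeasure (lebesgue_on \<Omega>) (space (lebesgue_on \<Omega>)) < \<infinity>"
    using emeasure_bounded_finite[OF \<Omega>(2)] \<Omega>(1) open_sets_lebesgue[OF \<Omega>(1)]
    by (simp add: emeasure_restrict_space)
  interpret finite_measure "lebesgue_on \<Omega>"
    using fin by (intro finite_measureI) auto
  have b: "(LINT x|lebesgue_on \<Omega>. \<bar>?g n x - \<bar>u x\<bar>\<bar> powr p)
      \<le> 2 powr p * ((LINT x|lebesgue_on \<Omega>. \<bar>f n x - u x\<bar> powr p) + measure (lebesgue_on \<Omega>) (space (lebesgue_on \<Omega>)) * e n powr p)" for n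
  proof -
    have m: "(\<lambda>x. f n x - u x) \<in> borel_measurable (lebesgue_on \<Omega>)"
      "(\<lambda>x. e n) \<in> borel_measurable (lebesgue_on \<Omega>)"
      "(\<lambda>x. ?g n x - \<bar>u x\<bar>) \<in> borel_measurable (lebesgue_on \<Omega>)"
      using fD(1)[of n] fD(2) gm[of n] by auto
    have le: "\<bar>?g n x - \<bar>u x\<bar>\<bar> \<le> \<bar>f n x - u x\<bar> + \<bar>e n\<bar>" for x
      using smooth_abs_bounds[OF e(1)[of n], of "f n x"] e(1)[of n] by linarith
    have ce: "integrable (lebesgue_on \<Omega>) (\<lambda>x. \<bar>e n\<bar> powr p)" by simp
    show ?thesis
      using integrable_powr_add(2)[OF p0 m fD(5) ce le] e(1)[of n] by simp
  qed
  have "(\<lambda>n. LINT x|lebesgue_on \<Omega>. \<bar>?g n x - \<bar>u x\<bar>\<bar> powr p) \<longlonglongrightarrow> 0"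
  proof (rule tendsto_sandwich[OF _ _ tendsto_const])
    have "(\<lambda>n. e n powr p) \<longlonglongrightarrow> 0"
      using e p by (intro tendsto_zero_powrI[OF e(2) tendsto_const]) (auto intro!: always_eventually less_imp_le)
    then have "(\<lambda>n. 2 powr p * ((LINT x|lebesgue_on \<Omega>. \<bar>f n x - u x\<bar> powr p)
         + measure (lebesgue_on \<Omega>) (space (lebesgue_on \<Omega>)) * e n powr p))
      \<longlonglongrightarrow> 2 powr p * (0 + measure (lebesgue_on \<Omega>) (space (lebesgue_on \<Omega>)) * 0)"
      by (intro tendsto_intros fD(6))
    then show "(\<lambda>n. 2 powr p * ((LINT x|lebesgue_on \<Omega>. \<bar>f n x - u x\<bar> powr p)
         + measure (lebesgue_on \<Omega>) (space (lebesgue_on \<Omega>)) * e n powr p)) \<longlonglongrightarrow> 0" by simp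
  qed (use b in auto)
  then show ?thesis using gm gi fD(2,4) by (simp add: tendsto_Lp_def)
qed

text \<open>For test functions the value of the problem bounds the form without a quotient, so that \<open>v = 0\<close> need
  not be excluded.\<close>

lemma H_minimizer_inequality:
  fixes u :: "'a::euclidean_space \<Rightarrow> real"
  assumes dim: "DIM('a) \<ge> 3" and op: "open \<Omega>"
    and min: "H_minimizer \<Omega> q u" and q: "1 \<le> q"
    and v: "v \<in> test_functions \<Omega>"
  shows "H_quotient \<Omega> q u * (LINT x|lebesgue_on \<Omega>. \<bar>v x\<bar> powr q) powr (2 / q) \<le> hardy_form v v"
proof (cases "AE x in lebesgue_on \<Omega>. v x = 0")
  case True
  then have "(LINT x|lebesgue_on \<Omega>. \<bar>v x\<bar> powr q) = 0"
    by (intro integral_eq_zero_AE) (auto elim: eventually_mono)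
  then show ?thesis using hardy_form_nonneg[OF dim v] by simp
next
  case False
  let ?I = "LINT x|lebesgue_on \<Omega>. \<bar>v x\<bar> powr q"
  have vi: "integrable (lebesgue_on \<Omega>) (\<lambda>x. \<bar>v x\<bar> powr q)"
    using q by (intro test_powr_integrable[OF v] op) auto
  have "?I \<noteq> 0"
  proof
    assume "?I = 0"
    then have "AE x in lebesgue_on \<Omega>. \<bar>v x\<bar> powr q = 0"
      using integral_nonneg_eq_0_iff_AE[OF vi] by simp
    then show False using False by (auto elim: eventually_mono)
  qed
  moreover have "0 \<le> ?I" by simp
  ultimately have I: "0 < ?I" by linarith
  have "v \<in> H_space \<Omega>" using H_represents_test[OF op v] by (auto simp: H_space_def)
  then have "\<not> H_quotient \<Omega> q v < H_quotient \<Omega> q u"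
    using min False by (auto simp: H_minimizer_def is_arg_min_def)
  then have "H_quotient \<Omega> q u \<le> hardy_form v v / ?I powr (2 / q)"
    using hardy_form_nonneg[OF dim v]
    by (simp add: H_quotient_def H_norm_test[OF dim op v] hardy_norm_eq[OF op v])
  then show ?thesis using I by (simp add: field_simps)
qed

text \<open>With \<open>l\<close> the norm of \<open>u\<close> and \<open>P\<close> the integral in question, comparison of \<open>f\<^sub>n + t \<psi>\<close> with the minimal
  value yields \<open>l\<^sup>2 \<le> l\<^sup>2 + 2 t P + t\<^sup>2 hardy_form \<psi> \<psi>\<close> in the limit \<open>n \<rightarrow> \<infinity>\<close>, and this for
  all \<open>t > 0\<close> only if \<open>P \<ge> 0\<close>.\<close>

proposition minimizer_abs_supersolution:
  fixes u :: "'a::euclidean_space \<Rightarrow> real"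
  assumes dim: "DIM('a) \<ge> 3" and \<Omega>: "open \<Omega>" "bounded \<Omega>"
    and min: "H_minimizer \<Omega> q u" and q: "1 \<le> q" "q < 2 * real DIM('a) / (real DIM('a) - 2)"
    and \<psi>: "\<psi> \<in> test_functions \<Omega>" "\<And>x. 0 \<le> \<psi> x"
  shows "integrable (lebesgue_on \<Omega>) (\<lambda>x. \<bar>u x\<bar> * hardy_op \<psi> x)"
    and "0 \<le> (LINT x|lebesgue_on \<Omega>. \<bar>u x\<bar> * hardy_op \<psi> x)"
proof -
  have uH: "u \<in> H_space \<Omega>" and u0: "\<not> (AE x in lebesgue_on \<Omega>. u x = 0)"
    using min by (auto simp: H_minimizer_def is_arg_min_def)
  from uH obtain \<phi> where rep: "H_represents \<Omega> \<phi> u" by (auto simp: H_space_def)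
  have \<phi>: "\<phi> n \<in> test_functions \<Omega>" for n using rep by (simp add: H_represents_def)
  have Lp: "tendsto_Lp \<Omega> p \<phi> u" if "1 \<le> p" "p < 2 * real DIM('a) / (real DIM('a) - 2)" for p
    using rep that by (simp add: H_represents_def)
  define l where "l = H_norm \<Omega> u"
  have l: "(\<lambda>n. hardy_norm \<Omega> (\<phi> n)) \<longlonglongrightarrow> l" unfolding l_def by (rule H_norm_LIMSEQ[OF dim \<Omega>(1) rep])
  define A where "A n = 2 * ((real DIM('a) - 2) / 2)\<^sup>2 * (LINT x|lborel. \<bar>\<phi> n x / (norm x)\<^sup>2\<bar>)" for n
  have A: "0 \<le> A n" for n unfolding A_def by (intro mult_nonneg_nonneg) auto
  \<comment> \<open>so small that smoothing costs at most \<open>1/(n + 1)\<close> in the form, and tending to \<open>0\<close>\<close>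
  define e where "e n = inverse (real (Suc n)) / (1 + A n)" for n
  have e: "0 < e n" for n using A[of n] by (simp add: e_def add_pos_nonneg)
  have "e n \<le> inverse (real (Suc n))" for n
  proof -
    have "inverse (real (Suc n)) / (1 + A n) \<le> inverse (real (Suc n)) / 1"
      using A[of n] by (intro divide_left_mono) auto
    then show ?thesis by (simp add: e_def)
  qed
  then have e0: "e \<longlonglongrightarrow> 0"
    using e by (intro tendsto_sandwich[OF _ _ tendsto_const LIMSEQ_inverse_real_of_nat]) (auto intro!: always_eventually less_imp_le)
  define f where "f n = (\<lambda>x. smooth_abs (e n) (\<phi> n x))" for n
  have f: "f n \<in> test_functions \<Omega>" for n unfolding f_def by (rule test_smooth_abs[OF \<phi> e])
  have f_nonneg: "0 \<le> f n x" for n x using smooth_abs_bounds[OF e] by (simp add: f_def)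
  have fLp: "tendsto_Lp \<Omega> p f (\<lambda>x. \<bar>u x\<bar>)" if "1 \<le> p" "p < 2 * real DIM('a) / (real DIM('a) - 2)" for p
    unfolding f_def[abs_def] by (rule tendsto_Lp_smooth_abs[OF Lp[OF that] that(1) e e0 \<Omega> \<phi>])
  have fQ: "hardy_form (f n) (f n) \<le> (hardy_norm \<Omega> (\<phi> n))\<^sup>2 + inverse (real (Suc n))" for n
  proof -
    have "e n * A n \<le> e n * (1 + A n)" using e[of n] by (intro mult_left_mono) auto
    also have "\<dots> = inverse (real (Suc n))" using A[of n] by (simp add: e_def)
    finally have "e n * A n \<le> inverse (real (Suc n))" .
    moreover have "(hardy_norm \<Omega> (\<phi> n))\<^sup>2 = hardy_form (\<phi> n) (\<phi> n)"
      using hardy_norm_eq[OF \<Omega>(1) \<phi>] hardy_form_nonneg[OF dim \<phi>] by simp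
    ultimately show ?thesis
      using hardy_form_smooth_abs_le[OF dim \<phi>[of n] e[of n]] unfolding f_def A_def by linarith
  qed
  define P where "P = (LINT x|lebesgue_on \<Omega>. \<bar>u x\<bar> * hardy_op \<psi> x)"
  note pairing = hardy_op_pairing[OF dim \<Omega>(1) fLp[OF hardy_exponent_range[OF dim]] \<psi>(1)]
  show "integrable (lebesgue_on \<Omega>) (\<lambda>x. \<bar>u x\<bar> * hardy_op \<psi> x)" by (rule pairing(1))
  have P: "(\<lambda>n. hardy_form (f n) \<psi>) \<longlonglongrightarrow> P"
    using pairing(2) by (simp add: P_def hardy_form_eq_integral_on[OF dim \<Omega>(1) f \<psi>(1)])
  define m where "m = H_quotient \<Omega> q u"
  define I where "I v = (LINT x|lebesgue_on \<Omega>. \<bar>v x\<bar> powr q)" for v :: "'a \<Rightarrow> real"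
  have m: "0 \<le> m" by (auto simp: m_def H_quotient_def)
  have uq: "integrable (lebesgue_on \<Omega>) (\<lambda>x. \<bar>u x\<bar> powr q)"
    using tendsto_LpD(4)[OF Lp[OF q]] q by simp
  have Iu: "0 < I u"
  proof -
    have "I u \<noteq> 0"
    proof
      assume "I u = 0"
      then have "AE x in lebesgue_on \<Omega>. \<bar>u x\<bar> powr q = 0"
        using integral_nonneg_eq_0_iff_AE[OF uq] by (simp add: I_def)
      then show False using u0 by (auto elim: eventually_mono)
    qed
    moreover have "0 \<le> I u" by (simp add: I_def)
    ultimately show ?thesis by linarith
  qed
  have ml: "m * I u powr (2 / q) = l\<^sup>2"
    using Iu by (simp add: m_def H_quotient_def l_def I_def)
  have key: "l\<^sup>2 \<le> l\<^sup>2 + 2 * t * P + t\<^sup>2 * hardy_form \<psi> \<psi>" if t: "0 < t" for t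
  proof (rule ccontr)
    let ?R = "\<lambda>n. (hardy_norm \<Omega> (\<phi> n))\<^sup>2 + inverse (real (Suc n)) + 2 * t * hardy_form (f n) \<psi> + t\<^sup>2 * hardy_form \<psi> \<psi>"
    let ?Z = "l\<^sup>2 + 2 * t * P + t\<^sup>2 * hardy_form \<psi> \<psi>"
    have R: "?R \<longlonglongrightarrow> l\<^sup>2 + 0 + 2 * t * P + t\<^sup>2 * hardy_form \<psi> \<psi>"
      by (intro tendsto_intros l P LIMSEQ_inverse_real_of_nat)
    assume "\<not> l\<^sup>2 \<le> ?Z"
    then have Z: "?Z < m * I u powr (2 / q)" by (simp add: ml)
    \<comment> \<open>a level \<open>c\<close> slightly below \<open>I u\<close>, which the integrals \<open>I (f n)\<close> eventually exceed\<close>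
    have "((\<lambda>c. m * c powr (2 / q)) \<longlongrightarrow> m * I u powr (2 / q)) (at_left (I u))"
      using Iu by (intro tendsto_intros) auto
    then have "\<forall>\<^sub>F c in at_left (I u). ?Z < m * c powr (2 / q)" using Z by (rule order_tendstoD(1))
    moreover have "\<forall>\<^sub>F c in at_left (I u). 0 < c \<and> c < I u"
      unfolding eventually_at_left_field using Iu by (intro exI[of _ 0]) auto
    ultimately have "\<forall>\<^sub>F c in at_left (I u). ?Z < m * c powr (2 / q) \<and> 0 < c \<and> c < I u"
      by (rule eventually_conj)
    then obtain c where c: "?Z < m * c powr (2 / q)" "0 < c" "c < I u"
      using eventually_happens'[OF trivial_limit_at_left_real] by blast
    have "\<forall>\<^sub>F n in sequentially. c < I (f n)"
      unfolding I_def using c(3) q by (intro tendsto_Lp_integral_lower[OF fLp[OF q]]) (auto simp: I_def)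
    then have "\<forall>\<^sub>F n in sequentially. m * c powr (2 / q) \<le> ?R n"
    proof eventually_elim
      case (elim n)
      let ?v = "\<lambda>x. f n x + t * \<psi> x"
      have v: "?v \<in> test_functions \<Omega>" by (intro test_add test_cmult f \<psi>)
      have "I (f n) \<le> I ?v"
        unfolding I_def
      proof (intro integral_mono test_powr_integrable[OF f] test_powr_integrable[OF v] \<Omega>)
        fix x show "\<bar>f n x\<bar> powr q \<le> \<bar>?v x\<bar> powr q"
          using f_nonneg[of n x] \<psi>(2)[of x] t q by (intro powr_mono2) auto
      qed (use q in auto)
      then have "c powr (2 / q) \<le> I ?v powr (2 / q)"
        using elim c(2) q by (intro powr_mono2) auto
      then have "m * c powr (2 / q) \<le> m * I ?v powr (2 / q)" using m by (rule mult_left_mono)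
      also have "\<dots> \<le> hardy_form ?v ?v"
        unfolding m_def I_def by (rule H_minimizer_inequality[OF dim \<Omega>(1) min q(1) v])
      also have "\<dots> = hardy_form (f n) (f n) + 2 * t * hardy_form (f n) \<psi> + t\<^sup>2 * hardy_form \<psi> \<psi>"
        by (rule hardy_form_add_cmult[OF dim f \<psi>(1)])
      also have "\<dots> \<le> ?R n" using fQ[of n] by simp
      finally show ?case .
    qed
    then have "m * c powr (2 / q) \<le> ?Z"
      using tendsto_lowerbound[OF R] by simp
    then show False using c(1) by simp
  qed
  show "0 \<le> (LINT x|lebesgue_on \<Omega>. \<bar>u x\<bar> * hardy_op \<psi> x)"
  proof (rule ccontr)
    assume "\<not> ?thesis"
    then have Pneg: "P < 0" by (simp add: P_def)
    define h where "h = hardy_form \<psi> \<psi>"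
    have h: "0 \<le> h" unfolding h_def by (rule hardy_form_nonneg[OF dim \<psi>(1)])
    define t where "t = - P / (h + 1)"
    have t: "0 < t" using Pneg h unfolding t_def by (intro divide_pos_pos) auto
    have "0 \<le> t * (2 * P + t * h)" using key[OF t] by (simp add: h_def power2_eq_square algebra_simps)
    then have "0 \<le> 2 * P + t * h" using t by (simp add: zero_le_mult_iff)
    moreover have "t * h \<le> t * (h + 1)" using t by simp
    moreover have "t * (h + 1) = - P" using h by (simp add: t_def)
    ultimately show False using Pneg by linarith
  qed
qed

section \<open>The weighted \<open>L\<^sup>2\<close> bound for functions in \<open>H\<^sub>0\<^sup>1(\<Omega>)\<close>\<close>

lemma nn_integral_le_AE_limit:
  assumes "\<And>n. f n \<in> borel_measurable M" "AE x in M. (\<lambda>n. f n x) \<longlonglongrightarrow> g x"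
    and "\<And>n. (\<integral>\<^sup>+x. f n x \<partial>M) \<le> (C::ennreal)"
  shows "(\<integral>\<^sup>+x. g x \<partial>M) \<le> C"
proof -
  have "(\<integral>\<^sup>+x. g x \<partial>M) = (\<integral>\<^sup>+x. liminf (\<lambda>n. f n x) \<partial>M)"
    using assms(2) by (intro nn_integral_cong_AE) (auto elim!: eventually_mono dest: lim_imp_Liminf[OF sequentially_bot])
  also have "\<dots> \<le> liminf (\<lambda>n. \<integral>\<^sup>+x. f n x \<partial>M)" by (rule nn_integral_liminf[OF assms(1)])
  also have "\<dots> \<le> liminf (\<lambda>n. C)" using assms(3) by (intro Liminf_mono always_eventually) auto
  also have "\<dots> = C" by (simp add: Liminf_const)
  finally show ?thesis .
qed

text \<open>The gradients of an approximating sequence are bounded in \<open>L\<^sup>2\<close>, hence so are the functions divided by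
  the norm, by Hardy's inequality. Fatou's lemma along a subsequence converging almost everywhere carries
  the bound over to \<open>u\<close>.\<close>

proposition H10_integrable_divide_norm2:
  fixes u :: "'a::euclidean_space \<Rightarrow> real"
  assumes dim: "DIM('a) \<ge> 3" and op: "open \<Omega>" and u: "u \<in> H10_space \<Omega>"
  shows "integrable (lebesgue_on \<Omega>) (\<lambda>x. (u x)\<^sup>2 / (norm x)\<^sup>2)"
proof -
  obtain g \<phi> where \<phi>: "\<And>n. \<phi> n \<in> test_functions \<Omega>"
    and Lu: "tendsto_Lp \<Omega> 2 \<phi> u" and Lg: "tendsto_Lp \<Omega> 2 (\<lambda>n. grad (\<phi> n)) g"
    using u by (auto simp: H10_space_def)
  let ?M = "lebesgue_on \<Omega>"
  let ?c = "((real DIM('a) - 2) / 2)\<^sup>2"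
  have c: "0 < ?c" using dim by simp
  have p2: "norm y powr 2 = (norm y)\<^sup>2" for y :: 'a by simp
  have G: "grad (\<phi> n) \<in> borel_measurable ?M" "integrable ?M (\<lambda>x. (norm (grad (\<phi> n) x))\<^sup>2)"
    "g \<in> borel_measurable ?M" "integrable ?M (\<lambda>x. (norm (g x))\<^sup>2)"
    "(\<lambda>n. LINT x|?M. (norm (grad (\<phi> n) x - g x))\<^sup>2) \<longlonglongrightarrow> 0" for n
    using Lg by (auto simp: tendsto_Lp_def)
  have sq: "(norm (a + b))\<^sup>2 \<le> 2 * (norm a)\<^sup>2 + 2 * (norm b)\<^sup>2" for a b :: 'a
  proof -
    have "(norm (a + b))\<^sup>2 \<le> (norm a + norm b)\<^sup>2" by (intro power_mono norm_triangle_ineq) auto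
    also have "\<dots> \<le> 2 * (norm a)\<^sup>2 + 2 * (norm b)\<^sup>2"
      using sum_squares_bound[of "norm a" "norm b"] by (simp add: power2_sum)
    finally show ?thesis .
  qed
  have Gd: "integrable ?M (\<lambda>x. (norm (grad (\<phi> n) x - g x))\<^sup>2)" for n
  proof (rule Bochner_Integration.integrable_bound)
    show "integrable ?M (\<lambda>x. 2 * (norm (grad (\<phi> n) x))\<^sup>2 + 2 * (norm (g x))\<^sup>2)" using G by simp
    show "AE x in ?M. norm ((norm (grad (\<phi> n) x - g x))\<^sup>2) \<le> norm (2 * (norm (grad (\<phi> n) x))\<^sup>2 + 2 * (norm (g x))\<^sup>2)"
    proof (rule AE_I2)
      fix x
      show "norm ((norm (grad (\<phi> n) x - g x))\<^sup>2) \<le> norm (2 * (norm (grad (\<phi> n) x))\<^sup>2 + 2 * (norm (g x))\<^sup>2)"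
        using sq[of "grad (\<phi> n) x" "- g x"] by simp
    qed
  qed (use G(1)[of n] G(3) in measurable)
  obtain D where D: "\<And>n. (LINT x|?M. (norm (grad (\<phi> n) x - g x))\<^sup>2) \<le> D"
    using convergent_imp_Bseq[OF convergentI[OF G(5)]] unfolding Bseq_def by (metis abs_le_D1 real_norm_def)
  define B where "B = 2 * D + 2 * (LINT x|?M. (norm (g x))\<^sup>2)"
  have B: "(LINT x|?M. (norm (grad (\<phi> n) x))\<^sup>2) \<le> B" for n
  proof -
    have "(LINT x|?M. (norm (grad (\<phi> n) x))\<^sup>2) \<le> (LINT x|?M. 2 * (norm (grad (\<phi> n) x - g x))\<^sup>2 + 2 * (norm (g x))\<^sup>2)"
    proof (intro integral_mono)
      fix x
      show "(norm (grad (\<phi> n) x))\<^sup>2 \<le> 2 * (norm (grad (\<phi> n) x - g x))\<^sup>2 + 2 * (norm (g x))\<^sup>2"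
        using sq[of "grad (\<phi> n) x - g x" "g x"] by simp
    qed (use G Gd in auto)
    also have "\<dots> = 2 * (LINT x|?M. (norm (grad (\<phi> n) x - g x))\<^sup>2) + 2 * (LINT x|?M. (norm (g x))\<^sup>2)"
      using G(4) Gd[of n] by simp
    also have "\<dots> \<le> B" using D[of n] by (simp add: B_def)
    finally show ?thesis .
  qed
  have i: "integrable ?M (\<lambda>x. (\<phi> n x)\<^sup>2 / (norm x)\<^sup>2)" for n
    using integrable_divide_norm2[OF dim test_mult[OF \<phi> \<phi>]] test_borel[OF \<phi>] test_outside[OF \<phi>]
    by (subst integral_lebesgue_on_eq_lborel(2)[OF open_sets_lebesgue[OF op]]) (auto simp: power2_eq_square)
  have bound: "(LINT x|?M. (\<phi> n x)\<^sup>2 / (norm x)\<^sup>2) \<le> B / ?c" for n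
  proof -
    have "0 \<le> (hardy_norm \<Omega> (\<phi> n))" using hardy_norm_eq[OF op \<phi>] hardy_form_nonneg[OF dim \<phi>] by simp
    then have "?c * (LINT x|?M. (\<phi> n x)\<^sup>2 / (norm x)\<^sup>2) \<le> (LINT x|?M. (norm (grad (\<phi> n) x))\<^sup>2)"
      unfolding hardy_norm_def by simp
    also have "\<dots> \<le> B" by (rule B)
    finally show ?thesis using c by (simp add: pos_le_divide_eq mult.commute del: power_divide)
  qed
  obtain r where r: "AE x in ?M. (\<lambda>n. \<bar>\<phi> (r n) x - u x\<bar> powr 2) \<longlonglongrightarrow> 0"
    using tendsto_L1_AE_subseq[of ?M "\<lambda>n x. \<bar>\<phi> n x - u x\<bar> powr 2"] tendsto_LpD[OF Lu] by auto
  have um: "u \<in> borel_measurable ?M" using Lu by (simp add: tendsto_Lp_def)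
  have nm: "(\<lambda>x::'a. norm x) \<in> borel_measurable ?M" by (rule borel_measurable_lebesgue_onI) simp
  have "(\<integral>\<^sup>+x. ennreal ((u x)\<^sup>2 / (norm x)\<^sup>2) \<partial>?M) \<le> ennreal (B / ?c)"
  proof (rule nn_integral_le_AE_limit[where f="\<lambda>n x. ennreal ((\<phi> (r n) x)\<^sup>2 / (norm x)\<^sup>2)"])
    show "AE x in ?M. (\<lambda>n. ennreal ((\<phi> (r n) x)\<^sup>2 / (norm x)\<^sup>2)) \<longlonglongrightarrow> ennreal ((u x)\<^sup>2 / (norm x)\<^sup>2)"
      using r
    proof eventually_elim
      case (elim x)
      have "(\<lambda>n. \<bar>\<phi> (r n) x - u x\<bar>) \<longlonglongrightarrow> 0"
        using tendsto_real_sqrt[OF elim] by simp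
      then have "(\<lambda>n. \<phi> (r n) x) \<longlonglongrightarrow> u x" by (simp add: LIM_zero_iff tendsto_rabs_zero_iff)
      then show ?case
        unfolding divide_inverse by (intro tendsto_ennrealI tendsto_mult_right tendsto_power)
    qed
    show "(\<lambda>x. ennreal ((\<phi> (r n) x)\<^sup>2 / (norm x)\<^sup>2)) \<in> borel_measurable ?M" for n
      using borel_measurable_integrable[OF i] by simp
    show "(\<integral>\<^sup>+x. ennreal ((\<phi> (r n) x)\<^sup>2 / (norm x)\<^sup>2) \<partial>?M) \<le> ennreal (B / ?c)" for n
      by (subst nn_integral_eq_integral[OF i]) (auto intro!: ennreal_leI bound simp del: power_divide)
  qed
  also have "\<dots> < \<infinity>" by simp
  finally show ?thesis
    using um nm by (intro integrableI_nonneg) auto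
qed

section \<open>Radial test functions\<close>

lemma laplacian_eq_0_open:
  assumes "open U" "x \<in> U" "\<And>y. y \<in> U \<Longrightarrow> f y = 0"
  shows "laplacian f x = 0"
  unfolding laplacian_def
  by (intro sum.neutral ballI pd_eq_0_open[OF assms(1) _ assms(2)] pd_eq_0_open[OF assms(1,3)])

lemma laplacian_radial:
  fixes x z :: "'a::euclidean_space"
  assumes S: "open S" "(norm (x - z))\<^sup>2 \<in> S"
    and G: "\<And>s. s \<in> S \<Longrightarrow> (G has_real_derivative G1 s) (at s)"
    and G1: "\<And>s. s \<in> S \<Longrightarrow> (G1 has_real_derivative G2 s) (at s)"
  shows "laplacian (\<lambda>x. G ((norm (x - z))\<^sup>2)) x
    = 2 * real DIM('a) * G1 ((norm (x - z))\<^sup>2) + 4 * (norm (x - z))\<^sup>2 * G2 ((norm (x - z))\<^sup>2)"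
proof -
  define U where "U = {y::'a. (norm (y - z))\<^sup>2 \<in> S}"
  have U: "open U" "x \<in> U"
    using S unfolding U_def by (auto intro!: continuous_intros open_vimage[of S "\<lambda>y. (norm (y - z))\<^sup>2", unfolded vimage_def])
  have r: "((\<lambda>y. (norm (y - z))\<^sup>2) has_derivative (\<lambda>h. 2 * ((y - z) \<bullet> h))) (at y)" for y
    unfolding power2_norm_eq_inner by (auto intro!: derivative_eq_intros simp: inner_commute)
  have comp: "((\<lambda>y. H ((norm (y - z))\<^sup>2)) has_derivative (\<lambda>h. H' ((norm (y - z))\<^sup>2) * (2 * ((y - z) \<bullet> h)))) (at y)"
    if "y \<in> U" "\<And>s. s \<in> S \<Longrightarrow> (H has_real_derivative H' s) (at s)" for H H' y
    using has_derivative_compose[OF r, of H "(*) (H' ((norm (y - z))\<^sup>2))" y] that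
    by (simp add: U_def has_field_derivative_def)
  have pd1: "pd i (\<lambda>y. G ((norm (y - z))\<^sup>2)) y = G1 ((norm (y - z))\<^sup>2) * (2 * ((y - z) \<bullet> i))" if "y \<in> U" for i y
    by (subst frechet_derivative_at[OF comp[OF that G], symmetric]) auto
  have pd2: "pd i (pd i (\<lambda>y. G ((norm (y - z))\<^sup>2))) x
      = 2 * G1 ((norm (x - z))\<^sup>2) + 4 * ((x - z) \<bullet> i)\<^sup>2 * G2 ((norm (x - z))\<^sup>2)" if i: "i \<in> Basis" for i
  proof -
    have "((\<lambda>y. 2 * ((y - z) \<bullet> i)) has_derivative (\<lambda>h. 2 * (h \<bullet> i))) (at x)"
      by (auto intro!: derivative_eq_intros)
    from has_derivative_mult[OF comp[OF U(2) G1] this]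
    have "((\<lambda>y. G1 ((norm (y - z))\<^sup>2) * (2 * ((y - z) \<bullet> i))) has_derivative
       (\<lambda>h. G1 ((norm (x - z))\<^sup>2) * (2 * (h \<bullet> i)) + G2 ((norm (x - z))\<^sup>2) * (2 * ((x - z) \<bullet> h)) * (2 * ((x - z) \<bullet> i)))) (at x)" .
    then have "(pd i (\<lambda>y. G ((norm (y - z))\<^sup>2)) has_derivative
       (\<lambda>h. G1 ((norm (x - z))\<^sup>2) * (2 * (h \<bullet> i)) + G2 ((norm (x - z))\<^sup>2) * (2 * ((x - z) \<bullet> h)) * (2 * ((x - z) \<bullet> i)))) (at x)"
      by (rule has_derivative_transform_within_open[OF _ U]) (simp add: pd1)
    from frechet_derivative_at[OF this, symmetric]
    show ?thesis using i by (simp add: power2_eq_square)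
  qed
  have "laplacian (\<lambda>x. G ((norm (x - z))\<^sup>2)) x
    = (\<Sum>i\<in>Basis. 2 * G1 ((norm (x - z))\<^sup>2) + 4 * ((x - z) \<bullet> i)\<^sup>2 * G2 ((norm (x - z))\<^sup>2))"
    unfolding laplacian_def by (intro sum.cong refl pd2)
  also have "\<dots> = 2 * real DIM('a) * G1 ((norm (x - z))\<^sup>2) + 4 * (\<Sum>i\<in>Basis. ((x - z) \<bullet> i)\<^sup>2) * G2 ((norm (x - z))\<^sup>2)"
    by (simp add: sum.distrib sum_distrib_left sum_distrib_right)
  also have "(\<Sum>i\<in>Basis. ((x - z) \<bullet> i)\<^sup>2) = (norm (x - z))\<^sup>2"
    by (subst power2_norm_eq_inner, subst (2) euclidean_inner) (simp add: power2_eq_square)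
  finally show ?thesis .
qed

text \<open>A single term of the exponential series at \<open>1/s\<close> is at most its sum.\<close>

lemma flat_le_fact: "flat (- int k) s \<le> fact k"
proof (cases "s \<le> 0")
  case False
  let ?y = "1 / s"
  have "inverse (fact k) *\<^sub>R ?y ^ k = (\<Sum>n\<in>{k}. inverse (fact n) *\<^sub>R ?y ^ n)" by simp
  also have "\<dots> \<le> exp ?y"
    unfolding exp_def using False
    by (intro sum_le_suminf summable_exp_generic) auto
  finally have le: "inverse (fact k) *\<^sub>R ?y ^ k \<le> exp ?y" .
  have "?y ^ k = fact k * (inverse (fact k) *\<^sub>R ?y ^ k)" by simp
  also have "\<dots> \<le> fact k * exp ?y" using le by (rule mult_left_mono) simp
  finally have "?y ^ k \<le> fact k * exp ?y" .
  then have "?y ^ k * exp (- ?y) \<le> fact k * exp ?y * exp (- ?y)" by (intro mult_right_mono) auto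
  also have "\<dots> = fact k" by (simp add: exp_minus)
  finally have "?y ^ k * exp (- ?y) \<le> fact k" .
  then show ?thesis using False by (simp add: flat_def power_int_minus power_one_over inverse_eq_divide)
qed (simp add: flat_def)

text \<open>The power \<open>|x|\<^bsup>-(N-2)/2\<^esup>\<close> is a solution of \<open>L \<psi> = 0\<close> away from the origin, and in the
  product with \<open>\<eta> (ln |x|)\<close> the terms with \<open>\<eta>'\<close> cancel: the Laplacian of \<open>\<eta> (ln |x|)\<close> contributes
  \<open>(N - 2) \<eta>'\<close>, the mixed term \<open>- (N - 2) \<eta>'\<close>. The function is written in terms of \<open>|x|\<^sup>2\<close>, which is smooth everywhere; since \<open>\<eta>\<close> vanishes for
  \<open>t \<le> t0\<close>, the product is \<open>0\<close> near the origin, and also at the origin itself, where the power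
  has the value \<open>0\<close>.\<close>

lemma test_log_radial:
  fixes \<eta> :: "real \<Rightarrow> real"
  assumes dim: "DIM('a::euclidean_space) \<ge> 3"
    and \<eta>: "\<And>k. C_on k UNIV \<eta>" "\<And>t. t \<le> t0 \<Longrightarrow> \<eta> t = 0" "\<And>t. b \<le> t \<Longrightarrow> \<eta> t = 0"
    and sub: "cball 0 (exp b) \<subseteq> \<Omega>"
    and d: "\<And>t. (\<eta> has_real_derivative \<eta>1 t) (at t)" "\<And>t. (\<eta>1 has_real_derivative \<eta>2 t) (at t)"
  defines "\<psi> \<equiv> \<lambda>x::'a. ((norm x)\<^sup>2) powr (- ((real DIM('a) - 2) / 4)) * \<eta> (ln ((norm x)\<^sup>2) / 2)"
  shows "\<psi> \<in> test_functions \<Omega>"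
    and "hardy_op \<psi> x = - (norm x powr (- real DIM('a) / 2 - 1) * \<eta>2 (ln (norm x)))"
proof -
  define a where "a = (real DIM('a) - 2) / 4"
  have N: "real DIM('a) = 4 * a + 2" by (simp add: a_def field_simps)
  have ln_norm: "ln ((norm y)\<^sup>2) / 2 = ln (norm y)" if "y \<noteq> 0" for y :: 'a
    using that by (simp add: ln_realpow)
  have zero: "\<psi> y = 0" if "y \<in> ball 0 (exp t0)" for y
  proof (cases "y = 0")
    case False
    then have "ln (norm y) < t0" using that
      by (metis dist_0_norm exp_less_cancel_iff exp_ln mem_ball zero_less_norm_iff)
    then show ?thesis unfolding \<psi>_def ln_norm[OF False] by (simp add: \<eta>(2))
  qed (simp add: \<psi>_def)
  have smooth0: "C_on k (- {0}) \<psi>" for k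
  proof -
    have 1: "C_on k (- {0}) (\<lambda>x::'a. (\<lambda>t. t powr (- a)) ((norm (x - 0))\<^sup>2))"
      by (rule C_on_compose[OF _ _ C_on_powr C_on_norm2]) auto
    have 2: "C_on k (- {0}) (\<lambda>x::'a. ln ((norm (x - 0))\<^sup>2))"
      by (rule C_on_compose[OF _ _ C_on_ln C_on_norm2]) auto
    have "C_on k (- {0}) (\<lambda>x::'a. \<eta> ((1/2) * ln ((norm (x - 0))\<^sup>2)))"
      by (rule C_on_compose[OF _ _ \<eta>(1) C_on_cmult[OF _ 2]]) auto
    from C_on_mult[OF open_Compl[OF closed_singleton] 1 this] show ?thesis by (simp add: \<psi>_def a_def)
  qed
  have smooth1: "C_on k (ball 0 (exp t0)) \<psi>" for k
    by (rule C_on_cong[OF _ _ C_on_const[of _ _ 0]]) (auto simp: zero)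
  have smooth: "C_on k UNIV \<psi>" for k
  proof -
    have "C_on k (- {0} \<union> ball 0 (exp t0)) \<psi>" by (intro C_on_Un smooth0 smooth1) auto
    moreover have "- {0} \<union> ball 0 (exp t0) = (UNIV :: 'a set)" by auto
    ultimately show ?thesis by simp
  qed
  show "\<psi> \<in> test_functions \<Omega>"
  proof (rule test_functionsI[OF smooth compact_cball sub])
    fix y :: 'a assume "y \<notin> cball 0 (exp b)"
    then have y: "exp b < norm y" by simp
    then have "y \<noteq> 0" by (metis exp_gt_zero less_asym norm_zero)
    moreover have "b \<le> ln (norm y)" using y
      by (metis calculation exp_le_cancel_iff exp_ln less_imp_le zero_less_norm_iff)
    ultimately show "\<psi> y = 0" unfolding \<psi>_def by (simp add: ln_norm \<eta>(3))
  qed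
  show "hardy_op \<psi> x = - (norm x powr (- real DIM('a) / 2 - 1) * \<eta>2 (ln (norm x)))"
  proof (cases "x = 0")
    case True
    have "laplacian \<psi> x = 0"
      by (rule laplacian_eq_0_open[of "ball 0 (exp t0)"]) (use True zero in auto)
    then show ?thesis using True by (simp add: hardy_op_def)
  next
    case False
    define \<rho> where "\<rho> = (norm x)\<^sup>2"
    have \<rho>: "0 < \<rho>" using False by (simp add: \<rho>_def)
    define G1 where "G1 s = s powr (- a - 1) * (\<eta>1 (ln s / 2) / 2 - a * \<eta> (ln s / 2))" for s
    define G2 where "G2 s = s powr (- a - 2) * (\<eta>2 (ln s / 2) / 4 - (a + 1/2) * \<eta>1 (ln s / 2) + a * (a + 1) * \<eta> (ln s / 2))" for s
    have pw: "s powr (y - 1) * s = s powr y" "s powr y / s = s powr (y - 1)" if "0 < s" for s y :: real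
      using that by (simp_all add: powr_diff)
    have dl: "((\<lambda>s. ln s / 2) has_real_derivative inverse s / 2) (at s)" if "0 < s" for s :: real
      using that by (auto intro!: derivative_eq_intros simp: field_simps)
    have dp: "((\<lambda>s. s powr y) has_real_derivative y * s powr (y - 1)) (at s)" if "0 < s" for s y :: real
      using that by (auto intro!: derivative_eq_intros)
    have D1: "((\<lambda>s. s powr (- a) * \<eta> (ln s / 2)) has_real_derivative G1 s) (at s)" if "0 < s" for s
    proof -
      have "((\<lambda>s. s powr (- a) * \<eta> (ln s / 2)) has_real_derivative
         (- a * s powr (- a - 1)) * \<eta> (ln s / 2) + (\<eta>1 (ln s / 2) * (inverse s / 2)) * s powr (- a)) (at s)"
        by (rule DERIV_mult[OF dp[OF that] DERIV_chain2[OF d(1) dl[OF that]]])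
      moreover have "inverse s * s powr (- a) = s powr (- a - 1)" using pw(2)[OF that, of "- a"] by (simp add: divide_inverse mult.commute)
      then have "(- a * s powr (- a - 1)) * \<eta> (ln s / 2) + (\<eta>1 (ln s / 2) * (inverse s / 2)) * s powr (- a) = G1 s"
        unfolding G1_def by (simp add: algebra_simps)
      ultimately show ?thesis by simp
    qed
    have D2: "(G1 has_real_derivative G2 s) (at s)" if "0 < s" for s
    proof -
      have "(G1 has_real_derivative
         ((- a - 1) * s powr (- a - 1 - 1)) * (\<eta>1 (ln s / 2) / 2 - a * \<eta> (ln s / 2))
         + ((\<eta>2 (ln s / 2) * (inverse s / 2)) / 2 - a * (\<eta>1 (ln s / 2) * (inverse s / 2))) * s powr (- a - 1)) (at s)"
        unfolding G1_def[abs_def]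
        by (intro DERIV_mult dp[OF that] DERIV_diff DERIV_cdivide DERIV_cmult
           DERIV_chain2[OF d(1) dl[OF that]] DERIV_chain2[OF d(2) dl[OF that]])
      moreover have q: "inverse s * s powr (- a - 1) = s powr (- a - 2)"
      proof -
        have "- a - 2 = - a - 1 - 1" by simp
        then show ?thesis using pw(2)[OF that, of "- a - 1"] by (simp only: divide_inverse mult.commute)
      qed
      moreover have "((\<eta>2 (ln s / 2) * (inverse s / 2)) / 2 - a * (\<eta>1 (ln s / 2) * (inverse s / 2))) * s powr (- a - 1)
        = (\<eta>2 (ln s / 2) / 4 - a * \<eta>1 (ln s / 2) / 2) * s powr (- a - 2)"
        unfolding q[symmetric] by (simp add: algebra_simps)
      moreover have "((- a - 1) * s powr (- a - 1 - 1)) * (\<eta>1 (ln s / 2) / 2 - a * \<eta> (ln s / 2))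
         + (\<eta>2 (ln s / 2) / 4 - a * \<eta>1 (ln s / 2) / 2) * s powr (- a - 2) = G2 s"
        unfolding G2_def by (simp add: algebra_simps)
      ultimately show ?thesis by simp
    qed
    have "laplacian (\<lambda>x. (\<lambda>s. s powr (- a) * \<eta> (ln s / 2)) ((norm (x - 0))\<^sup>2)) x
       = 2 * real DIM('a) * G1 ((norm (x - 0))\<^sup>2) + 4 * (norm (x - 0))\<^sup>2 * G2 ((norm (x - 0))\<^sup>2)"
      by (rule laplacian_radial[of "{0<..}"]) (use False D1 D2 in auto)
    then have L: "laplacian \<psi> x = 2 * real DIM('a) * G1 \<rho> + 4 * \<rho> * G2 \<rho>"
      by (simp add: \<psi>_def a_def \<rho>_def)
    have g2: "\<rho> * G2 \<rho> = \<rho> powr (- a - 1) * (\<eta>2 (ln \<rho> / 2) / 4 - (a + 1/2) * \<eta>1 (ln \<rho> / 2) + a * (a + 1) * \<eta> (ln \<rho> / 2))"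
    proof -
      have "- a - 2 = - a - 1 - 1" by simp
      then have "\<rho> * \<rho> powr (- a - 2) = \<rho> powr (- a - 1)"
        using pw(1)[OF \<rho>, of "- a - 1"] by (simp only: mult.commute)
      then show ?thesis by (simp only: G2_def mult.assoc[symmetric])
    qed
    have q: "\<psi> x / (norm x)\<^sup>2 = \<rho> powr (- a - 1) * \<eta> (ln \<rho> / 2)"
    proof -
      have "\<psi> x = \<rho> powr (- a) * \<eta> (ln \<rho> / 2)" by (simp add: \<psi>_def a_def \<rho>_def)
      then show ?thesis unfolding pw(2)[OF \<rho>, of "- a", symmetric] \<rho>_def[symmetric] by simp
    qed
    have c: "((real DIM('a) - 2) / 2)\<^sup>2 = 4 * a\<^sup>2" by (simp add: a_def power2_eq_square)
    have "- (2 * (4 * a + 2) * (P * (e1 / 2 - a * e0)) + 4 * \<rho> * g) - 4 * a\<^sup>2 * (P * e0) = - (P * e2)"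
      if "\<rho> * g = P * (e2 / 4 - (a + 1/2) * e1 + a * (a + 1) * e0)" for P e0 e1 e2 g
      unfolding mult.assoc[of 4 \<rho> g] that by (simp add: field_simps power2_eq_square)
    from this[OF g2] have "hardy_op \<psi> x = - (\<rho> powr (- a - 1) * \<eta>2 (ln \<rho> / 2))"
      by (simp only: hardy_op_def L q c) (simp only: N G1_def)
    also have "\<rho> powr (- a - 1) = norm x powr (- real DIM('a) / 2 - 1)"
    proof -
      have "\<rho> = norm x powr 2" using False by (simp add: \<rho>_def)
      moreover have "2 * (- a - 1) = - real DIM('a) / 2 - 1" by (simp add: a_def field_simps)
      ultimately show ?thesis by (simp only: powr_powr)
    qed
    also have "ln \<rho> / 2 = ln (norm x)" unfolding \<rho>_def by (rule ln_norm[OF False])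
    finally show ?thesis .
  qed
qed

section \<open>Vanishing near the origin\<close>

lemma flat_bounds:
  shows "0 \<le> flat j s" "s \<le> 0 \<Longrightarrow> flat j s = 0" "0 < s \<Longrightarrow> 0 < flat j s"
    "flat 0 s \<le> 1" "flat (-1) s \<le> 1" "flat (-2) s \<le> 2" "flat (-3) s \<le> 6" "flat (-4) s \<le> 24"
    "0 < s \<Longrightarrow> flat 1 s \<le> s"
proof -
  show "flat 0 s \<le> 1" "flat (-1) s \<le> 1" "flat (-2) s \<le> 2" "flat (-3) s \<le> 6" "flat (-4) s \<le> 24"
    using flat_le_fact[of 0 s] flat_le_fact[of 1 s] flat_le_fact[of 2 s] flat_le_fact[of 3 s] flat_le_fact[of 4 s]
    by (simp_all add: fact_numeral)
qed (auto simp: flat_def)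

lemma DERIV_flat_comp:
  assumes "(g has_real_derivative g') (at t)"
  shows "((\<lambda>t. flat j (g t)) has_real_derivative (of_int j * flat (j - 1) (g t) + flat (j - 2) (g t)) * g') (at t)"
  by (rule DERIV_chain2[OF flat_has_derivative assms])

text \<open>With \<open>s = b - t\<close>, the first factor \<open>s exp (-1/s)\<close> is convex and decreasing in \<open>t\<close>, vanishes for
  \<open>t \<ge> b\<close> and grows linearly as \<open>t \<rightarrow> -\<infinity>\<close>; its second derivative is \<open>flat (-3) s\<close>. The second factor
  cuts it off at \<open>t = -2/c\<close>.\<close>

definition profile :: "real \<Rightarrow> real \<Rightarrow> real \<Rightarrow> real" where
  "profile b c t = flat 1 (b - t) * flat 0 (2 + t * c)"

definition profile' :: "real \<Rightarrow> real \<Rightarrow> real \<Rightarrow> real" where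
  "profile' b c t = flat 1 (b - t) * (flat (-2) (2 + t * c) * c)
     - (flat 0 (b - t) + flat (-1) (b - t)) * flat 0 (2 + t * c)"

definition profile'' :: "real \<Rightarrow> real \<Rightarrow> real \<Rightarrow> real" where
  "profile'' b c t = flat (-3) (b - t) * flat 0 (2 + t * c)
     - 2 * (flat 0 (b - t) + flat (-1) (b - t)) * (flat (-2) (2 + t * c) * c)
     + flat 1 (b - t) * ((flat (-4) (2 + t * c) - 2 * flat (-3) (2 + t * c)) * c\<^sup>2)"

text \<open>The last estimate says that cutting off the profile costs only \<open>O(c)\<close> of its convexity: either \<open>c\<close>
  comes with the bounded first derivative of the profile, or \<open>c\<^sup>2\<close> with the profile itself, which is
  \<open>O(1/c)\<close> where the cutoff is not zero.\<close>

lemma profile_properties: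
  fixes b c :: real
  assumes c: "0 < c"
  shows "C_on k UNIV (profile b c)"
    and "0 \<le> profile b c t" and "t \<le> - 2 / c \<Longrightarrow> profile b c t = 0" and "b \<le> t \<Longrightarrow> profile b c t = 0"
    and "(profile b c has_real_derivative profile' b c t) (at t)"
    and "(profile' b c has_real_derivative profile'' b c t) (at t)"
    and "flat (-3) (b - t) * flat 0 (2 + t * c)
      \<le> profile'' b c t + (if - 2 / c \<le> t \<and> t < b then c * (8 + 24 * (\<bar>b\<bar> * c + 2)) else 0)"
proof -
  have C1: "C_on k UNIV (\<lambda>t. flat j (b - t))" for j
    by (rule C_on_compose[OF _ _ C_on_flat C_on_diff[OF _ C_on_const C_on_ident]]) auto
  have "C_on k UNIV (\<lambda>t. 2 + c * t)"
    by (intro C_on_add C_on_const C_on_cmult C_on_ident) auto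
  then have l: "C_on k UNIV (\<lambda>t. 2 + t * c)" by (simp add: mult.commute)
  have C2: "C_on k UNIV (\<lambda>t. flat j (2 + t * c))" for j
    by (rule C_on_compose[OF open_UNIV open_UNIV C_on_flat l]) auto
  show "C_on k UNIV (profile b c)" unfolding profile_def[abs_def] by (intro C_on_mult C1 C2) auto
  show "0 \<le> profile b c t" by (simp add: profile_def flat_bounds(1))
  show "t \<le> - 2 / c \<Longrightarrow> profile b c t = 0"
    using c by (simp add: profile_def flat_bounds(2) field_simps)
  show "b \<le> t \<Longrightarrow> profile b c t = 0" by (simp add: profile_def flat_bounds(2))
  have l1: "((\<lambda>t. b - t) has_real_derivative - 1) (at t)" for t by (auto intro!: derivative_eq_intros)
  have l2: "((\<lambda>t. 2 + t * c) has_real_derivative c) (at t)" for t by (auto intro!: derivative_eq_intros)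
  note E = DERIV_flat_comp[OF l1] and T = DERIV_flat_comp[OF l2]
  show "(profile b c has_real_derivative profile' b c t) (at t)"
    unfolding profile_def[abs_def] by (rule DERIV_cong[OF DERIV_mult[OF E T]]) (simp add: profile'_def algebra_simps)
  show "(profile' b c has_real_derivative profile'' b c t) (at t)"
    unfolding profile'_def[abs_def]
    by (rule DERIV_cong[OF DERIV_diff[OF DERIV_mult[OF E DERIV_cmult_right[OF T]] DERIV_mult[OF DERIV_add[OF E E] T]]])
       (simp add: profile''_def algebra_simps power2_eq_square)
  show "flat (-3) (b - t) * flat 0 (2 + t * c)
      \<le> profile'' b c t + (if - 2 / c \<le> t \<and> t < b then c * (8 + 24 * (\<bar>b\<bar> * c + 2)) else 0)"
  proof (cases "- 2 / c \<le> t \<and> t < b")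
    case True
    then have tb: "t < b" "- 2 \<le> t * c" using c by (auto simp: field_simps)
    note fb = flat_bounds
    have "2 * (flat 0 (b - t) + flat (-1) (b - t)) * (flat (-2) (2 + t * c) * c) \<le> (2 * (1 + 1)) * (2 * c)"
      using c by (intro mult_mono add_mono mult_nonneg_nonneg add_nonneg_nonneg fb(1,4,5,6) mult_left_mono mult_right_mono) auto
    moreover have "flat 1 (b - t) * ((2 * flat (-3) (2 + t * c) - flat (-4) (2 + t * c)) * c\<^sup>2) \<le> (\<bar>b\<bar> * c + 2) * (12 * c)"
    proof -
      have "flat 1 (b - t) * ((2 * flat (-3) (2 + t * c) - flat (-4) (2 + t * c)) * c\<^sup>2) \<le> flat 1 (b - t) * (12 * c\<^sup>2)"
        using fb(1)[of "-4" "2 + t * c"] fb(7)[of "2 + t * c"]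
        by (intro mult_left_mono mult_right_mono fb(1)) auto
      also have "\<dots> = (flat 1 (b - t) * c) * (12 * c)" by (simp add: power2_eq_square)
      also have "\<dots> \<le> ((b - t) * c) * (12 * c)" using c tb by (intro mult_right_mono fb(9)) auto
      also have "\<dots> \<le> (\<bar>b\<bar> * c + 2) * (12 * c)"
      proof (intro mult_right_mono)
        have "b * c \<le> \<bar>b\<bar> * c" using c by (intro mult_right_mono) auto
        then show "(b - t) * c \<le> \<bar>b\<bar> * c + 2" using tb by (simp add: left_diff_distrib)
      qed (use c in auto)
      finally show ?thesis .
    qed
    moreover have "(\<bar>b\<bar> * c + 2) * (12 * c) \<le> c * (24 * (\<bar>b\<bar> * c + 2))"
      using c by simp
    ultimately show ?thesis using True by (simp add: profile''_def algebra_simps)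
  next
    case False
    then consider "t < - 2 / c" | "b \<le> t" by linarith
    then show ?thesis
    proof cases
      case 1
      then have "2 + t * c \<le> 0" using c by (simp add: field_simps)
      then have "profile'' b c t = 0" "flat (-3) (b - t) * flat 0 (2 + t * c) = 0"
        by (simp_all add: profile''_def flat_bounds(2))
      then show ?thesis using False by (simp only: if_False)
    next
      case 2
      then have "profile'' b c t = 0" "flat (-3) (b - t) * flat 0 (2 + t * c) = 0"
        by (simp_all add: profile''_def flat_bounds(2))
      then show ?thesis using False by (simp only: if_False)
    qed
  qed
qed

text \<open>Test with the profile cut off at \<open>t = -2m\<^sup>2\<close>, that is \<open>c = 1/m\<^sup>2\<close>. The convex part contributes
  \<open>g k\<close>, which is positive wherever \<open>V\<close> is, on any fixed annulus. By the Cauchy-Schwarz inequality for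
  \<open>V/|x|\<close> and \<open>|x|\<^bsup>-N/2\<^esup>\<close>, the error is at most \<open>c\<close> times a multiple of
  \<open>m\<close>, as the integral of \<open>|x|\<^bsup>-N\<^esup>\<close> over the annulus grows like \<open>m\<^sup>2\<close>. So the error tends to \<open>0\<close>,
  and the integral of \<open>g k\<close> vanishes.\<close>

proposition supersolution_vanishes_near_0:
  fixes V :: "'a::euclidean_space \<Rightarrow> real"
  assumes dim: "DIM('a) \<ge> 3" and op: "open \<Omega>" and sub: "cball 0 (exp b) \<subseteq> \<Omega>"
    and V: "V \<in> borel_measurable (lebesgue_on \<Omega>)" "\<And>x. 0 \<le> V x"
    and V2: "integrable (lebesgue_on \<Omega>) (\<lambda>x. (V x)\<^sup>2 / (norm x)\<^sup>2)"
    and super: "\<And>\<psi>. \<psi> \<in> test_functions \<Omega> \<Longrightarrow> (\<And>x. 0 \<le> \<psi> x) \<Longrightarrow>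
       integrable (lebesgue_on \<Omega>) (\<lambda>x. V x * hardy_op \<psi> x) \<and> 0 \<le> (LINT x|lebesgue_on \<Omega>. V x * hardy_op \<psi> x)"
  shows "AE x in lebesgue_on \<Omega>. x \<in> ball 0 (exp b) \<longrightarrow> V x = 0"
proof -
  let ?M = "lebesgue_on \<Omega>"
  define w where "w x = norm x powr (- real DIM('a) / 2 - 1)" for x :: 'a
  define E2 where "E2 x = flat (-3) (b - ln (norm x))" for x :: 'a
  define J where "J = (LINT x|?M. (V x)\<^sup>2 / (norm x)\<^sup>2)"
  define g where "g k x = V x * w x * E2 x * indicator (annulus (exp b) k) x" for k :: nat and x :: 'a
  define \<kappa> where "\<kappa> = 8 + 24 * (\<bar>b\<bar> + 2)"
  have \<kappa>: "0 < \<kappa>" by (simp add: \<kappa>_def)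
  define W where "W = unit_ball_vol (real DIM('a)) * exp (real DIM('a))"
  have W: "0 \<le> W" by (simp add: W_def)
  define B where "B = nat \<lceil>\<bar>b\<bar>\<rceil>"
  have B: "\<bar>b\<bar> \<le> real B" unfolding B_def by linarith
  have w_nonneg: "0 \<le> w x" for x by (simp add: w_def)
  have Mb: "h \<in> borel_measurable ?M" if "h \<in> borel_measurable borel" for h :: "'a \<Rightarrow> real"
    using that by (rule borel_measurable_lebesgue_onI)
  have flat_meas [measurable]: "flat j \<in> borel_measurable borel" for j
    using C_on_flat[of 0 j] by (auto intro: borel_measurable_continuous_onI)
  have gm: "g k \<in> borel_measurable ?M" for k
  proof -
    have "(\<lambda>x::'a. w x * E2 x * indicator (annulus (exp b) k) x) \<in> borel_measurable borel"
      unfolding w_def E2_def by measurable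
    from borel_measurable_times[OF V(1) Mb[OF this]] show ?thesis
      by (simp add: g_def[abs_def] mult.assoc)
  qed
  have g_nonneg: "0 \<le> g k x" for k x
    using V(2)[of x] w_nonneg[of x] flat_bounds(1) by (simp add: g_def E2_def)
  have annulus_int: "integrable ?M (\<lambda>x. indicator (annulus (exp b) k) x * norm x powr (- real DIM('a)))"
    "(LINT x|?M. indicator (annulus (exp b) k) x * norm x powr (- real DIM('a))) \<le> W * real k" for k
  proof -
    let ?h = "\<lambda>x::'a. indicator (annulus (exp b) k) x * norm x powr (- real DIM('a))"
    have nn: "(\<integral>\<^sup>+x. ennreal (?h x) \<partial>lborel) \<le> ennreal (W * real k)"
      using nn_integral_powr_annulus[where 'a='a, of "real DIM('a)" "exp b" k] by (simp add: W_def)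
    have hm: "?h \<in> borel_measurable borel" by measurable
    have i: "integrable lborel ?h"
      using hm nn by (intro integrableI_nonneg) (auto intro: le_less_trans)
    have out: "?h x = 0" if "x \<notin> \<Omega>" for x
      using that subsetD[OF sub, of x] by (auto simp: annulus_def indicator_def)
    show "integrable ?M ?h"
      using i integral_lebesgue_on_eq_lborel(2)[OF open_sets_lebesgue[OF op] hm out] by blast
    have "ennreal (LINT x|lborel. ?h x) \<le> ennreal (W * real k)"
      using nn_integral_eq_integral[OF i] nn by simp
    then have "(LINT x|lborel. ?h x) \<le> W * real k" using W by (simp add: ennreal_le_iff)
    then show "(LINT x|?M. ?h x) \<le> W * real k"
      using integral_lebesgue_on_eq_lborel(1)[OF open_sets_lebesgue[OF op] hm out] by simp
  qed
  have main: "integrable ?M (g k) \<and> flat 0 1 * (LINT x|?M. g k x) \<le> \<kappa> * (J + W * (real B + 2)) / real m"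
    if m: "1 \<le> m" "real k + \<bar>b\<bar> \<le> real m" for k m :: nat
  proof -
    define c where "c = 1 / (real m)\<^sup>2"
    have m0: "1 \<le> real m" using m by simp
    have c: "0 < c" "c \<le> 1" using m0 by (auto simp: c_def)
    define \<psi> where "\<psi> = (\<lambda>x::'a. ((norm x)\<^sup>2) powr (- ((real DIM('a) - 2) / 4)) * profile b c (ln ((norm x)\<^sup>2) / 2))"
    note pp = profile_properties[OF c(1)]
    have \<psi>: "\<psi> \<in> test_functions \<Omega>"
      unfolding \<psi>_def by (rule test_log_radial(1)[OF dim pp(1,3,4) sub pp(5,6)])
    have op_eq: "hardy_op \<psi> x = - (w x * profile'' b c (ln (norm x)))" for x
      unfolding \<psi>_def w_def by (rule test_log_radial(2)[OF dim pp(1,3,4) sub pp(5,6)])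
    have \<psi>0: "0 \<le> \<psi> x" for x
      unfolding \<psi>_def by (intro mult_nonneg_nonneg profile_properties(2) c) auto
    \<comment> \<open>the annulus of index \<open>K\<close> contains all points where the test function does not vanish\<close>
    define K where "K = B + 2 * m\<^sup>2"
    define A where "A x = V x * w x * indicator (annulus (exp b) K) x" for x
    have Am: "A \<in> borel_measurable ?M"
    proof -
      have "(\<lambda>x::'a. w x * indicator (annulus (exp b) K) x) \<in> borel_measurable borel"
        unfolding w_def by measurable
      from borel_measurable_times[OF V(1) Mb[OF this]] show ?thesis
        by (simp add: A_def[abs_def] mult.assoc)
    qed
    have A_nonneg: "0 \<le> A x" for x using V(2)[of x] w_nonneg[of x] by (simp add: A_def)
    let ?H = "\<lambda>x. (1 / real m) * ((V x)\<^sup>2 / (norm x)\<^sup>2) + (1 / real m ^ 3) * (indicator (annulus (exp b) K) x * norm x powr (- real DIM('a)))"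
    have Hi: "integrable ?M ?H"
      by (intro Bochner_Integration.integrable_add integrable_mult_right V2 annulus_int)
    have A_le: "c * A x \<le> ?H x" for x
    proof (cases "x \<in> annulus (exp b) K")
      case True
      then have x: "x \<noteq> 0" by (auto simp: annulus_def mult_le_0_iff)
      define p where "p = V x / norm x"
      define r where "r = norm x powr (- real DIM('a) / 2)"
      have wr: "w x = r / norm x" using x by (simp add: w_def r_def powr_diff)
      have r2: "r\<^sup>2 = norm x powr (- real DIM('a))" by (simp add: r_def power2_eq_square powr_add[symmetric])
      \<comment> \<open>the weight \<open>1/m\<close> balances the two resulting integrals, \<open>J\<close> and \<open>O(m\<^sup>2)\<close>\<close>
      have "0 \<le> (p - r / real m)\<^sup>2" by simp
      then have "2 * (p * (r / real m)) \<le> p\<^sup>2 + (r / real m)\<^sup>2" by (simp add: power2_diff)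
      moreover have "0 \<le> p * (r / real m)" using V(2)[of x] by (simp add: p_def r_def)
      ultimately have "p * (r / real m) \<le> p\<^sup>2 + (r / real m)\<^sup>2" by linarith
      then have "(1 / real m) * (p * (r / real m)) \<le> (1 / real m) * (p\<^sup>2 + (r / real m)\<^sup>2)"
        by (rule mult_left_mono) simp
      also have "(1 / real m) * (p * (r / real m)) = c * A x"
        using True by (simp add: c_def A_def wr p_def power2_eq_square)
      also have "(1 / real m) * (p\<^sup>2 + (r / real m)\<^sup>2) = ?H x"
        using True r2 by (simp add: p_def power_divide distrib_left power2_eq_square power3_eq_cube)
      finally show ?thesis .
    qed (simp add: A_def)
    have Ai: "integrable ?M (\<lambda>x. c * A x)"
    proof (rule Bochner_Integration.integrable_bound[OF Hi])
      show "AE x in ?M. norm (c * A x) \<le> norm (?H x)"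
      proof (rule AE_I2)
        fix x
        have "0 \<le> c * A x" using A_nonneg c by simp
        then show "norm (c * A x) \<le> norm (?H x)" using A_le[of x] by simp
      qed
    qed (use Am in measurable)
    have AI: "(LINT x|?M. c * A x) \<le> (J + W * (real B + 2)) / real m"
    proof -
      have "(LINT x|?M. c * A x) \<le> (LINT x|?M. ?H x)" by (intro integral_mono Ai Hi A_le)
      also have "\<dots> = (1 / real m) * J + (1 / real m ^ 3) * (LINT x|?M. indicator (annulus (exp b) K) x * norm x powr (- real DIM('a)))"
        unfolding J_def using V2 annulus_int(1)
        by (subst Bochner_Integration.integral_add) (intro integrable_mult_right V2 annulus_int arg_cong2[where f="(+)"] integral_mult_right_zero)+
      also have "\<dots> \<le> (1 / real m) * J + (1 / real m ^ 3) * (W * real K)"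
        by (intro add_left_mono mult_left_mono annulus_int) auto
      also have "\<dots> \<le> (1 / real m) * J + (1 / real m ^ 3) * (W * ((real B + 2) * (real m)\<^sup>2))"
      proof (intro add_left_mono mult_left_mono W)
        have "real B * 1 \<le> real B * (real m)\<^sup>2" using m0 by (intro mult_left_mono) auto
        then show "real K \<le> (real B + 2) * (real m)\<^sup>2" by (simp add: K_def distrib_right)
      qed auto
      also have "\<dots> = (J + W * (real B + 2)) / real m"
        using m0 by (simp add: field_simps power2_eq_square power3_eq_cube)
      finally show ?thesis .
    qed
    have Oi: "integrable ?M (\<lambda>x. V x * hardy_op \<psi> x)" and O: "0 \<le> (LINT x|?M. V x * hardy_op \<psi> x)"
      using super[OF \<psi> \<psi>0] by blast+
    have pw: "flat 0 1 * g k x \<le> \<kappa> * (c * A x) - V x * hardy_op \<psi> x" for x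
    proof (cases "x = 0")
      case True
      then show ?thesis by (simp add: g_def A_def w_def op_eq annulus_def)
    next
      case False
      let ?t = "ln (norm x)"
      have t_lt: "?t < b \<longleftrightarrow> norm x < exp b" and t_ge: "\<And>s. s \<le> ?t \<longleftrightarrow> exp s \<le> norm x"
        unfolding not_le[symmetric] using False by (auto simp: ln_ge_iff)
      have Vw: "0 \<le> V x * w x" using V(2) w_nonneg by simp
      have "flat 0 1 * (E2 x * indicator (annulus (exp b) k) x) \<le> E2 x * flat 0 (2 + ?t * c)"
      proof (cases "x \<in> annulus (exp b) k")
        case True
        then have "exp (b - real k) \<le> norm x" by (simp add: annulus_def exp_diff exp_minus divide_inverse)
        then have "b - real k \<le> ?t" using t_ge by simp
        then have "- real m \<le> ?t" using m(2) by linarith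
        then have "- real m * c \<le> ?t * c" using c by (intro mult_right_mono) auto
        moreover have "real m * c \<le> 1" using m0 by (simp add: c_def power2_eq_square)
        ultimately have s: "1 \<le> 2 + ?t * c" by simp
        \<comment> \<open>on the smaller annulus the cutoff factor is bounded below\<close>
        have "flat 0 1 \<le> flat 0 (2 + ?t * c)"
          using s by (simp add: flat_def field_simps)
        then have "flat 0 1 * E2 x \<le> flat 0 (2 + ?t * c) * E2 x"
          by (rule mult_right_mono) (simp add: E2_def flat_bounds(1))
        then show ?thesis using True by (simp add: mult.commute)
      qed (simp add: E2_def flat_bounds(1))
      also have "E2 x * flat 0 (2 + ?t * c) \<le> profile'' b c ?t + (if - 2 / c \<le> ?t \<and> ?t < b then c * (8 + 24 * (\<bar>b\<bar> * c + 2)) else 0)"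
        unfolding E2_def by (rule profile_properties(7)[OF c(1)])
      also have "\<dots> \<le> profile'' b c ?t + \<kappa> * c * indicator (annulus (exp b) K) x"
      proof (intro add_left_mono)
        show "(if - 2 / c \<le> ?t \<and> ?t < b then c * (8 + 24 * (\<bar>b\<bar> * c + 2)) else 0) \<le> \<kappa> * c * indicator (annulus (exp b) K) x"
        proof (cases "- 2 / c \<le> ?t \<and> ?t < b")
          case True
          have "b - real K \<le> - 2 / c" using B by (simp add: K_def c_def)
          then have "exp (b - real K) \<le> norm x" using True t_ge by (metis order_trans)
          then have "x \<in> annulus (exp b) K" using True t_lt by (simp add: annulus_def exp_diff exp_minus divide_inverse)
          moreover have "\<bar>b\<bar> * c \<le> \<bar>b\<bar> * 1" using c by (intro mult_left_mono) auto
          then have "c * (8 + 24 * (\<bar>b\<bar> * c + 2)) \<le> c * \<kappa>" unfolding \<kappa>_def using c by (intro mult_left_mono) auto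
          ultimately show ?thesis using True by (simp add: mult.commute)
        next
          case False
          have "0 \<le> \<kappa> * c * indicator (annulus (exp b) K) x"
            using \<kappa> c by (intro mult_nonneg_nonneg) auto
          then show ?thesis by (simp only: False if_False)
        qed
      qed
      finally have "V x * w x * (flat 0 1 * (E2 x * indicator (annulus (exp b) k) x))
          \<le> V x * w x * (profile'' b c ?t + \<kappa> * c * indicator (annulus (exp b) K) x)"
        using Vw by (rule mult_left_mono)
      moreover have "V x * w x * (y + \<kappa> * c * i) = \<kappa> * (c * (V x * w x * i)) - V x * - (w x * y)" for y i
        by (simp add: algebra_simps)
      moreover have "V x * w x * (flat 0 1 * (E2 x * i)) = flat 0 1 * (V x * w x * E2 x * i)" for i
        by (simp add: algebra_simps)
      ultimately show ?thesis unfolding g_def A_def op_eq by simp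
    qed
    let ?R = "\<lambda>x. \<kappa> * (c * A x) - V x * hardy_op \<psi> x"
    have Ri: "integrable ?M ?R" by (intro Bochner_Integration.integrable_diff integrable_mult_right Ai Oi)
    have f1: "0 < flat 0 1" by (simp add: flat_def)
    have gi': "integrable ?M (\<lambda>x. flat 0 1 * g k x)"
    proof (rule Bochner_Integration.integrable_bound[OF Ri])
      show "AE x in ?M. norm (flat 0 1 * g k x) \<le> norm (?R x)"
      proof (rule AE_I2)
        fix x
        have "0 \<le> flat 0 1 * g k x" using f1 g_nonneg by simp
        then show "norm (flat 0 1 * g k x) \<le> norm (?R x)" using pw[of x] by simp
      qed
    qed (use gm in measurable)
    then have "integrable ?M (\<lambda>x. (1 / flat 0 1) * (flat 0 1 * g k x))" by (rule integrable_mult_right)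
    then have gi: "integrable ?M (g k)" using f1 by simp
    have "flat 0 1 * (LINT x|?M. g k x) = (LINT x|?M. flat 0 1 * g k x)" by simp
    also have "\<dots> \<le> (LINT x|?M. ?R x)" by (intro integral_mono gi' Ri pw)
    also have "\<dots> = \<kappa> * (LINT x|?M. c * A x) - (LINT x|?M. V x * hardy_op \<psi> x)"
      by (subst Bochner_Integration.integral_diff) (intro integrable_mult_right Ai Oi arg_cong2[where f="(-)"] integral_mult_right_zero refl)+
    also have "\<dots> \<le> \<kappa> * ((J + W * (real B + 2)) / real m)"
      using mult_left_mono[OF AI, of \<kappa>] \<kappa> O by linarith
    finally show ?thesis using gi by simp
  qed
  have g0: "AE x in ?M. g k x = 0" for k
  proof -
    define m0 where "m0 = k + B + 1"
    have gi: "integrable ?M (g k)" using main[of m0 k] B by (simp add: m0_def)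
    have "(\<lambda>m. \<kappa> * (J + W * (real B + 2)) / real m) \<longlonglongrightarrow> 0"
      by (rule lim_const_over_n)
    then have "flat 0 1 * (LINT x|?M. g k x) \<le> 0"
    proof (rule LIMSEQ_le_const)
      show "\<exists>N. \<forall>m\<ge>N. flat 0 1 * (LINT x|?M. g k x) \<le> \<kappa> * (J + W * (real B + 2)) / real m"
        using main B by (intro exI[of _ m0]) (auto simp: m0_def)
    qed
    moreover have "0 < flat 0 1" by (simp add: flat_def)
    ultimately have "(LINT x|?M. g k x) \<le> 0" by (simp add: mult_le_0_iff)
    moreover have "0 \<le> (LINT x|?M. g k x)" using g_nonneg by simp
    ultimately have "(LINT x|?M. g k x) = 0" by linarith
    then show ?thesis using integral_nonneg_eq_0_iff_AE[OF gi] g_nonneg by simp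
  qed
  have nz: "AE x in ?M. x \<noteq> 0"
  proof -
    have "AE x in lebesgue. x \<noteq> (0::'a)" by (rule AE_completion[OF AE_lborel_singleton])
    then show ?thesis using open_sets_lebesgue[OF op] by (subst AE_restrict_space_iff) auto
  qed
  have "AE x in ?M. \<forall>k. g k x = 0" using g0 by (simp add: AE_all_countable)
  with nz show ?thesis
  proof eventually_elim
    case (elim x)
    show ?case
    proof
      assume x: "x \<in> ball 0 (exp b)"
      let ?k = "nat \<lceil>b - ln (norm x)\<rceil>"
      have t: "ln (norm x) < b" unfolding not_le[symmetric] using x elim(1) by (simp add: ln_ge_iff)
      have "b - real ?k \<le> ln (norm x)" by linarith
      then have "exp (b - real ?k) \<le> norm x" using elim(1) by (simp add: ln_ge_iff)
      then have "x \<in> annulus (exp b) ?k" using x by (simp add: annulus_def exp_diff exp_minus divide_inverse)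
      moreover have "g ?k x = 0" using elim(2) by blast
      moreover have "0 < w x" "0 < E2 x" using elim(1) t by (simp_all add: w_def E2_def flat_bounds(3))
      ultimately show "V x = 0" by (simp add: g_def)
    qed
  qed
qed

section \<open>Propagation of zeros and the conclusion\<close>

lemma barrier_laplacian:
  fixes x z :: "'a::euclidean_space" and R K :: real
  assumes K0: "0 < K"
  defines "s \<equiv> (R\<^sup>2 - (norm (x - z))\<^sup>2) / K"
  shows "laplacian (\<lambda>x. flat 0 ((R\<^sup>2 - (norm (x - z))\<^sup>2) / K)) x
    = 2 * real DIM('a) * (flat (-2) s * (- 1 / K))
      + 4 * (norm (x - z))\<^sup>2 * ((flat (-4) s - 2 * flat (-3) s) * (1 / K\<^sup>2))"
proof -
  let ?G1 = "\<lambda>\<rho>. flat (-2) ((R\<^sup>2 - \<rho>) / K) * (- 1 / K)"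
  let ?G2 = "\<lambda>\<rho>. (flat (-4) ((R\<^sup>2 - \<rho>) / K) - 2 * flat (-3) ((R\<^sup>2 - \<rho>) / K)) * (1 / K\<^sup>2)"
  have l: "((\<lambda>\<rho>. (R\<^sup>2 - \<rho>) / K) has_real_derivative - 1 / K) (at t)" for t
    using K0 by (auto intro!: derivative_eq_intros)
  have d1: "((\<lambda>\<rho>. flat 0 ((R\<^sup>2 - \<rho>) / K)) has_real_derivative ?G1 t) (at t)" for t
    by (rule DERIV_cong[OF DERIV_flat_comp[OF l]]) simp
  have d2: "(?G1 has_real_derivative ?G2 t) (at t)" for t
    by (rule DERIV_cong[OF DERIV_cmult_right[OF DERIV_flat_comp[OF l]]]) (simp add: power2_eq_square)
  show ?thesis
    unfolding s_def by (rule laplacian_radial[OF open_UNIV UNIV_I d1 d2])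
qed

text \<open>For large \<open>K\<close> the Hopf-type barrier \<open>exp (-K/(R\<^sup>2 - |x - z|\<^sup>2))\<close> is strictly subharmonic except near its
  centre: the second derivatives bring down \<open>1/s\<^sup>4\<close>, the first ones only \<open>1/s\<^sup>2\<close>.\<close>

lemma barrier_laplacian_pos:
  fixes x z :: "'a::euclidean_space" and r R K :: real
  assumes r: "0 < r" "r \<le> norm (x - z)" "norm (x - z) < R"
    and K: "2 * real DIM('a) * R ^ 4 / r\<^sup>2 < K" "4 * R\<^sup>2 \<le> K"
  shows "0 < laplacian (\<lambda>x. flat 0 ((R\<^sup>2 - (norm (x - z))\<^sup>2) / K)) x"
proof -
  define \<rho> where "\<rho> = (norm (x - z))\<^sup>2"
  have \<rho>: "r\<^sup>2 \<le> \<rho>" "\<rho> < R\<^sup>2" unfolding \<rho>_def using r by (auto intro: power_mono power_strict_mono)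
  have r2: "0 < r\<^sup>2" using r by simp
  have \<rho>0: "0 < \<rho>" using \<rho>(1) r2 by linarith
  have R2: "0 < R\<^sup>2" using \<rho> r2 by linarith
  then have K0: "0 < K" using K by linarith
  define s where "s = (R\<^sup>2 - \<rho>) / K"
  have s: "0 < s" "s \<le> R\<^sup>2 / K"
    using \<rho>(2) K0 by (auto simp: s_def \<rho>_def divide_right_mono)
  have "laplacian (\<lambda>x. flat 0 ((R\<^sup>2 - (norm (x - z))\<^sup>2) / K)) x
    = 2 * real DIM('a) * (flat (-2) s * (- 1 / K)) + 4 * \<rho> * ((flat (-4) s - 2 * flat (-3) s) * (1 / K\<^sup>2))"
    unfolding s_def \<rho>_def by (rule barrier_laplacian[OF K0])
  also have "\<dots> = exp (- 1 / s) / s ^ 4 / K\<^sup>2 * (4 * \<rho> * (1 - 2 * s) - 2 * real DIM('a) * K * s\<^sup>2)"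
    using s(1) K0
    by (simp add: flat_def power_int_minus field_simps power2_eq_square power3_eq_cube power4_eq_xxxx)
  also have "0 < \<dots>"
  proof (intro mult_pos_pos)
    have "2 * s \<le> 2 * (R\<^sup>2 / K)" using s by simp
    also have "\<dots> \<le> 1 / 2" using K K0 by (simp add: field_simps)
    finally have "4 * \<rho> * (1 / 2) \<le> 4 * \<rho> * (1 - 2 * s)"
      using \<rho>0 by (intro mult_left_mono) auto
    moreover have "2 * real DIM('a) * K * s\<^sup>2 \<le> 2 * real DIM('a) * K * (R\<^sup>2 / K)\<^sup>2"
      using s K0 by (intro mult_left_mono power_mono) auto
    moreover have "2 * real DIM('a) * K * (R\<^sup>2 / K)\<^sup>2 = 2 * real DIM('a) * R ^ 4 / K"
      using K0 by (simp add: power2_eq_square power4_eq_xxxx field_simps)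
    moreover have "2 * real DIM('a) * R ^ 4 / K < r\<^sup>2"
      using K(1) K0 r2 by (simp add: field_simps)
    ultimately show "0 < 4 * \<rho> * (1 - 2 * s) - 2 * real DIM('a) * K * s\<^sup>2"
      using \<rho> r2 by linarith
  qed (use s K0 in auto)
  finally show ?thesis .
qed

text \<open>Test with the barrier. Its operator value is negative on the annulus between \<open>r\<close> and \<open>R\<close> and \<open>0\<close> outside
  the larger ball, while \<open>V = 0\<close> on the smaller one; the integral can be nonnegative only if \<open>V\<close> vanishes
  on the annulus.\<close>

lemma supersolution_zero_spreads:
  fixes V :: "'a::euclidean_space \<Rightarrow> real"
  assumes dim: "DIM('a) \<ge> 3" and r: "0 < r" "r < R" and sub: "cball z R \<subseteq> \<Omega>"
    and V: "\<And>x. 0 \<le> V x"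
    and super: "\<And>\<psi>. \<psi> \<in> test_functions \<Omega> \<Longrightarrow> (\<And>x. 0 \<le> \<psi> x) \<Longrightarrow>
       integrable (lebesgue_on \<Omega>) (\<lambda>x. V x * hardy_op \<psi> x) \<and> 0 \<le> (LINT x|lebesgue_on \<Omega>. V x * hardy_op \<psi> x)"
    and zero: "AE x in lebesgue_on \<Omega>. x \<in> ball z r \<longrightarrow> V x = 0"
  shows "AE x in lebesgue_on \<Omega>. x \<in> ball z R \<longrightarrow> V x = 0"
proof -
  let ?M = "lebesgue_on \<Omega>"
  define K where "K = 2 * real DIM('a) * R ^ 4 / r\<^sup>2 + 4 * R\<^sup>2 + 1"
  have K: "2 * real DIM('a) * R ^ 4 / r\<^sup>2 < K" "4 * R\<^sup>2 \<le> K"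
    using r by (auto simp: K_def add_nonneg_nonneg add_nonneg_pos)
  have "0 < R\<^sup>2" using r by simp
  then have K0: "0 < K" using K by linarith
  define \<psi> where "\<psi> = (\<lambda>x::'a. flat 0 ((R\<^sup>2 - (norm (x - z))\<^sup>2) / K))"
  have \<psi>0: "0 \<le> \<psi> x" for x by (simp add: \<psi>_def flat_bounds(1))
  have \<psi>_out: "\<psi> x = 0" if "R \<le> norm (x - z)" for x
  proof -
    have "R\<^sup>2 \<le> (norm (x - z))\<^sup>2" using that r by (intro power_mono) auto
    then show ?thesis unfolding \<psi>_def using K0 by (intro flat_bounds(2)) (simp add: divide_simps)
  qed
  have \<psi>: "\<psi> \<in> test_functions \<Omega>"
  proof (rule test_functionsI[OF _ compact_cball sub])
    fix k
    have "C_on k UNIV (\<lambda>x::'a. (1 / K) * (R\<^sup>2 - (norm (x - z))\<^sup>2))"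
      by (intro C_on_cmult C_on_diff C_on_const C_on_norm2) auto
    then have l: "C_on k UNIV (\<lambda>x::'a. (R\<^sup>2 - (norm (x - z))\<^sup>2) / K)" by simp
    show "C_on k UNIV \<psi>"
      unfolding \<psi>_def by (rule C_on_compose[OF open_UNIV open_UNIV C_on_flat l]) auto
  next
    fix x assume "x \<notin> cball z R"
    then show "\<psi> x = 0" by (intro \<psi>_out) (simp add: dist_norm norm_minus_commute)
  qed
  have neg: "hardy_op \<psi> x < 0" if "r \<le> norm (x - z)" "norm (x - z) < R" for x
  proof -
    have "0 < laplacian \<psi> x" unfolding \<psi>_def by (rule barrier_laplacian_pos[OF r(1) that K])
    moreover have "0 \<le> ((real DIM('a) - 2) / 2)\<^sup>2 * (\<psi> x / (norm x)\<^sup>2)"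
      using \<psi>0[of x] by (intro mult_nonneg_nonneg) auto
    ultimately show ?thesis by (simp add: hardy_op_def)
  qed
  have out: "hardy_op \<psi> x = 0" if "R \<le> norm (x - z)" for x
  proof -
    have "R\<^sup>2 \<le> (norm (x - z))\<^sup>2" using that r by (intro power_mono) auto
    then have "(R\<^sup>2 - (norm (x - z))\<^sup>2) / K \<le> 0" using K0 by (simp add: divide_simps)
    then have "laplacian \<psi> x = 0"
      unfolding \<psi>_def barrier_laplacian[OF K0] by (simp add: flat_bounds(2))
    then show ?thesis using \<psi>_out[OF that] by (simp add: hardy_op_def)
  qed
  have Oi: "integrable ?M (\<lambda>x. V x * hardy_op \<psi> x)" and O: "0 \<le> (LINT x|?M. V x * hardy_op \<psi> x)"
    using super[OF \<psi> \<psi>0] by blast+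
  have le0: "AE x in ?M. 0 \<le> - (V x * hardy_op \<psi> x)"
    using zero
  proof eventually_elim
    case (elim x)
    consider "norm (x - z) < r" | "r \<le> norm (x - z)" "norm (x - z) < R" | "R \<le> norm (x - z)"
      by linarith
    then show ?case
    proof cases
      case 1
      then show ?thesis using elim by (simp add: dist_norm norm_minus_commute)
    next
      case 2
      then show ?thesis using neg[OF 2] V[of x] by (simp add: mult_nonneg_nonpos)
    next
      case 3
      then show ?thesis by (simp add: out)
    qed
  qed
  have i: "integrable ?M (\<lambda>x. - (V x * hardy_op \<psi> x))" using Oi by simp
  have "0 \<le> (LINT x|?M. - (V x * hardy_op \<psi> x))" by (rule integral_nonneg_AE[OF le0])
  then have "(LINT x|?M. - (V x * hardy_op \<psi> x)) = 0" using O by simp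
  then have "AE x in ?M. - (V x * hardy_op \<psi> x) = 0"
    using integral_nonneg_eq_0_iff_AE[OF i le0] by simp
  with zero show ?thesis
  proof eventually_elim
    case (elim x)
    show ?case
    proof
      assume x: "x \<in> ball z R"
      show "V x = 0"
      proof (cases "x \<in> ball z r")
        case True
        then show ?thesis using elim(1) by simp
      next
        case False
        then have "hardy_op \<psi> x < 0" using x by (intro neg) (auto simp: dist_norm norm_minus_commute)
        then show ?thesis using elim(2) by simp
      qed
    qed
  qed
qed

lemma AE_zero_of_local:
  fixes V :: "'a::euclidean_space \<Rightarrow> real"
  assumes "\<And>x. x \<in> \<Omega> \<Longrightarrow> \<exists>r>0. AE y in lebesgue_on \<Omega>. y \<in> ball x r \<longrightarrow> V y = 0"
  shows "AE y in lebesgue_on \<Omega>. V y = 0"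
proof -
  obtain r where r: "\<And>x. x \<in> \<Omega> \<Longrightarrow> 0 < r x"
    "\<And>x. x \<in> \<Omega> \<Longrightarrow> AE y in lebesgue_on \<Omega>. y \<in> ball x (r x) \<longrightarrow> V y = 0"
    using assms by metis
  obtain \<F> where \<F>: "\<F> \<subseteq> (\<lambda>x. ball x (r x)) ` \<Omega>" "countable \<F>" "\<Union> \<F> = \<Union> ((\<lambda>x. ball x (r x)) ` \<Omega>)"
    using Lindelof[of "(\<lambda>x. ball x (r x)) ` \<Omega>"] by auto
  have "AE y in lebesgue_on \<Omega>. \<forall>B\<in>\<F>. y \<in> B \<longrightarrow> V y = 0"
    using \<F>(1,2) r(2) by (subst AE_ball_countable) auto
  moreover have "AE y in lebesgue_on \<Omega>. y \<in> \<Omega>"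
    by (rule AE_I2) (auto simp: space_restrict_space)
  ultimately show ?thesis
  proof eventually_elim
    case (elim y)
    then have "y \<in> \<Union> ((\<lambda>x. ball x (r x)) ` \<Omega>)" using r(1) by force
    then have "y \<in> \<Union> \<F>" using \<F>(3) by simp
    then show ?case using elim(1) by blast
  qed
qed

text \<open>The points near which \<open>V\<close> vanishes form an open set \<open>Z\<close>. It is closed in \<open>\<Omega>\<close> because \<open>V\<close> vanishes
  on every ball around a point of \<open>Z\<close> whose closure lies in \<open>\<Omega>\<close>, no matter how small the original
  neighbourhood was.\<close>

proposition supersolution_unique_continuation:
  fixes V :: "'a::euclidean_space \<Rightarrow> real"
  assumes dim: "DIM('a) \<ge> 3" and op: "open \<Omega>" and con: "connected \<Omega>"
    and V: "\<And>x. 0 \<le> V x"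
    and super: "\<And>\<psi>. \<psi> \<in> test_functions \<Omega> \<Longrightarrow> (\<And>x. 0 \<le> \<psi> x) \<Longrightarrow>
       integrable (lebesgue_on \<Omega>) (\<lambda>x. V x * hardy_op \<psi> x) \<and> 0 \<le> (LINT x|lebesgue_on \<Omega>. V x * hardy_op \<psi> x)"
    and start: "z0 \<in> \<Omega>" "0 < r0" "AE x in lebesgue_on \<Omega>. x \<in> ball z0 r0 \<longrightarrow> V x = 0"
  shows "AE x in lebesgue_on \<Omega>. V x = 0"
proof -
  let ?P = "\<lambda>z r. AE x in lebesgue_on \<Omega>. x \<in> ball z r \<longrightarrow> V x = 0"
  have mono: "?P z' r'" if "?P z r" "ball z' r' \<subseteq> ball z r" for z z' r r'
    using that(1) by (rule eventually_mono) (use that(2) in auto)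
  define Z where "Z = {z\<in>\<Omega>. \<exists>r>0. ?P z r}"
  have openZ: "open Z"
    unfolding open_contains_ball
  proof
    fix z assume "z \<in> Z"
    then obtain r where r: "z \<in> \<Omega>" "0 < r" "?P z r" by (auto simp: Z_def)
    obtain e where e: "0 < e" "ball z e \<subseteq> \<Omega>" using op r(1) open_contains_ball by blast
    show "\<exists>e>0. ball z e \<subseteq> Z"
    proof (intro exI conjI)
      show "0 < min e r" using e r by simp
      show "ball z (min e r) \<subseteq> Z"
      proof
        fix y assume y: "y \<in> ball z (min e r)"
        then have "y \<in> \<Omega>" using e(2) by auto
        moreover have "ball y (r - dist z y) \<subseteq> ball z r"
        proof
          fix v assume "v \<in> ball y (r - dist z y)"
          then show "v \<in> ball z r" using dist_triangle[of z v y] by simp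
        qed
        then have "?P y (r - dist z y)" by (rule mono[OF r(3)])
        moreover have "0 < r - dist z y" using y by simp
        ultimately show "y \<in> Z" unfolding Z_def by blast
      qed
    qed
  qed
  have openC: "open (\<Omega> - Z)"
    unfolding open_contains_ball
  proof
    fix x assume x: "x \<in> \<Omega> - Z"
    obtain e where e: "0 < e" "ball x e \<subseteq> \<Omega>" using op x open_contains_ball by blast
    \<comment> \<open>then \<open>x \<in> ball z (2 * d)\<close> and \<open>cball z (2 * d) \<subseteq> \<Omega>\<close> for all \<open>z \<in> ball x d\<close>\<close>
    define d where "d = e / 4"
    have d: "0 < d" using e by (simp add: d_def)
    have "z \<notin> Z" if z: "z \<in> ball x d" for z
    proof
      assume "z \<in> Z"
      then obtain r where r: "0 < r" "?P z r" by (auto simp: Z_def)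
      have "cball z (2 * d) \<subseteq> \<Omega>"
      proof
        fix v assume "v \<in> cball z (2 * d)"
        then have "dist x v < e" using z dist_triangle[of x v z] d by (simp add: d_def)
        then show "v \<in> \<Omega>" using e(2) by auto
      qed
      moreover have "?P z (min r d)" by (rule mono[OF r(2)]) auto
      ultimately have "?P z (2 * d)"
        using d r(1) by (intro supersolution_zero_spreads[OF dim _ _ _ V super, of "min r d" "2 * d" z]) auto
      then have "?P x d"
      proof (rule mono)
        show "ball x d \<subseteq> ball z (2 * d)"
        proof
          fix v assume "v \<in> ball x d"
          then show "v \<in> ball z (2 * d)" using z dist_triangle[of z v x] by (simp add: dist_commute)
        qed
      qed
      then have "x \<in> Z" using x d by (auto simp: Z_def)
      then show False using x by simp
    qed
    moreover have "ball x d \<subseteq> \<Omega>" using e by (auto simp: d_def)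
    ultimately show "\<exists>e>0. ball x e \<subseteq> \<Omega> - Z" using d by blast
  qed
  have "z0 \<in> Z" using start by (auto simp: Z_def)
  then have "Z = \<Omega>"
    using connectedD[OF con openZ openC] start(1) by (auto simp: Z_def)
  then show ?thesis by (intro AE_zero_of_local) (auto simp: Z_def)
qed

theorem proposition4p2:
  fixes \<Omega> :: "(real ^ 'n) set" and q :: real
  assumes "CARD('n) \<ge> 3"
    and "open \<Omega>" and "connected \<Omega>" and "bounded \<Omega>" and "0 \<in> \<Omega>"
    and "1 \<le> q" and "q < 2 * real CARD('n) / (real CARD('n) - 2)"
  shows "\<not> (\<exists>u. H_minimizer \<Omega> q u \<and> u \<in> H10_space \<Omega>)"
proof
  assume "\<exists>u. H_minimizer \<Omega> q u \<and> u \<in> H10_space \<Omega>"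
  then obtain u where min: "H_minimizer \<Omega> q u" and u: "u \<in> H10_space \<Omega>" by blast
  have dim: "DIM(real ^ 'n) \<ge> 3" and q: "q < 2 * real DIM(real ^ 'n) / (real DIM(real ^ 'n) - 2)"
    using assms(1,7) by simp_all
  have super: "integrable (lebesgue_on \<Omega>) (\<lambda>x. \<bar>u x\<bar> * hardy_op \<psi> x) \<and> 0 \<le> (LINT x|lebesgue_on \<Omega>. \<bar>u x\<bar> * hardy_op \<psi> x)"
    if "\<psi> \<in> test_functions \<Omega>" "\<And>x. 0 \<le> \<psi> x" for \<psi>
    using minimizer_abs_supersolution[OF dim assms(2,4) min assms(6) q that] by blast
  have um: "u \<in> borel_measurable (lebesgue_on \<Omega>)"
    using u by (auto simp: H10_space_def tendsto_Lp_def)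
  have u2: "integrable (lebesgue_on \<Omega>) (\<lambda>x. \<bar>u x\<bar>\<^sup>2 / (norm x)\<^sup>2)"
    using H10_integrable_divide_norm2[OF dim assms(2) u] by simp
  obtain R where R: "0 < R" "cball 0 R \<subseteq> \<Omega>"
    using assms(2,5) open_contains_cball by blast
  have "AE x in lebesgue_on \<Omega>. x \<in> ball 0 (exp (ln R)) \<longrightarrow> \<bar>u x\<bar> = 0"
    using um u2 super R by (intro supersolution_vanishes_near_0[OF dim assms(2)]) auto
  then have "AE x in lebesgue_on \<Omega>. \<bar>u x\<bar> = 0"
    using R super by (intro supersolution_unique_continuation[OF dim assms(2,3) _ _ assms(5), of _ R]) auto
  then have "AE x in lebesgue_on \<Omega>. u x = 0" by simp
  moreover have "\<not> (AE x in lebesgue_on \<Omega>. u x = 0)"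
    using min by (auto simp: H_minimizer_def is_arg_min_def)
  ultimately show False by blast
qed

end
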